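(* Let $K$ be a finite abelian extension of $k$. Let $n,m\in\mathbb{N}$ and $N\in R_T$ be such that $K\subseteq {}_nk(\Lambda_N)_m$ and such that $m$ is minimum with this property (for the given $n$ and $N$). Let $F=K\cap {}_nk(\Lambda_N)$, let $t=f_\infty(K/k)=f_\infty(K/F)$ be the degree of the infinite primes of $K$, let $R=K_m\cap {}_nk(\Lambda_N)$ and $d^{\ast}=f_\infty(RK/K)$. Then $$m=t\,e_\infty(K/F)=t\,d^{\ast}=f_\infty(RK/k).$$ In particular $$d^{\ast}=f_\infty(RK/K)=e_\infty(K/F).$$
   Context: $k=\mathbb{F}_q(T)$ is a global rational function field of characteristic $p$, $R_T=\mathbb{F}_q[T]$, and $P_\infty$ (the infinite prime) is the pole of $T$ in $k$. For nonzero $N\in R_T$, $k(\Lambda_N)$ is the $N$-th Carlitz cyclotomic function field. $L_n$ denotes the subfield of degree $q^n$ over $k$ of $k(\Lambda_{1/T^{n+1}})$, the cyclotomic function field of modulus $(1/T)^{n+1}$ constructed with $\mathbb{F}_q[1/T]$ in place of $\mathbb{F}_q[T]$ (so $L_n$ is the fixed field of $\mathbb{F}_q^*$). ${}_nk(\Lambda_N):=L_n\,k(\Lambda_N)$, ${}_nk(\Lambda_N)_m:=L_n\,k(\Lambda_N)\,\mathbb{F}_{q^m}$, and $K_m:=K\,\mathbb{F}_{q^m}$. By the Kronecker--Weber theorem every finite abelian extension of $k$ is contained in some ${}_nk(\Lambda_N)_m$. The minimum $m$ (which does not depend on $n$ and $N$) is called the conductor of constants of $K/k$. For finite abelian extensions,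 $e_\infty(A/B)$ and $f_\infty(A/B)$ are the ramification index and inertia degree in $A/B$ of the primes of $B$ above $P_\infty$. *)

theory Defs
  imports "HOL-Algebra.Algebraic_Closure_Type" "HOL-Algebra.Generated_Fields" "HOL-Library.Cardinality"
begin

text \<open>
  All fields under consideration are subfields of one fixed algebraic closure of
  \<open>k = \<F>\<^sub>q(T)\<close>. Here \<open>\<F>\<^sub>q\<close> is the type \<open>'a\<close>, an arbitrary finite field with
  \<open>q = CARD('a)\<close>, and \<open>R\<^sub>T\<close> is \<open>'a poly\<close>.
\<close>

type_synonym 'a kbar = "'a poly fract alg_closure"

abbreviation Amb :: "'b::field ring"
  where "Amb \<equiv> ring_of_type_algebra"


section \<open>Subfields, Galois groups, composites\<close>

definition compositum :: "'b::field set \<Rightarrow> 'b set \<Rightarrow> 'b set"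
  where "compositum A B = generate_field Amb (A \<union> B)"

definition Gal :: "'b::field set \<Rightarrow> 'b set \<Rightarrow> ('b \<Rightarrow> 'b) set"
  where "Gal L E = {\<sigma> \<in> ring_iso (Amb\<lparr>carrier := L\<rparr>) (Amb\<lparr>carrier := L\<rparr>). \<forall>x\<in>E. \<sigma> x = x}"

definition fixed_field :: "'b::field set \<Rightarrow> ('b \<Rightarrow> 'b) set \<Rightarrow> 'b set"
  where "fixed_field L H = {x \<in> L. \<forall>\<sigma>\<in>H. \<sigma> x = x}"

definition finite_abelian_extension :: "'b::field set \<Rightarrow> 'b set \<Rightarrow> bool"
  where "finite_abelian_extension L E \<longleftrightarrow>
    subfield E Amb \<and> subfield L Amb \<and> E \<subseteq> L \<and>
    ring.finite_dimension Amb E L \<and>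
    fixed_field L (Gal L E) = E \<and>
    (\<forall>\<sigma>\<in>Gal L E. \<forall>\<tau>\<in>Gal L E. \<forall>x\<in>L. \<sigma> (\<tau> x) = \<tau> (\<sigma> x))"


section \<open>The rational function field and its constant extensions\<close>

definition k_field :: "'a::{field,finite} kbar set"
  where "k_field = range to_ac"

definition const :: "'a::{field,finite} \<Rightarrow> 'a kbar"
  where "const a = to_ac (Fract [:a:] 1)"

definition T_elem :: "'a::{field,finite} kbar"
  where "T_elem = to_ac (Fract [:0, 1:] 1)"

text \<open>The copy of \<open>\<F>\<^bsub>q^m\<^esub>\<close> in the algebraic closure; only meaningful for \<open>m \<ge> 1\<close>.\<close>

definition Fqm :: "nat \<Rightarrow> 'a::{field,finite} kbar set"
  where "Fqm m = {x. x ^ (CARD('a) ^ m) = x}"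

definition const_ext :: "'a::{field,finite} kbar set \<Rightarrow> nat \<Rightarrow> 'a kbar set"
  where "const_ext A m = compositum A (Fqm m)"


section \<open>Carlitz cyclotomic function fields\<close>

text \<open>
  The Carlitz action of a polynomial \<open>M\<close> over \<open>\<F>\<^sub>q\<close>, the indeterminate acting by
  \<open>x \<mapsto> x\<^sup>q + \<theta> x\<close>. For \<open>\<theta> = T\<close> this is the usual module structure over \<open>\<F>\<^sub>q[T]\<close>;
  for \<open>\<theta> = 1/T\<close> it is the structure over \<open>\<F>\<^sub>q[1/T]\<close>, the polynomial \<open>M\<close> then
  standing for the element \<open>M(1/T)\<close>.
\<close>

definition carlitz :: "'a::{field,finite} kbar \<Rightarrow> 'a poly \<Rightarrow> 'a kbar \<Rightarrow> 'a kbar"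
  where "carlitz \<theta> M u =
    (\<Sum>i\<le>Polynomial.degree M.
       const (Polynomial.coeff M i) * ((\<lambda>x. x ^ CARD('a) + \<theta> * x) ^^ i) u)"

definition Carlitz_torsion :: "'a::{field,finite} kbar \<Rightarrow> 'a poly \<Rightarrow> 'a kbar set"
  where "Carlitz_torsion \<theta> M = {u. carlitz \<theta> M u = 0}"

definition cyclotomic_field :: "'a::{field,finite} kbar \<Rightarrow> 'a poly \<Rightarrow> 'a kbar set"
  where "cyclotomic_field \<theta> M = generate_field Amb (k_field \<union> Carlitz_torsion \<theta> M)"

text \<open>
  \<open>k(\<Lambda>)\<close> with \<open>\<Lambda>\<close> the torsion of \<open>(1/T)\<^bsup>n+1\<^esup>\<close> has Galois group
  \<open>(\<F>\<^sub>q[1/T]/(1/T)\<^bsup>n+1\<^esup>)\<^sup>*\<close>, in which \<open>a \<in> \<F>\<^sub>q\<^sup>*\<close> is the automorphism with \<open>\<lambda> \<mapsto> a \<lambda>\<close>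
  on \<open>\<Lambda>\<close>. The fixed field of \<open>\<F>\<^sub>q\<^sup>*\<close> is the only subfield of degree \<open>q\<^sup>n\<close> over \<open>k\<close>,
  the Galois group being abelian of order \<open>(q - 1) q\<^sup>n\<close>.
\<close>

definition L_field :: "nat \<Rightarrow> 'a::{field,finite} kbar set"
  where "L_field n =
    (let \<theta> = inverse T_elem; M = Polynomial.monom 1 (n + 1);
         \<Lambda> = Carlitz_torsion \<theta> M; C = cyclotomic_field \<theta> M
     in fixed_field C
          {\<sigma> \<in> Gal C k_field. \<exists>a::'a. a \<noteq> 0 \<and> (\<forall>u\<in>\<Lambda>. \<sigma> u = const a * u)})"

definition nk_field :: "nat \<Rightarrow> 'a::{field,finite} poly \<Rightarrow> 'a kbar set"
  where "nk_field n N = compositum (L_field n) (cyclotomic_field T_elem N)"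


section \<open>Primes, ramification indices and inertia degrees\<close>

text \<open>
  A prime of \<open>A\<close> is given by its normalized valuation. Values outside \<open>A - {0}\<close> are
  irrelevant. Triviality on the constants is automatic: every nonzero element of a finite
  field has finite multiplicative order.
\<close>

definition prime_valuation :: "'b::field set \<Rightarrow> ('b \<Rightarrow> int) \<Rightarrow> bool"
  where "prime_valuation A v \<longleftrightarrow>
    (\<forall>x\<in>A - {0}. \<forall>y\<in>A - {0}. v (x * y) = v x + v y) \<and>
    (\<forall>x\<in>A - {0}. \<forall>y\<in>A - {0}. x + y \<noteq> 0 \<longrightarrow> v (x + y) \<ge> min (v x) (v y)) \<and>
    v ` (A - {0}) = UNIV"

definition has_ram_index :: "('b::field \<Rightarrow> int) \<Rightarrow> 'b set \<Rightarrow> ('b \<Rightarrow> int) \<Rightarrow> nat \<Rightarrow> bool"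
  where "has_ram_index v B w e \<longleftrightarrow> e > 0 \<and> (\<forall>x\<in>B - {0}. v x = int e * w x)"

definition lies_over :: "('b::field \<Rightarrow> int) \<Rightarrow> 'b set \<Rightarrow> ('b \<Rightarrow> int) \<Rightarrow> bool"
  where "lies_over v B w \<longleftrightarrow> (\<exists>e. has_ram_index v B w e)"

definition ram_index :: "('b::field \<Rightarrow> int) \<Rightarrow> 'b set \<Rightarrow> ('b \<Rightarrow> int) \<Rightarrow> nat"
  where "ram_index v B w = (THE e. has_ram_index v B w e)"

definition val_ring :: "'b::field set \<Rightarrow> ('b \<Rightarrow> int) \<Rightarrow> 'b set"
  where "val_ring A v = {x \<in> A. x = 0 \<or> v x \<ge> 0}"

definition val_ideal :: "'b::field set \<Rightarrow> ('b \<Rightarrow> int) \<Rightarrow> 'b set"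
  where "val_ideal A v = {x \<in> A. x = 0 \<or> v x > 0}"

definition residue_field :: "'b::field set \<Rightarrow> ('b \<Rightarrow> int) \<Rightarrow> 'b set ring"
  where "residue_field A v = (Amb\<lparr>carrier := val_ring A v\<rparr>) Quot (val_ideal A v)"

text \<open>
  The residue field of \<open>w\<close> enters as its image in the residue field of \<open>v\<close>.
\<close>

definition inertia_degree ::
    "'b::field set \<Rightarrow> ('b \<Rightarrow> int) \<Rightarrow> 'b set \<Rightarrow> ('b \<Rightarrow> int) \<Rightarrow> nat"
  where "inertia_degree A v B w =
    ring.dim (residue_field A v)
      ((\<lambda>x. val_ideal A v +>\<^bsub>Amb\<lparr>carrier := val_ring A v\<rparr>\<^esub> x) ` val_ring B w)
      (carrier (residue_field A v))"

text \<open>The valuation at the pole of \<open>T\<close>: \<open>f/g \<mapsto> deg g - deg f\<close>.\<close>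

definition inf_val :: "'a::{field,finite} kbar \<Rightarrow> int"
  where "inf_val x = (THE z. \<exists>f g. f \<noteq> 0 \<and> g \<noteq> 0 \<and> x = to_ac (Fract f g) \<and>
    z = int (Polynomial.degree g) - int (Polynomial.degree f))"

definition infinite_prime :: "'a::{field,finite} kbar set \<Rightarrow> ('a kbar \<Rightarrow> int) \<Rightarrow> bool"
  where "infinite_prime A v \<longleftrightarrow> prime_valuation A v \<and> lies_over v k_field inf_val"

text \<open>
  For \<open>k \<subseteq> B \<subseteq> A\<close> with \<open>A/k\<close> finite abelian, all infinite primes have the same ramification
  index and the same inertia degree in \<open>A/B\<close>; the following are these common values.
\<close>

definition e_inf :: "'a::{field,finite} kbar set \<Rightarrow> 'a kbar set \<Rightarrow> nat"
  where "e_inf A B = (THE e. \<forall>v w. infinite_prime A v \<and> infinite_prime B w \<and> lies_over v B w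
    \<longrightarrow> ram_index v B w = e)"

definition f_inf :: "'a::{field,finite} kbar set \<Rightarrow> 'a kbar set \<Rightarrow> nat"
  where "f_inf A B = (THE f. \<forall>v w. infinite_prime A v \<and> infinite_prime B w \<and> lies_over v B w
    \<longrightarrow> inertia_degree A v B w = f)"


section \<open>Sanity checks\<close>

lemma inf_val_Fract:
  fixes f g :: "'a::{field,finite} poly"
  assumes "f \<noteq> 0" "g \<noteq> 0"
  shows "inf_val (to_ac (Fract f g)) = int (Polynomial.degree g) - int (Polynomial.degree f)"
  unfolding inf_val_def
proof (rule the_equality)
  show "\<exists>f' g'. f' \<noteq> 0 \<and> g' \<noteq> 0 \<and> to_ac (Fract f g) = to_ac (Fract f' g') \<and>
    int (Polynomial.degree g) - int (Polynomial.degree f) =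
    int (Polynomial.degree g') - int (Polynomial.degree f')"
    using assms by blast
next
  fix z
  assume "\<exists>f' g'. f' \<noteq> 0 \<and> g' \<noteq> 0 \<and> to_ac (Fract f g) = to_ac (Fract f' g') \<and>
    z = int (Polynomial.degree g') - int (Polynomial.degree f')"
  then obtain f' g' where *: "f' \<noteq> 0" "g' \<noteq> 0" "Fract f g = Fract f' g'"
    "z = int (Polynomial.degree g') - int (Polynomial.degree f')"
    by auto
  have "f * g' = f' * g"
    using * assms by (simp add: eq_fract)
  then have "Polynomial.degree f + Polynomial.degree g' =
      Polynomial.degree f' + Polynomial.degree g"
    using * assms by (metis degree_mult_eq)
  with * show "z = int (Polynomial.degree g) - int (Polynomial.degree f)"
    by linarith
qed

lemma prime_valuation_inf_val:
  "prime_valuation (k_field :: 'a::{field,finite} kbar set) inf_val"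
proof -
  have rep: "\<exists>f g. f \<noteq> 0 \<and> g \<noteq> 0 \<and> x = to_ac (Fract f g)"
    if x: "x \<in> k_field - {0}" for x :: "'a kbar"
  proof -
    obtain r where r: "x = to_ac r" "r \<noteq> 0"
      using x by (auto simp: k_field_def)
    obtain f g where fg: "r = Fract f g" "g \<noteq> 0"
      by (cases r) auto
    have "f \<noteq> 0"
      using fg r by (auto simp: Zero_fract_def eq_fract)
    with fg r show ?thesis by blast
  qed
  have mult: "inf_val (x * y) = inf_val x + inf_val y"
    if xy: "x \<in> k_field - {0}" "y \<in> k_field - {0}" for x y :: "'a kbar"
  proof -
    obtain f g where x: "f \<noteq> 0" "g \<noteq> 0" "x = to_ac (Fract f g)"
      using rep[OF xy(1)] by blast
    obtain f' g' where y: "f' \<noteq> 0" "g' \<noteq> 0" "y = to_ac (Fract f' g')"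
      using rep[OF xy(2)] by blast
    note * = x y
    have "x * y = to_ac (Fract (f * f') (g * g'))"
      using * by (simp flip: to_ac_mult)
    then show ?thesis
      using * by (simp add: inf_val_Fract degree_mult_eq)
  qed
  have add: "inf_val (x + y) \<ge> min (inf_val x) (inf_val y)"
    if xy: "x \<in> k_field - {0}" "y \<in> k_field - {0}" "x + y \<noteq> 0" for x y :: "'a kbar"
  proof -
    obtain f g where x: "f \<noteq> 0" "g \<noteq> 0" "x = to_ac (Fract f g)"
      using rep[OF xy(1)] by blast
    obtain f' g' where y: "f' \<noteq> 0" "g' \<noteq> 0" "y = to_ac (Fract f' g')"
      using rep[OF xy(2)] by blast
    note * = x y
    have s: "x + y = to_ac (Fract (f * g' + f' * g) (g * g'))"
      using * by (simp flip: to_ac_add)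
    have nz: "f * g' + f' * g \<noteq> 0"
      using xy(3) s by (metis fract_collapse(1) to_ac_0)
    have "Polynomial.degree (f * g' + f' * g) \<le>
        max (Polynomial.degree f + Polynomial.degree g') (Polynomial.degree f' + Polynomial.degree g)"
      using degree_add_le_max[of "f * g'" "f' * g"] * by (simp add: degree_mult_eq)
    moreover have "inf_val (x + y) = int (Polynomial.degree g) + int (Polynomial.degree g') -
        int (Polynomial.degree (f * g' + f' * g))"
      unfolding s using * nz by (simp add: inf_val_Fract degree_mult_eq)
    moreover have "inf_val x = int (Polynomial.degree g) - int (Polynomial.degree f)"
      "inf_val y = int (Polynomial.degree g') - int (Polynomial.degree f')"
      using * by (simp_all add: inf_val_Fract)
    ultimately show ?thesis by linarith
  qed
  have surj: "z \<in> inf_val ` (k_field - {0} :: 'a kbar set)" for z :: int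
  proof -
    define f g :: "'a poly" where
      "f = Polynomial.monom 1 (nat (- z))" and "g = Polynomial.monom 1 (nat z)"
    have fg: "f \<noteq> 0" "g \<noteq> 0"
      by (auto simp: f_def g_def)
    have "inf_val (to_ac (Fract f g)) = z"
      using fg by (simp add: inf_val_Fract) (simp add: f_def g_def Polynomial.degree_monom_eq)
    moreover have "to_ac (Fract f g) \<in> k_field - {0}"
      using fg by (auto simp: k_field_def Zero_fract_def eq_fract)
    ultimately show ?thesis by (metis imageI)
  qed
  show ?thesis
    unfolding prime_valuation_def using mult add surj by blast
qed

end

theory Submission
  imports Defs
begin

text \<open>
  Every infinite prime of a field \<open>A \<supseteq> k\<close> extends to an absolute value of the algebraic closure (Chevalley), and for
  each such absolute value \<open>E = \<^sub>nk(\<Lambda>\<^sub>N)\<close> has residue field \<open>\<F>\<^sub>q\<close>: if \<open>\<lambda>\<close> generates the torsion of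
  \<open>(1/T)\<^bsup>n+1\<^esup>\<close>, then \<open>E\<close> lies in the closure of \<open>\<F>\<^sub>q[\<lambda>, 1/\<lambda>]\<close>. Hence \<open>E\<^sub>m = E \<F>\<^bsub>q^m\<^esub>\<close> is
  unramified over \<open>E\<close> with a single prime above each infinite prime of \<open>E\<close>, and the Frobenius \<open>\<phi>\<close> of \<open>E\<^sub>m/E\<close>
  is an isometry. By the minimality of \<open>m\<close>, \<open>\<phi>\<close> has order exactly \<open>m\<close> on \<open>K\<close> and on \<open>R K\<close>, with fixed fields \<open>F\<close>
  and \<open>R\<close>, so \<open>e f = m\<close> for \<open>K/F\<close> and for \<open>R K/R\<close>. A trace argument shows that \<open>R\<close> and \<open>K\<^sub>m\<close> have the same value
  group, so the residue degree of \<open>R K\<close> is \<open>m\<close>. Multiplicativity of residue degrees gives the rest, once the infinite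
  primes of \<open>K\<close> are known to be conjugate.
\<close>

section \<open>Subfields and linear algebra\<close>

text \<open>No completion is formed: local arguments take place inside the algebraic closure, under
  a real absolute value with \<open>N T_elem = 2\<close>, and limits are replaced by approximation
  to any precision. One absolute value restricts to all subfields, so the value groups and residue
  fields of \<open>K\<close>, \<open>F\<close>, \<open>R\<close> and \<open>R K\<close> can be
  compared directly. Residue fields are represented by subsets of \<open>Fqm m\<close>, whose
  nonzero elements have absolute value 1, and residue degrees are read off from cardinalities. The
  small residue field of \<open>E\<close> also makes \<open>E\<close> and \<open>Fqm m\<close>
  linearly disjoint over the constants, which is what makes the Frobenius well defined. Since
  \<open>f_inf\<close> and \<open>e_inf\<close> quantify over all pairs of infinite primes, each
  count has to be made for every absolute value. The residue fields of \<open>k\<close> and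
  \<open>F\<close> have \<open>q\<close> elements and that of \<open>R K\<close> has
  \<open>q ^ m\<close> under each of them; only for \<open>K\<close> could the number depend on the
  prime, and this is where conjugacy enters.\<close>

interpretation Amb: ring Amb
  by (rule ring_from_type_algebra)

lemma Amb_simps [simp]:
  "carrier Amb = UNIV" "\<zero>\<^bsub>Amb\<^esub> = 0" "\<one>\<^bsub>Amb\<^esub> = 1"
  "x \<otimes>\<^bsub>Amb\<^esub> y = x * y" "x \<oplus>\<^bsub>Amb\<^esub> y = x + y"
  by (auto simp: ring_of_type_algebra_def)

lemma Amb_a_inv [simp]: "\<ominus>\<^bsub>Amb\<^esub> x = - (x :: 'b::field)"
  by (rule Amb.minus_equality) auto

lemma Amb_m_inv [simp]: "x \<noteq> 0 \<Longrightarrow> inv\<^bsub>Amb\<^esub> x = inverse (x :: 'b::field)"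
  by (rule comm_monoid.comm_inv_char[OF cring.axioms(2)[OF cring_from_type_algebra]]) auto

text \<open>Because \<open>inverse 0 = 0\<close>, closure under \<open>inverse\<close> carries no
  side condition; the \<open>sf_intros\<close> rules rely on this form.\<close>

lemma subfield_Amb_iff:
  fixes A :: "'b::field set"
  shows "subfield A Amb \<longleftrightarrow> 1 \<in> A \<and> (\<forall>x\<in>A. \<forall>y\<in>A. x + y \<in> A \<and> x * y \<in> A)
    \<and> (\<forall>x\<in>A. - x \<in> A \<and> inverse x \<in> A)"
proof
  assume A: "subfield A Amb"
  note S = subringE[OF subfieldE(1)[OF A], simplified]
  have "inverse x \<in> A" if "x \<in> A" for x
    using Amb.subfield_m_inv(1)[OF A, of x] that S(2) by (cases "x = 0") auto
  then show "1 \<in> A \<and> (\<forall>x\<in>A. \<forall>y\<in>A. x + y \<in> A \<and> x * y \<in> A) \<and> (\<forall>x\<in>A. - x \<in> A \<and> inverse x \<in> A)"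
    using S by auto
next
  assume A: "1 \<in> A \<and> (\<forall>x\<in>A. \<forall>y\<in>A. x + y \<in> A \<and> x * y \<in> A) \<and> (\<forall>x\<in>A. - x \<in> A \<and> inverse x \<in> A)"
  show "subfield A Amb"
  proof (rule field.subfieldI'[OF field_from_type_algebra])
    show "subring A Amb"
      by (rule Amb.subringI) (use A in auto)
  qed (use A in auto)
qed

named_theorems sf_intros

lemma sf_1 [sf_intros]: "subfield A Amb \<Longrightarrow> 1 \<in> A"
  and sf_add [sf_intros]: "subfield A Amb \<Longrightarrow> x \<in> A \<Longrightarrow> y \<in> A \<Longrightarrow> x + y \<in> A"
  and sf_mult [sf_intros]: "subfield A Amb \<Longrightarrow> x \<in> A \<Longrightarrow> y \<in> A \<Longrightarrow> x * y \<in> A"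
  and sf_uminus [sf_intros]: "subfield A Amb \<Longrightarrow> x \<in> A \<Longrightarrow> - x \<in> A"
  and sf_inverse [sf_intros]: "subfield A Amb \<Longrightarrow> x \<in> A \<Longrightarrow> inverse x \<in> A"
  by (auto simp: subfield_Amb_iff)

lemma sf_0 [sf_intros]: "subfield A Amb \<Longrightarrow> 0 \<in> A"
  using sf_add[of A 1 "- 1"] sf_1[of A] sf_uminus[of A 1] by simp

lemma sf_diff [sf_intros]: "subfield A Amb \<Longrightarrow> x \<in> A \<Longrightarrow> y \<in> A \<Longrightarrow> x - y \<in> A"
  using sf_add[of A x "- y"] sf_uminus[of A y] by simp

lemma sf_divide [sf_intros]: "subfield A Amb \<Longrightarrow> x \<in> A \<Longrightarrow> y \<in> A \<Longrightarrow> x / y \<in> A"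
  by (simp add: divide_inverse sf_mult sf_inverse)

lemma sf_power [sf_intros]: "subfield A Amb \<Longrightarrow> x \<in> A \<Longrightarrow> x ^ n \<in> A"
  by (induction n) (auto intro: sf_intros)

lemma sf_powi [sf_intros]: "subfield A Amb \<Longrightarrow> x \<in> A \<Longrightarrow> x powi i \<in> A"
  by (auto simp: power_int_def intro: sf_intros)

lemma sf_sum [sf_intros]: "subfield A Amb \<Longrightarrow> (\<And>i. i \<in> I \<Longrightarrow> f i \<in> A) \<Longrightarrow> sum f I \<in> A"
  by (induction I rule: infinite_finite_induct) (auto intro: sf_intros)

lemma sf_prod [sf_intros]: "subfield A Amb \<Longrightarrow> (\<And>i. i \<in> I \<Longrightarrow> f i \<in> A) \<Longrightarrow> prod f I \<in> A"
  by (induction I rule: infinite_finite_induct) (auto intro: sf_intros)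

lemma subfieldI_Amb:
  fixes A :: "'b::field set"
  assumes "1 \<in> A" "\<And>x y. x \<in> A \<Longrightarrow> y \<in> A \<Longrightarrow> x + y \<in> A" "\<And>x y. x \<in> A \<Longrightarrow> y \<in> A \<Longrightarrow> x * y \<in> A"
    "\<And>x. x \<in> A \<Longrightarrow> - x \<in> A" "\<And>x. x \<in> A \<Longrightarrow> x \<noteq> 0 \<Longrightarrow> inverse x \<in> A"
  shows "subfield A Amb"
  unfolding subfield_Amb_iff
proof (intro conjI ballI)
  fix x assume "x \<in> A"
  then show "inverse x \<in> A" using assms(5)[of x] by (cases "x = 0") auto
qed (use assms in auto)

lemma subfield_generate_field: "subfield (generate_field Amb H) Amb"
  by (rule field.generate_field_is_subfield[OF field_from_type_algebra]) auto

lemma generate_field_least: "subfield E Amb \<Longrightarrow> H \<subseteq> E \<Longrightarrow> generate_field Amb H \<subseteq> E"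
  by (rule field.generate_field_min_subfield1[OF field_from_type_algebra]) auto

lemma subset_generate_field: "H \<subseteq> generate_field Amb H"
  by (auto intro: generate_field.incl)

lemma subfield_compositum: "subfield (compositum A B) Amb"
  and compositum_left: "A \<subseteq> compositum A B"
  and compositum_right: "B \<subseteq> compositum A B"
  and compositum_least: "subfield E Amb \<Longrightarrow> A \<subseteq> E \<Longrightarrow> B \<subseteq> E \<Longrightarrow> compositum A B \<subseteq> E"
  unfolding compositum_def
  using subfield_generate_field subset_generate_field[of "A \<union> B"] generate_field_least[of E "A \<union> B"]
  by auto

lemma subfield_Int: "subfield A Amb \<Longrightarrow> subfield B Amb \<Longrightarrow> subfield (A \<inter> B) Amb"
  by (auto simp: subfield_Amb_iff)

text \<open>Elimination, by induction on the equations: an unknown with a nonzero coefficient in the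
  new equation is solved for and substituted into the others, which leaves fewer equations than
  unknowns. Both bounds in \<open>e * f = m\<close> start from such a solution with entries in a
  given subfield.\<close>

lemma homogeneous_system:
  fixes a :: "'j \<Rightarrow> 'i \<Rightarrow> 'b::field"
  assumes "finite J" "finite I" "card J < card I" and A: "subfield A Amb"
    and "\<And>j i. j \<in> J \<Longrightarrow> i \<in> I \<Longrightarrow> a j i \<in> A"
  shows "\<exists>c. (\<forall>i\<in>I. c i \<in> A) \<and> (\<exists>i\<in>I. c i \<noteq> 0) \<and> (\<forall>j\<in>J. (\<Sum>i\<in>I. c i * a j i) = 0)"
  using assms(1,2,3,5)
proof (induction J arbitrary: I a rule: finite_induct)
  case empty
  then have "I \<noteq> {}" by auto
  then show ?case by (intro exI[of _ "\<lambda>_. 1"]) (auto intro: sf_intros A)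
next
  case (insert j J)
  show ?case
  proof (cases "\<forall>i\<in>I. a j i = 0")
    case True
    have "card J < card I" using insert by auto
    then obtain c where "\<forall>i\<in>I. c i \<in> A" "\<exists>i\<in>I. c i \<noteq> 0" "\<forall>j\<in>J. (\<Sum>i\<in>I. c i * a j i) = 0"
      using insert.IH[of I a] insert.prems by auto
    then show ?thesis using True by (intro exI[of _ c]) auto
  next
    case False
    then obtain i0 where i0: "i0 \<in> I" "a j i0 \<noteq> 0" by auto
    define I' where "I' = I - {i0}"
    have I: "I = insert i0 I'" "i0 \<notin> I'" "finite I'" using i0 insert.prems by (auto simp: I'_def)
    have "card J < card I'" using insert.prems insert.hyps I by auto
    then obtain c where c: "\<forall>i\<in>I'. c i \<in> A" "\<exists>i\<in>I'. c i \<noteq> 0"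
      "\<forall>j'\<in>J. (\<Sum>i\<in>I'. c i * (a j' i - a j' i0 * a j i / a j i0)) = 0"
      using insert.IH[of I' "\<lambda>j' i. a j' i - a j' i0 * a j i / a j i0"] insert.prems i0 I A
      by (auto intro!: sf_intros)
    \<comment> \<open>The eliminated unknown gets the value forced by equation \<open>j\<close>; the
      others keep the solution of the reduced system.\<close>
    define d where "d = (\<lambda>i. if i = i0 then - (\<Sum>i\<in>I'. c i * a j i) / a j i0 else c i)"
    have dI: "(\<Sum>i\<in>I. d i * a j' i) = d i0 * a j' i0 + (\<Sum>i\<in>I'. c i * a j' i)" for j'
    proof -
      have "(\<Sum>i\<in>I'. d i * a j' i) = (\<Sum>i\<in>I'. c i * a j' i)"
        by (rule sum.cong) (use I in \<open>auto simp: d_def\<close>)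
      then show ?thesis using I by simp
    qed
    have "(\<Sum>i\<in>I. d i * a j i) = 0"
      unfolding dI using i0 by (simp add: d_def)
    moreover have "(\<Sum>i\<in>I. d i * a j' i) = 0" if "j' \<in> J" for j'
    proof -
      have "(\<Sum>i\<in>I. d i * a j' i) = (\<Sum>i\<in>I'. c i * a j' i) - (\<Sum>i\<in>I'. c i * a j i) * (a j' i0 / a j i0)"
        unfolding dI by (simp add: d_def)
      also have "\<dots> = (\<Sum>i\<in>I'. c i * (a j' i - a j' i0 * a j i / a j i0))"
        by (simp add: sum_distrib_left sum_distrib_right sum_divide_distrib sum_subtractf algebra_simps)
      finally show ?thesis using c(3) that by simp
    qed
    moreover have "d i0 \<in> A" using A c i0 insert.prems I
      by (auto simp: d_def intro!: sf_intros)
    ultimately show ?thesis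
      using c(1,2) I by (intro exI[of _ d]) (auto simp: d_def)
  qed
qed

text \<open>Artin's argument: subtracting \<open>\<sigma> k y\<close> times the relation at
  \<open>x\<close> from the relation at \<open>y * x\<close> removes the term of index
  \<open>k\<close>, and a \<open>y\<close> that separates \<open>i\<close> from \<open>k\<close>
  then kills \<open>c i\<close>. Evaluation at 1 disposes of the last coefficient.\<close>

lemma dedekind_independence:
  fixes \<sigma> :: "'i \<Rightarrow> 'b::field \<Rightarrow> 'b"
  assumes "finite I" 
    and "\<And>i x y. i \<in> I \<Longrightarrow> x \<in> A \<Longrightarrow> y \<in> A \<Longrightarrow> \<sigma> i (x * y) = \<sigma> i x * \<sigma> i y"
    and "\<And>x y. x \<in> A \<Longrightarrow> y \<in> A \<Longrightarrow> x * y \<in> A" 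
    and one: "1 \<in> A" "\<And>i. i \<in> I \<Longrightarrow> \<sigma> i 1 = 1"
    and "\<And>i j. i \<in> I \<Longrightarrow> j \<in> I \<Longrightarrow> i \<noteq> j \<Longrightarrow> \<exists>x\<in>A. \<sigma> i x \<noteq> \<sigma> j x"
    and "\<And>x. x \<in> A \<Longrightarrow> (\<Sum>i\<in>I. c i * \<sigma> i x) = 0"
  shows "\<forall>i\<in>I. c i = 0"
  using assms(1,2,5,6,7)
proof (induction I arbitrary: c rule: finite_induct)
  case empty
  then show ?case by simp
next
  case (insert k I)
  have *: "c i * (\<sigma> i y - \<sigma> k y) = 0" if i: "i \<in> I" and y: "y \<in> A" for i y
  proof -
    have "(\<Sum>i\<in>I. (c i * (\<sigma> i y - \<sigma> k y)) * \<sigma> i x) = 0" if x: "x \<in> A" for x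
    proof -
      have "(\<Sum>i\<in>insert k I. c i * \<sigma> i (y * x)) - \<sigma> k y * (\<Sum>i\<in>insert k I. c i * \<sigma> i x) = 0"
        using insert.prems(4) x y assms(3) by simp
      moreover have "(\<Sum>i\<in>insert k I. c i * \<sigma> i (y * x)) = (\<Sum>i\<in>insert k I. c i * (\<sigma> i y * \<sigma> i x))"
        by (rule sum.cong) (use insert.prems x y in auto)
      ultimately show ?thesis using insert.hyps
        by (simp add: sum_distrib_left sum_subtractf algebra_simps)
    qed
    then have "\<forall>i\<in>I. c i * (\<sigma> i y - \<sigma> k y) = 0"
      by (intro insert.IH) (use insert.prems in auto)
    then show ?thesis using i by blast
  qed
  have I0: "c i = 0" if i: "i \<in> I" for i
  proof -
    obtain y where "y \<in> A" "\<sigma> i y \<noteq> \<sigma> k y"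
      using insert.prems(3)[of i k] insert.hyps i by auto
    then show ?thesis using *[OF i] by auto
  qed
  have "(\<Sum>i\<in>insert k I. c i * \<sigma> i 1) = 0" using insert.prems one by blast
  then have "c k = 0" using I0 insert.hyps insert.prems by simp
  then show ?case using I0 by auto
qed

section \<open>Finite fields in the algebraic closure\<close>

lemma const_1 [simp]: "const 1 = 1"
proof -
  have "Fract [:1 :: 'a:] 1 = 1" by (simp add: One_fract_def one_pCons)
  then show "const 1 = (1 :: 'a kbar)" by (simp add: const_def)
qed

lemma const_simps [simp]:
  "const 0 = 0" "const (a + b) = const a + const b" "const (a * b) = const a * const b"
  "const (- a) = - const a" "const (a - b) = const a - const b"
  by (simp_all add: const_def fract_collapse mult.commute flip: to_ac_add to_ac_mult to_ac_minus to_ac_diff)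

lemma const_power [simp]: "const (a ^ n) = const a ^ n"
  by (induction n) auto

lemma const_eq_iff [simp]: "const a = const b \<longleftrightarrow> a = b"
  by (auto simp: const_def eq_fract)

lemma const_eq_0_iff [simp]: "const a = 0 \<longleftrightarrow> a = 0"
  using const_eq_iff[of a 0] by simp

lemma const_in_k [simp]: "const a \<in> k_field"
  by (auto simp: k_field_def const_def)

lemma T_in_k [simp]: "T_elem \<in> k_field"
  by (auto simp: k_field_def T_elem_def)

lemma subfield_k: "subfield k_field Amb"
proof (rule subfieldI_Amb)
  show "1 \<in> (k_field :: 'a kbar set)" unfolding k_field_def by (metis rangeI to_ac_1)
qed (auto simp: k_field_def simp flip: to_ac_add to_ac_mult to_ac_minus to_ac_inverse)

lemma T_nonzero [simp]: "T_elem \<noteq> 0"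
  by (auto simp: T_elem_def Zero_fract_def eq_fract)

interpretation Fq: vector_space "\<lambda>(a::'a::{field,finite}) (x::'a kbar). const a * x"
  by unfold_locales (auto simp: algebra_simps)

lemma card_gt_1: "CARD('a::{field,finite}) > 1"
proof -
  have "card {0, 1 :: 'a} \<le> CARD('a)" by (rule card_mono) auto
  then show ?thesis by simp
qed

text \<open>Multiplication by a nonzero \<open>a\<close> permutes the nonzero elements, so their
  product \<open>?P\<close> is unchanged by the factor \<open>a ^ (q - 1)\<close>.\<close>

lemma finite_field_power_card: "(a :: 'a::{field,finite}) ^ CARD('a) = a"
proof (cases "a = 0")
  case False
  let ?P = "\<Prod>x\<in>UNIV - {0::'a}. x"
  have "?P = (\<Prod>x\<in>UNIV - {0}. a * x)"
    by (rule prod.reindex_bij_witness[of _ "\<lambda>x. a * x" "\<lambda>x. x / a"]) (use False in auto)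
  also have "\<dots> = a ^ card (UNIV - {0::'a}) * ?P" by (simp add: prod.distrib)
  finally have "a ^ card (UNIV - {0::'a}) = 1" by simp
  moreover have "CARD('a) = Suc (card (UNIV - {0::'a}))"
    using card.remove[of "UNIV :: 'a set" 0] by simp
  ultimately show ?thesis by (metis mult.right_neutral power_Suc)
qed (use card_gt_1[where 'a = 'a] in simp)

text \<open>Over a field with \<open>q\<close> elements \<open>(X + 1)\<^sup>q - X\<^sup>q - 1\<close> has more roots than its degree, hence vanishes.\<close>

lemma of_nat_card_choose:
  assumes "0 < i" "i < CARD('a)"
  shows "of_nat (CARD('a) choose i) = (0 :: 'a::{field,finite})"
proof -
  let ?q = "CARD('a)"
  define p :: "'a poly" where "p = [:1, 1:] ^ ?q - Polynomial.monom 1 ?q - 1"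
  have "Polynomial.coeff ([:1, 1:] ^ n) i = (of_nat (n choose i) :: 'a)" for n i
    by (induction n arbitrary: i) (auto simp: coeff_pCons binomial_eq_0 split: nat.splits)
  then have cf: "Polynomial.coeff p i = of_nat (?q choose i) - (if i = ?q then 1 else 0) - (if i = 0 then 1 else 0)" for i
    by (simp add: p_def coeff_eq_0)
  have "p = 0"
  proof (rule ccontr)
    assume p: "p \<noteq> 0"
    have "Polynomial.degree p \<le> ?q - 1"
    proof (rule degree_le, intro allI impI)
      fix i assume "?q - 1 < i"
      then show "Polynomial.coeff p i = 0" using card_gt_1[where 'a = 'a]
        by (cases "i = ?q") (auto simp: cf binomial_eq_0)
    qed
    moreover have "poly p x = 0" for x
      by (simp add: p_def poly_monom finite_field_power_card)
    then have "{x. poly p x = 0} = UNIV" by auto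
    ultimately show False using card_poly_roots_bound[OF p] card_gt_1[where 'a = 'a] by simp
  qed
  then show ?thesis using cf[of i] assms by simp
qed

lemma frob_add:
  fixes x y :: "'a::{field,finite} kbar"
  shows "(x + y) ^ CARD('a) = x ^ CARD('a) + y ^ CARD('a)"
proof -
  let ?q = "CARD('a)"
  have "(x + y) ^ ?q = (\<Sum>k\<le>?q. of_nat (?q choose k) * x ^ k * y ^ (?q - k))"
    by (rule binomial_ring)
  also have "\<dots> = (\<Sum>k\<in>{0, ?q}. of_nat (?q choose k) * x ^ k * y ^ (?q - k))"
  proof (rule sum.mono_neutral_right)
    show "\<forall>i\<in>{..?q} - {0, ?q}. of_nat (?q choose i) * x ^ i * y ^ (?q - i) = 0"
    proof
      fix i assume i: "i \<in> {..?q} - {0, ?q}"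
      have "of_nat (?q choose i) = const (of_nat (?q choose i) :: 'a)"
        by (simp add: const_def poly_const_conv Fract_of_nat_eq flip: of_nat_poly)
      also have "\<dots> = 0" using i by (subst of_nat_card_choose) auto
      finally show "of_nat (?q choose i) * x ^ i * y ^ (?q - i) = 0" by simp
    qed
  qed auto
  also have "\<dots> = x ^ ?q + y ^ ?q" using card_gt_1[where 'a = 'a] by simp
  finally show ?thesis .
qed

lemma frob_uminus: "(- x) ^ CARD('a) = - (x ^ CARD('a))" for x :: "'a::{field,finite} kbar"
proof -
  have "x ^ CARD('a) + (- x) ^ CARD('a) = (x + - x) ^ CARD('a)" by (rule frob_add[symmetric])
  also have "\<dots> = 0" using card_gt_1[where 'a = 'a] by simp
  finally show ?thesis by (rule minus_unique[symmetric])
qed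

lemma frob_diff: "(x - y) ^ CARD('a) = x ^ CARD('a) - y ^ CARD('a)" for x y :: "'a::{field,finite} kbar"
  using frob_add[of x "- y"] by (simp add: frob_uminus)

lemma frob_sum: "(\<Sum>i\<in>I. f i :: 'a::{field,finite} kbar) ^ CARD('a) = (\<Sum>i\<in>I. f i ^ CARD('a))"
  by (induction I rule: infinite_finite_induct) (auto simp: frob_add)

lemma power_card_power_Suc: "x ^ (CARD('a) ^ Suc m) = (x ^ (CARD('a) ^ m)) ^ CARD('a::{field,finite})"
  for x :: "'b::monoid_mult"
  unfolding power_Suc2 power_mult ..

lemma frob_pow_add: "(x + y) ^ (CARD('a) ^ m) = x ^ (CARD('a) ^ m) + y ^ (CARD('a) ^ m)"
  and frob_pow_diff: "(x - y) ^ (CARD('a) ^ m) = x ^ (CARD('a) ^ m) - y ^ (CARD('a) ^ m)"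
  for x y :: "'a::{field,finite} kbar"
  by (induction m) (simp_all add: frob_add frob_diff power_card_power_Suc del: power_Suc)

lemma frob_const [simp]: "const a ^ CARD('a) = const (a :: 'a::{field,finite})"
  unfolding const_power[symmetric] finite_field_power_card ..

lemma frob_pow_const [simp]: "const a ^ (CARD('a) ^ m) = const (a :: 'a::{field,finite})"
  by (induction m) (simp_all add: power_card_power_Suc del: power_Suc)

lemma subfield_Fqm: "subfield (Fqm m) Amb"
proof (rule subfieldI_Amb)
  fix x :: "'a kbar" assume x: "x \<in> Fqm m"
  have "(0 - x) ^ (CARD('a) ^ m) = 0 - x" unfolding frob_pow_diff using x by (simp add: Fqm_def)
  then show "- x \<in> Fqm m" by (simp add: Fqm_def)
qed (auto simp: Fqm_def frob_pow_add power_mult_distrib power_inverse)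

lemma const_in_Fqm [simp]: "const a \<in> Fqm m"
  by (simp add: Fqm_def)

lemma Fqm_card_pos: "CARD('a::{field,finite}) ^ m > 1" if "m \<ge> 1"
  using one_less_power[OF card_gt_1[where 'a='a], of m] that by simp

text \<open>\<open>Fqm m\<close> is the root set of \<open>X ^ Q - X\<close> with
  \<open>Q = CARD('a) ^ m\<close>. This polynomial splits in the algebraic closure, and its
  derivative is \<open>- 1\<close>, so its \<open>Q\<close> roots are distinct.\<close>

lemma card_Fqm:
  assumes m: "m \<ge> 1"
  shows "finite (Fqm m :: 'a::{field,finite} kbar set)" "card (Fqm m :: 'a kbar set) = CARD('a) ^ m"
proof -
  let ?Q = "CARD('a) ^ m"
  have Q: "?Q > 1" using Fqm_card_pos[OF m] .
  define P :: "'a kbar poly" where "P = Polynomial.monom 1 ?Q - Polynomial.monom 1 1"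
  have deg: "Polynomial.degree P = ?Q"
    unfolding P_def using Q
    by (subst diff_conv_add_uminus, subst degree_add_eq_left) (auto simp: Polynomial.degree_monom_eq)
  then have P0: "P \<noteq> 0" using Q by (metis Polynomial.degree_0 not_less_zero)
  have roots: "{x. poly P x = 0} = Fqm m" by (auto simp: P_def Fqm_def poly_monom)
  show fin: "finite (Fqm m :: 'a kbar set)" using poly_roots_finite[OF P0] roots by simp
  obtain A where A: "size A = ?Q" "P = smult (Polynomial.lead_coeff P) (\<Prod>x\<in>#A. [:-x, 1:])"
    using alg_closed_imp_factorization[OF P0] deg by auto
  \<comment> \<open>The characteristic enters through \<open>q choose 1 = q\<close>, one of the
    vanishing binomial coefficients.\<close>
  have Q0: "of_nat ?Q = (0 :: 'a kbar)"
  proof -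
    have "of_nat CARD('a) = const (of_nat CARD('a) :: 'a)"
      by (simp add: const_def poly_const_conv Fract_of_nat_eq flip: of_nat_poly)
    also have "\<dots> = const (of_nat (CARD('a) choose 1))" by simp
    also have "\<dots> = 0" using card_gt_1[where 'a='a] by (subst of_nat_card_choose) auto
    finally show ?thesis using m by (simp add: of_nat_power)
  qed
  have pd: "pderiv P = -1"
    using Q0 Q by (simp add: P_def pderiv_diff pderiv_monom flip: of_nat_power)
  have "count A x \<le> 1" for x
  proof (rule ccontr)
    assume "\<not> count A x \<le> 1"
    then have "{#x, x#} \<subseteq># A" by (auto simp: subseteq_mset_def)
    then obtain B where "A = {#x, x#} + B" by (metis subset_mset.less_eqE)
    then obtain r where r: "P = [:-x, 1:] * ([:-x, 1:] * r)"
      using A(2) by (metis (no_types, lifting) image_mset_add_mset mult_smult_right mset_add add.commute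
          union_mset_add_mset_left add_cancel_left_left prod_mset.add_mset empty_neutral(1))
    have "pderiv P = [:-x, 1:] * pderiv ([:-x, 1:] * r) + ([:-x, 1:] * r) * pderiv [:-x, 1:]"
      by (subst r) (rule pderiv_mult)
    then have "poly (pderiv P) x = 0" by simp
    then show False using pd by simp
  qed
  then have "A = mset_set (set_mset A)"
    by (metis count_mset_set(1,3) count_greater_zero_iff finite_set_mset le_neq_implies_less less_one
        multiset_eqI not_gr_zero)
  then have "?Q = card (set_mset A)" using A(1) by (metis size_mset_set)
  also have "set_mset A = Fqm m"
  proof -
    have "poly P x = 0 \<longleftrightarrow> x \<in># A" for x
    proof -
      have "poly P x = Polynomial.lead_coeff P * (\<Prod>y\<in>#A. x - y)"
        by (subst A(2)) (simp add: poly_prod_mset image_mset.compositionality o_def)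
      then show ?thesis using P0 by (auto simp: prod_mset_zero_iff)
    qed
    then show ?thesis using roots by auto
  qed
  finally show "card (Fqm m :: 'a kbar set) = ?Q" by simp
qed

lemma Fqm_1: "Fqm 1 = range const"
proof -
  have "card (range (const :: 'a \<Rightarrow> 'a kbar)) = CARD('a)"
    by (rule card_image) (auto simp: inj_on_def)
  then have "range const = (Fqm 1 :: 'a kbar set)"
    using card_Fqm[of 1, where 'a = 'a] by (intro card_seteq) auto
  then show ?thesis by simp
qed

lemma frob_fixed_const: "x ^ CARD('a) = x \<Longrightarrow> \<exists>a. x = const a" for x :: "'a::{field,finite} kbar"
  using Fqm_1[where 'a='a] by (auto simp: Fqm_def)

text \<open>Both sides are monic of degree \<open>q\<close> in \<open>x\<close> and agree at the
  \<open>q\<close> constants, so their difference, of smaller degree, is zero. This factorization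
  locates a constant near an approximate solution of \<open>y ^ q = y\<close>.\<close>

lemma prod_minus_const: "(\<Prod>a\<in>UNIV. x - const a) = x ^ CARD('a) - x" for x :: "'a::{field,finite} kbar"
proof -
  let ?q = "CARD('a)"
  define P :: "'a kbar poly" where "P = (\<Prod>a\<in>UNIV. [:- const a, 1:])"
  define D where "D = P - (Polynomial.monom 1 ?q - Polynomial.monom 1 1)"
  have degP: "Polynomial.degree P = ?q"
    unfolding P_def by (subst degree_prod_eq_sum_degree) auto
  have lcP: "Polynomial.lead_coeff P = 1"
    unfolding P_def by (simp add: lead_coeff_prod)
  have "D = 0"
  proof (rule ccontr)
    assume D: "D \<noteq> 0"
    have "Polynomial.degree D \<le> ?q - 1"
    proof (rule degree_le, intro allI impI)
      fix i assume "?q - 1 < i"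
      then show "Polynomial.coeff D i = 0" using card_gt_1[where 'a = 'a] lcP degP
        by (cases "i = ?q") (auto simp: D_def coeff_eq_0)
    qed
    moreover have "range const \<subseteq> {x. poly D x = 0}"
      by (auto simp: D_def P_def poly_prod poly_monom)
    then have "card (range (const :: 'a \<Rightarrow> 'a kbar)) \<le> card {x. poly D x = 0}"
      by (intro card_mono poly_roots_finite D)
    moreover have "card (range (const :: 'a \<Rightarrow> 'a kbar)) = CARD('a)"
      by (rule card_image) (auto simp: inj_on_def)
    ultimately show False using card_poly_roots_bound[OF D] card_gt_1[where 'a = 'a] by simp
  qed
  then have "poly D x = 0" by simp
  then show ?thesis by (simp add: D_def P_def poly_prod poly_monom)
qed

text \<open>Each new independent vector multiplies the number of combinations by \<open>q\<close>.
  This converts the size of a residue field into the length of a basis over the constants.\<close>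

lemma card_span_independent:
  fixes B :: "'a::{field,finite} kbar set"
  assumes "finite B" "Fq.independent B"
  shows "finite (Fq.span B) \<and> card (Fq.span B) = CARD('a) ^ card B"
  using assms
proof (induction B rule: finite_induct)
  case (insert b B)
  then have B: "Fq.independent B" "b \<notin> Fq.span B"
    by (auto simp: Fq.independent_insert)
  define g where "g = (\<lambda>(a :: 'a, y :: 'a kbar). const a * b + y)"
  have inj: "inj_on g (UNIV \<times> Fq.span B)"
  proof (rule inj_onI, clarsimp simp: g_def)
    fix a y a' y' assume *: "y \<in> Fq.span B" "y' \<in> Fq.span B" "const a * b + y = const a' * b + y'"
    have "a = a'"
    proof (rule ccontr)
      assume ne: "a \<noteq> a'"
      have "const (a - a') * b = y' - y" using *(3) by (simp add: algebra_simps)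
      moreover have "y' - y \<in> Fq.span B" using * by (intro Fq.span_diff)
      ultimately have "const (1 / (a - a')) * (const (a - a') * b) \<in> Fq.span B"
        using Fq.span_scale by metis
      moreover have "const (1 / (a - a')) * (const (a - a') * b) = const ((1 / (a - a')) * (a - a')) * b"
        by (simp only: const_simps mult.assoc)
      ultimately show False using B(2) ne by (metis const_1 eq_iff_diff_eq_0 lambda_one nonzero_divide_eq_eq)
    qed
    then show "a = a' \<and> y = y'" using * by simp
  qed
  have "Fq.span (insert b B) = g ` (UNIV \<times> Fq.span B)"
  proof (intro equalityI subsetI)
    fix x assume "x \<in> Fq.span (insert b B)"
    then obtain a where "x - const a * b \<in> Fq.span B"
      using Fq.span_breakdown_eq[of x b B] by auto
    then have "g (a, x - const a * b) \<in> g ` (UNIV \<times> Fq.span B)" by blast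
    then show "x \<in> g ` (UNIV \<times> Fq.span B)" by (simp add: g_def)
  next
    fix x assume "x \<in> g ` (UNIV \<times> Fq.span B)"
    then obtain a y where "x = const a * b + y" "y \<in> Fq.span B" by (auto simp: g_def)
    moreover have "Fq.span B \<subseteq> Fq.span (insert b B)" by (rule Fq.span_mono) auto
    ultimately show "x \<in> Fq.span (insert b B)"
      using Fq.span_add[OF Fq.span_scale[OF Fq.span_base[of b "insert b B"], of a], of y] by auto
  qed
  moreover have "finite (Fq.span B)" "card (Fq.span B) = CARD('a) ^ card B"
    using insert.IH B by auto
  ultimately show ?case
    using card_image[OF inj] insert.hyps by (simp add: card_cartesian_product)
qed simp

section \<open>Nonarchimedean absolute values\<close>

locale absval =
  fixes N :: "'b::field \<Rightarrow> real"
  assumes N_0 [simp]: "N 0 = 0"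
    and N_pos: "x \<noteq> 0 \<Longrightarrow> N x > 0"
    and N_mult: "N (x * y) = N x * N y"
    and N_add: "N (x + y) \<le> max (N x) (N y)"
begin

lemma N_nonneg [simp]: "N x \<ge> 0"
  using N_pos[of x] by (cases "x = 0") auto

lemma N_eq_0_iff [simp]: "N x = 0 \<longleftrightarrow> x = 0"
  using N_pos[of x] by (cases "x = 0") auto

lemma N_pos_iff [simp]: "N x > 0 \<longleftrightarrow> x \<noteq> 0"
  using N_pos[of x] by (cases "x = 0") auto

lemma N_1 [simp]: "N 1 = 1"
  using N_mult[of 1 1] N_pos[of 1] by simp

lemma N_power: "N (x ^ n) = N x ^ n"
  by (induction n) (auto simp: N_mult)

lemma N_inverse: "N (inverse x) = inverse (N x)"
proof (cases "x = 0")
  case False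
  then have "N x * N (inverse x) = 1" by (simp flip: N_mult)
  then show ?thesis using False by (simp add: field_simps)
qed simp

lemma N_divide: "N (x / y) = N x / N y"
  by (simp add: divide_inverse N_mult N_inverse)

lemma N_powi: "N (x powi i) = N x powi i"
  by (cases "i \<ge> 0") (simp_all add: power_int_def N_power N_inverse)

lemma N_prod: "N (prod f I) = (\<Prod>i\<in>I. N (f i))"
  by (induction I rule: infinite_finite_induct) (auto simp: N_mult)

lemma N_uminus [simp]: "N (- x) = N x"
proof -
  have "N (- 1) ^ 2 = 1" by (simp flip: N_power)
  then have "N (- 1) = 1" using N_nonneg[of "- 1"] by (simp add: power2_eq_1_iff)
  then show ?thesis using N_mult[of "- 1" x] by simp
qed

lemma N_diff: "N (x - y) \<le> max (N x) (N y)"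
  using N_add[of x "- y"] by simp

lemma N_minus_commute: "N (x - y) = N (y - x)"
  using N_uminus[of "x - y"] by simp

lemma N_add_eq: "N x < N y \<Longrightarrow> N (x + y) = N y"
  using N_add[of x y] N_diff[of "x + y" x] by simp

lemma N_eq_of_diff_less: "N (x - y) < N x \<Longrightarrow> N y = N x"
  using N_add_eq[of "y - x" x] N_minus_commute[of x y] by simp

lemma N_add_le: "N x \<le> c \<Longrightarrow> N y \<le> c \<Longrightarrow> N (x + y) \<le> c"
  using N_add[of x y] by simp

lemma N_add_less: "N x < c \<Longrightarrow> N y < c \<Longrightarrow> N (x + y) < c"
  using N_add[of x y] by simp

lemma N_diff_le: "N x \<le> c \<Longrightarrow> N y \<le> c \<Longrightarrow> N (x - y) \<le> c"
  using N_diff[of x y] by simp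

lemma N_sum_le: "c \<ge> 0 \<Longrightarrow> (\<And>i. i \<in> I \<Longrightarrow> N (f i) \<le> c) \<Longrightarrow> N (sum f I) \<le> c"
  by (induction I rule: infinite_finite_induct) (auto intro: N_add_le)

lemma N_sum_less: "c > 0 \<Longrightarrow> (\<And>i. i \<in> I \<Longrightarrow> N (f i) < c) \<Longrightarrow> N (sum f I) < c"
  by (induction I rule: infinite_finite_induct) (auto intro: N_add_less)

lemma N_root_of_unity:
  assumes "x ^ n = 1" "n > 0"
  shows "N x = 1"
proof -
  have "N x ^ n = 1 ^ n" using assms by (simp flip: N_power)
  then show ?thesis using assms(2) power_eq_iff_eq_base[of n "N x" 1] by simp
qed

lemma N_trans_less: "N (x - y) < c \<Longrightarrow> N (y - z) < c \<Longrightarrow> N (x - z) < c"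
  using N_add_less[of "x - y" c "y - z"] by simp

end

section \<open>Valuation rings of the whole field and their absolute values\<close>

definition subring_set :: "'b::field set \<Rightarrow> bool"
  where "subring_set B \<longleftrightarrow> 1 \<in> B \<and> (\<forall>x\<in>B. - x \<in> B) \<and> (\<forall>x\<in>B. \<forall>y\<in>B. x + y \<in> B \<and> x * y \<in> B)"

lemma subring_set_0: "subring_set B \<Longrightarrow> 0 \<in> B"
  unfolding subring_set_def by (metis add.right_inverse)

lemma subring_set_sum: "subring_set B \<Longrightarrow> (\<And>i. i \<in> I \<Longrightarrow> f i \<in> B) \<Longrightarrow> sum f I \<in> B"
proof (induction I rule: infinite_finite_induct)
  case (insert x F)
  then show ?case by (simp add: subring_set_def)
qed (auto simp: subring_set_0)

lemma subring_set_power: "subring_set B \<Longrightarrow> x \<in> B \<Longrightarrow> x ^ n \<in> B"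
  by (induction n) (auto simp: subring_set_def)

text \<open>Chevalley: a subring that is maximal among those in which \<open>\<theta>\<close> is not invertible is a valuation ring.\<close>

theorem valuation_ring_extension:
  fixes B\<^sub>0 :: "'b::field set"
  assumes "subring_set B\<^sub>0" "\<theta> \<in> B\<^sub>0" "\<And>b. b \<in> B\<^sub>0 \<Longrightarrow> \<theta> * b \<noteq> 1"
  obtains B where "subring_set B" "B\<^sub>0 \<subseteq> B" "\<And>b. b \<in> B \<Longrightarrow> \<theta> * b \<noteq> 1"
    "\<And>x. x \<in> B \<or> inverse x \<in> B"
proof -
  define \<A> where "\<A> = {B. subring_set B \<and> B\<^sub>0 \<subseteq> B \<and> (\<forall>b\<in>B. \<theta> * b \<noteq> 1)}"
  have "\<exists>M\<in>\<A>. \<forall>W\<in>\<A>. M \<subseteq> W \<longrightarrow> W = M"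
  proof (rule subset_Zorn_nonempty)
    show "\<A> \<noteq> {}" using assms by (auto simp: \<A>_def)
  next
    fix \<C> assume ne: "\<C> \<noteq> {}" and ch: "subset.chain \<A> \<C>"
    have sub: "\<And>W. W \<in> \<C> \<Longrightarrow> W \<in> \<A>" using ch by (auto simp: subset.chain_def)
    have two: "\<exists>Z\<in>\<C>. x \<in> Z \<and> y \<in> Z" if "W \<in> \<C>" "Y \<in> \<C>" "x \<in> W" "y \<in> Y" for x y W Y
      using ch that unfolding subset.chain_def by blast
    have "subring_set (\<Union>\<C>)"
      unfolding subring_set_def
    proof (intro conjI ballI)
      show "1 \<in> \<Union>\<C>" using ne sub by (auto simp: \<A>_def subring_set_def)
    next
      fix x assume "x \<in> \<Union>\<C>"
      then obtain W where "W \<in> \<C>" "x \<in> W" by blast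
      then show "- x \<in> \<Union>\<C>" using sub[of W] by (auto simp: \<A>_def subring_set_def)
    next
      fix x y assume "x \<in> \<Union>\<C>" "y \<in> \<Union>\<C>"
      then obtain Z where "Z \<in> \<C>" "x \<in> Z" "y \<in> Z" using two by blast
      then show "x + y \<in> \<Union>\<C>" "x * y \<in> \<Union>\<C>" using sub[of Z] by (auto simp: \<A>_def subring_set_def)
    qed
    moreover have "B\<^sub>0 \<subseteq> \<Union>\<C>" using ne sub by (auto simp: \<A>_def)
    moreover have "\<forall>b\<in>\<Union>\<C>. \<theta> * b \<noteq> 1" using sub by (auto simp: \<A>_def)
    ultimately show "\<Union>\<C> \<in> \<A>" by (simp add: \<A>_def)
  qed
  then obtain B where B: "B \<in> \<A>" "\<And>W. W \<in> \<A> \<Longrightarrow> B \<subseteq> W \<Longrightarrow> W = B" by blast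
  have ring: "subring_set B" and B0: "B\<^sub>0 \<subseteq> B" and \<theta>B: "\<And>b. b \<in> B \<Longrightarrow> \<theta> * b \<noteq> 1"
    using B(1) by (auto simp: \<A>_def)
  have \<theta>: "\<theta> \<in> B" using assms B0 by auto
  have cl: "1 \<in> B" "0 \<in> B" "\<And>x y. x \<in> B \<Longrightarrow> y \<in> B \<Longrightarrow> x + y \<in> B" "\<And>x y. x \<in> B \<Longrightarrow> y \<in> B \<Longrightarrow> x * y \<in> B"
    "\<And>x. x \<in> B \<Longrightarrow> - x \<in> B" "\<And>x y. x \<in> B \<Longrightarrow> y \<in> B \<Longrightarrow> x - y \<in> B"
    using ring subring_set_0[OF ring] unfolding subring_set_def
    by (simp_all add: diff_conv_add_uminus del: add_uminus_conv_diff)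
  define BX where "BX = {p :: 'b poly. \<forall>i. Polynomial.coeff p i \<in> B}"
  have BX: "p + q \<in> BX" "p * q \<in> BX" "- p \<in> BX" if "p \<in> BX" "q \<in> BX" for p q
    using that by (auto simp: BX_def coeff_mult intro!: cl subring_set_sum[OF ring])
  have BXs: "Polynomial.smult b p \<in> BX" if "b \<in> B" "p \<in> BX" for b p
    using that by (auto simp: BX_def intro!: cl)
  \<comment> \<open>For \<open>x\<close> outside \<open>B\<close> the ring \<open>B[x]\<close> is
    strictly larger, so by maximality \<theta> becomes invertible in it.\<close>
  have poly_witness: "\<exists>p\<in>BX. \<theta> * poly p x = 1" if x: "x \<notin> B" for x
  proof (rule ccontr)
    assume no: "\<not> (\<exists>p\<in>BX. \<theta> * poly p x = 1)"
    define W where "W = (\<lambda>p. poly p x) ` BX"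
    have const: "b \<in> W" if "b \<in> B" for b
      using that cl unfolding W_def by (intro image_eqI[of _ _ "[:b:]"]) (auto simp: BX_def coeff_pCons split: nat.splits)
    have xX: "x \<in> W" unfolding W_def
      using cl by (intro image_eqI[of _ _ "[:0, 1:]"]) (auto simp: BX_def coeff_pCons split: nat.splits)
    have "subring_set W"
      unfolding subring_set_def
    proof (intro conjI ballI)
      show "1 \<in> W" using const cl by simp
    next
      fix u assume "u \<in> W"
      then obtain p where "p \<in> BX" "u = poly p x" by (auto simp: W_def)
      then show "- u \<in> W" unfolding W_def by (intro image_eqI[of _ _ "- p"]) (auto simp: BX)
    next
      fix u v assume "u \<in> W" "v \<in> W"
      then obtain p q where pq: "p \<in> BX" "u = poly p x" "q \<in> BX" "v = poly q x" by (auto simp: W_def)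
      then show "u + v \<in> W" unfolding W_def by (intro image_eqI[of _ _ "p + q"]) (auto simp: BX)
      from pq show "u * v \<in> W" unfolding W_def by (intro image_eqI[of _ _ "p * q"]) (auto simp: BX)
    qed
    moreover have "B \<subseteq> W" using const by auto
    moreover have "\<forall>b\<in>W. \<theta> * b \<noteq> 1" using no by (auto simp: W_def)
    ultimately have "W \<in> \<A>" using B0 by (auto simp: \<A>_def)
    then have "W = B" using B(2) \<open>B \<subseteq> W\<close> by blast
    then show False using xX x by simp
  qed
  \<comment> \<open>Descent: if \<open>p\<close> and \<open>r\<close> are witnesses for
    \<open>x\<close> and for \<open>1 / x\<close>, with \<open>r\<close> not of larger degree, the
    relation of \<open>r\<close> multiplied by \<open>x ^ ?n\<close> expresses
    \<open>(1 - \<theta> * ?r0) * x ^ ?n\<close> through lower powers, and this lowers the degree of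
    \<open>p\<close>.\<close>
  have reduce: "\<exists>p'\<in>BX. \<theta> * poly p' x = 1 \<and> Polynomial.degree p' < Polynomial.degree p"
    if x: "x \<noteq> 0" and p: "p \<in> BX" "\<theta> * poly p x = 1" and r: "r \<in> BX" "\<theta> * poly r (inverse x) = 1"
      and le: "Polynomial.degree r \<le> Polynomial.degree p" for x p r
  proof -
    let ?n = "Polynomial.degree p" and ?m = "Polynomial.degree r"
    let ?r0 = "Polynomial.coeff r 0" and ?pn = "Polynomial.coeff p (Polynomial.degree p)"
    have n: "?n > 0"
    proof (rule ccontr)
      assume "\<not> ?n > 0"
      then have "\<theta> * ?pn = 1" using p by (metis degree_0_id gr0I poly_const_conv)
      then show False using \<theta>B p(1) by (auto simp: BX_def)
    qed
    define s where "s = (\<Sum>j\<in>{1..?m}. Polynomial.monom (Polynomial.coeff r j) (?n - j))"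
    define p1 where "p1 = p - Polynomial.monom ?pn ?n"
    have s: "s \<in> BX" using r(1) cl by (auto simp: s_def BX_def coeff_sum intro!: subring_set_sum[OF ring])
    have p1: "p1 \<in> BX" using p(1) cl by (auto simp: p1_def BX_def)
    have ds: "Polynomial.degree s < ?n"
    proof -
      have "Polynomial.degree s \<le> ?n - 1" unfolding s_def
        by (intro degree_sum_le) (auto intro!: order_trans[OF degree_monom_le])
      then show ?thesis using n by simp
    qed
    have dp1: "Polynomial.degree p1 < ?n"
    proof -
      have "Polynomial.degree p1 \<le> ?n - 1"
      proof (rule degree_le, intro allI impI)
        fix i assume "?n - 1 < i"
        then show "Polynomial.coeff p1 i = 0" using n by (cases "i = ?n") (auto simp: p1_def coeff_eq_0)
      qed
      then show ?thesis using n by simp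
    qed
    have sx: "\<theta> * poly s x = (1 - \<theta> * ?r0) * x ^ ?n"
    proof -
      have "poly r (inverse x) = (\<Sum>j\<le>?m. Polynomial.coeff r j * inverse x ^ j)" by (rule poly_altdef)
      also have "{..?m} = insert 0 {1..?m}" by auto
      finally have r': "poly r (inverse x) = ?r0 + (\<Sum>j\<in>{1..?m}. Polynomial.coeff r j * inverse x ^ j)" by simp
      have "poly s x = (\<Sum>j\<in>{1..?m}. Polynomial.coeff r j * x ^ (?n - j))"
        by (simp add: s_def poly_sum poly_monom)
      also have "\<dots> = (\<Sum>j\<in>{1..?m}. Polynomial.coeff r j * inverse x ^ j) * x ^ ?n"
        unfolding sum_distrib_right
        by (rule sum.cong) (use le x in \<open>auto simp: power_diff field_simps\<close>)
      also have "\<dots> = (poly r (inverse x) - ?r0) * x ^ ?n" using r' by simp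
      finally have "poly s x = (poly r (inverse x) - ?r0) * x ^ ?n" .
      then have "\<theta> * poly s x = (\<theta> * poly r (inverse x) - \<theta> * ?r0) * x ^ ?n"
        by (simp only:) (simp add: algebra_simps)
      then show ?thesis using r(2) by simp
    qed
    \<comment> \<open>Scaling the relation of \<open>p\<close> by \<open>1 - \<theta> * ?r0\<close>
      allows its leading term to be replaced by a multiple of \<open>s\<close> without inverting
      that factor; the constant \<open>?r0\<close> brings the value back to 1.\<close>
    define p' where "p' = [:?r0:] + Polynomial.smult (1 - \<theta> * ?r0) p1 + Polynomial.smult (\<theta> * ?pn) s"
    have c: "?r0 \<in> B" "?pn \<in> B" using r(1) p(1) by (auto simp: BX_def)
    have "p' \<in> BX" unfolding p'_def
      using c cl by (intro BX BXs s p1 \<theta>) (auto simp: BX_def coeff_pCons \<theta> split: nat.splits)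
    moreover have "Polynomial.degree p' < ?n"
      unfolding p'_def using n ds dp1 by (intro degree_add_less) (auto intro: le_less_trans[OF degree_smult_le])
    moreover have "\<theta> * poly p' x = 1"
    proof -
      have px: "poly p1 x = poly p x - ?pn * x ^ ?n" by (simp add: p1_def poly_monom)
      have "\<theta> * poly p' x = \<theta> * ?r0 + (1 - \<theta> * ?r0) * (\<theta> * poly p x - \<theta> * ?pn * x ^ ?n) + \<theta> * ?pn * (\<theta> * poly s x)"
        by (simp add: p'_def px algebra_simps)
      also have "\<dots> = 1" unfolding p(2) sx by (simp add: algebra_simps)
      finally show ?thesis .
    qed
    ultimately show ?thesis by blast
  qed
  have val: "x \<in> B \<or> inverse x \<in> B" for x
  proof (rule ccontr)
    assume *: "\<not> (x \<in> B \<or> inverse x \<in> B)"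
    then have x: "x \<noteq> 0" using cl by auto
    have no: "\<not> (p \<in> BX \<and> r \<in> BX \<and> \<theta> * poly p x = 1 \<and> \<theta> * poly r (inverse x) = 1)" for p r
    proof (induction "Polynomial.degree p + Polynomial.degree r" arbitrary: p r rule: less_induct)
      case less
      show ?case
      proof
        assume a: "p \<in> BX \<and> r \<in> BX \<and> \<theta> * poly p x = 1 \<and> \<theta> * poly r (inverse x) = 1"
        show False
        proof (cases "Polynomial.degree r \<le> Polynomial.degree p")
          case True
          then obtain p' where "p' \<in> BX" "\<theta> * poly p' x = 1" "Polynomial.degree p' < Polynomial.degree p"
            using reduce[of x p r] a x by blast
          then show False using less[of p' r] a by auto
        next
          case False
          then obtain r' where "r' \<in> BX" "\<theta> * poly r' (inverse x) = 1" "Polynomial.degree r' < Polynomial.degree r"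
            using reduce[of "inverse x" r p] a x by auto
          then show False using less[of p r'] a by auto
        qed
      qed
    qed
    show False using poly_witness[of x] poly_witness[of "inverse x"] * no by blast
  qed
  show ?thesis using that[OF ring B0 \<theta>B val] .
qed

text \<open>Nonzero elements of \<open>k\<close> are powers of \<theta> up to units, and every
  \<open>x\<close> is algebraic over \<open>k\<close>; hence some power of \<open>x\<close> is a
  unit times a power of \<theta>. All values are therefore rational multiples of that of \<theta>,
  and exponentiation to base 2 gives a real absolute value with
  \<open>N \<theta> = 1 / 2\<close>.\<close>

theorem absval_of_valuation_ring:
  fixes B :: "'b::field set"
  assumes ring: "subring_set B" and val: "\<And>x. x \<in> B \<or> inverse x \<in> B"
    and \<theta>: "\<theta> \<in> B" "\<And>b. b \<in> B \<Longrightarrow> \<theta> * b \<noteq> 1" "\<theta> \<noteq> 0"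
    and k: "\<And>a. a \<in> k \<Longrightarrow> a \<noteq> 0 \<Longrightarrow> \<exists>i. a * \<theta> powi i \<in> B \<and> inverse (a * \<theta> powi i) \<in> B"
    and alg: "\<And>x. \<exists>p. p \<noteq> 0 \<and> (\<forall>i. Polynomial.coeff p i \<in> k) \<and> poly p x = 0"
  obtains N where "absval N" 
    "\<And>x n i. x \<noteq> 0 \<Longrightarrow> n > 0 \<Longrightarrow> x ^ n * \<theta> powi i \<in> B \<Longrightarrow> inverse (x ^ n * \<theta> powi i) \<in> B
      \<Longrightarrow> N x = 2 powr (real_of_int i / n)"
proof -
  have cl: "1 \<in> B" "0 \<in> B" "\<And>x y. x \<in> B \<Longrightarrow> y \<in> B \<Longrightarrow> x + y \<in> B" "\<And>x y. x \<in> B \<Longrightarrow> y \<in> B \<Longrightarrow> x * y \<in> B"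
    "\<And>x. x \<in> B \<Longrightarrow> - x \<in> B" "\<And>x y. x \<in> B \<Longrightarrow> y \<in> B \<Longrightarrow> x - y \<in> B"
    using ring subring_set_0[OF ring] unfolding subring_set_def
    by (simp_all add: diff_conv_add_uminus del: add_uminus_conv_diff)
  define U where "U = {u \<in> B. u \<noteq> 0 \<and> inverse u \<in> B}"
  have U1: "1 \<in> U" using cl by (simp add: U_def)
  have Um: "u * v \<in> U" if "u \<in> U" "v \<in> U" for u v using that cl by (auto simp: U_def)
  have Ui: "inverse u \<in> U" if "u \<in> U" for u using that by (auto simp: U_def)
  have Up: "u ^ n \<in> U" if "u \<in> U" for u and n :: nat using that by (induction n) (auto simp: U1 Um)
  have Upi: "u powi n \<in> U" if "u \<in> U" for u and n :: int
    using that by (auto simp: power_int_def Up Ui)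
  \<comment> \<open>A valuation ring is local: one of the two quotients lies in \<open>B\<close>,
    and a unit sum would then make the divisor a unit.\<close>
  have nonunit_add: "a + b \<notin> U" if a: "a \<in> B" "a \<notin> U" and b: "b \<in> B" "b \<notin> U" for a b
  proof
    assume u: "a + b \<in> U"
    have *: False if a: "a \<in> B" "a \<notin> U" and b: "b \<in> B" "b \<notin> U" and ab: "a * inverse b \<in> B" "b \<noteq> 0"
      and u: "a + b \<in> U" for a b
    proof -
      have "(a * inverse b + 1) * inverse (a + b) \<in> B" using ab(1) u cl by (auto simp: U_def)
      moreover have "(a * inverse b + 1) * inverse (a + b) = inverse b" using ab(2) u
        by (auto simp: U_def field_simps)
      ultimately show False using b ab(2) by (simp add: U_def)
    qed
    show False
    proof (cases "a = 0 \<or> b = 0")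
      case True
      then show False using u a b by auto
    next
      case False
      have "a * inverse b \<in> B \<or> b * inverse a \<in> B"
        using val[of "a * inverse b"] by (simp add: mult.commute)
      then show False using *[of a b] *[of b a] a b u False by (auto simp: add.commute)
    qed
  qed
  have \<theta>U: "i = 0" if "\<theta> powi i \<in> U" for i
  proof -
    have pos: False if "i > 0" "\<theta> powi i \<in> U" for i
    proof -
      have "\<theta> * (\<theta> ^ (nat i - 1) * inverse (\<theta> powi i)) = 1"
        using that \<theta>(3) by (cases "nat i") (auto simp: power_int_def field_simps)
      moreover have "\<theta> ^ (nat i - 1) * inverse (\<theta> powi i) \<in> B"
        using that subring_set_power[OF ring \<theta>(1)] cl by (auto simp: U_def)
      ultimately show False using \<theta>(2) by blast
    qed
    show ?thesis using pos[of i] pos[of "- i"] that Ui[OF that] by (cases i "0 :: int" rule: linorder_cases)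
        (auto simp: power_int_minus)
  qed
  \<comment> \<open>In a vanishing sum no single term can strictly dominate: with \<open>t i\<close>
    a term of maximal size, the remaining quotients sum to \<open>- 1\<close>, a unit, so one of
    them is itself a unit. Comparing these two terms isolates a power of \<open>x\<close>.\<close>
  have V_ex: "\<exists>n i. n > 0 \<and> x ^ n * \<theta> powi i \<in> U" if x: "x \<noteq> 0" for x
  proof -
    obtain p where p: "p \<noteq> 0" "\<And>i. Polynomial.coeff p i \<in> k" "poly p x = 0" using alg by blast
    define I where "I = {i. i \<le> Polynomial.degree p \<and> Polynomial.coeff p i \<noteq> 0}"
    define t where "t = (\<lambda>i. Polynomial.coeff p i * x ^ i)"
    have I: "finite I" "I \<noteq> {}" using p(1) by (auto simp: I_def intro!: exI[of _ "Polynomial.degree p"])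
    have t: "t i \<noteq> 0" if "i \<in> I" for i using that x by (auto simp: t_def I_def)
    have "(\<Sum>i\<in>I. t i) = (\<Sum>i\<le>Polynomial.degree p. t i)"
      by (rule sum.mono_neutral_left) (auto simp: I_def t_def)
    then have t0: "(\<Sum>i\<in>I. t i) = 0" using p(3) by (simp add: t_def poly_altdef)
    have "\<exists>i\<in>I. \<forall>j\<in>I. t j * inverse (t i) \<in> B"
      using I t
    proof (induction I rule: finite_ne_induct)
      case (singleton i)
      then show ?case using cl by auto
    next
      case (insert l F)
      then obtain i where i: "i \<in> F" "\<forall>j\<in>F. t j * inverse (t i) \<in> B" by auto
      show ?case
      proof (cases "t l * inverse (t i) \<in> B")
        case True
        then show ?thesis using i by auto
      next
        case False
        then have il: "t i * inverse (t l) \<in> B" using val[of "t l * inverse (t i)"] by (simp add: mult.commute)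
        have "t j * inverse (t l) \<in> B" if "j \<in> F" for j
        proof -
          have "t j * inverse (t l) = (t j * inverse (t i)) * (t i * inverse (t l))"
            using insert.prems i by simp
          then show ?thesis using i that il cl(4) by metis
        qed
        then show ?thesis using insert.prems cl by auto
      qed
    qed
    then obtain i where i: "i \<in> I" "\<And>j. j \<in> I \<Longrightarrow> t j * inverse (t i) \<in> B" by auto
    have "\<exists>j\<in>I - {i}. t j * inverse (t i) \<in> U"
    proof (rule ccontr)
      assume "\<not> ?thesis"
      then have no: "t j * inverse (t i) \<notin> U" if "j \<in> I - {i}" for j using that by blast
      have "(\<Sum>j\<in>J. t j * inverse (t i)) \<in> B \<and> (\<Sum>j\<in>J. t j * inverse (t i)) \<notin> U" if "J \<subseteq> I - {i}" "finite J" for J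
        using that(2,1)
      proof (induction J rule: finite_induct)
        case empty
        then show ?case using cl by (simp add: U_def)
      next
        case (insert j J)
        then show ?case using nonunit_add[OF i(2)[of j] no[of j], of "\<Sum>j\<in>J. t j * inverse (t i)"] i(2)[of j] cl by auto
      qed
      then have "(\<Sum>j\<in>I - {i}. t j * inverse (t i)) \<notin> U" using I by auto
      moreover have "(\<Sum>j\<in>I - {i}. t j * inverse (t i)) = - 1"
      proof -
        have "(\<Sum>j\<in>I - {i}. t j) = - t i" using t0 I i by (simp add: sum.remove[of I i] eq_neg_iff_add_eq_0 add.commute)
        then show ?thesis using t[OF i(1)] by (simp flip: sum_distrib_right)
      qed
      ultimately show False using U1 cl by (auto simp: U_def)
    qed
    then obtain j where j: "j \<in> I" "j \<noteq> i" "t j * inverse (t i) \<in> U" by auto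
    have coef: "\<exists>l. Polynomial.coeff p i' * \<theta> powi l \<in> U" if "i' \<in> I" for i'
      using k[of "Polynomial.coeff p i'"] p(2) that \<theta>(3) by (auto simp: U_def I_def)
    obtain l where l: "Polynomial.coeff p i * \<theta> powi l \<in> U" using coef i(1) by blast
    obtain l' where l': "Polynomial.coeff p j * \<theta> powi l' \<in> U" using coef j(1) by blast
    have main: "\<exists>n i. n > 0 \<and> x ^ n * \<theta> powi i \<in> U"
      if "b > (a :: nat)" "ca * \<theta> powi la \<in> U" "cb * \<theta> powi lb \<in> U" "(cb * x ^ b) * inverse (ca * x ^ a) \<in> U" for a b ca cb la lb
    proof -
      have nz: "ca \<noteq> 0" "cb \<noteq> 0" using that by (auto simp: U_def)
      have "((cb * x ^ b) * inverse (ca * x ^ a)) * (ca * \<theta> powi la) * inverse (cb * \<theta> powi lb) \<in> U"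
        by (rule Um[OF Um[OF that(4,2)] Ui[OF that(3)]])
      also have "((cb * x ^ b) * inverse (ca * x ^ a)) * (ca * \<theta> powi la) * inverse (cb * \<theta> powi lb)
        = x ^ (b - a) * \<theta> powi (la - lb)"
        using nz x \<theta>(3) that(1) by (simp add: power_int_diff power_diff field_simps)
      finally show ?thesis using that(1) by (intro exI[of _ "b - a"]) auto
    qed
    show ?thesis
    proof (cases "j > i")
      case True
      then show ?thesis using main[OF True l l'] j(3) by (simp add: t_def)
    next
      case False
      then have ij: "i > j" using j by simp
      show ?thesis using main[OF ij l' l] Ui[OF j(3)] by (simp add: t_def mult.commute)
    qed
  qed
  have V_uniq: "real_of_int i / n = real_of_int i' / n'"
    if "n > 0" "n' > 0" "x ^ n * \<theta> powi i \<in> U" "x ^ n' * \<theta> powi i' \<in> U" for x i i' and n n' :: nat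
  proof -
    have x: "x \<noteq> 0" using that by (auto simp: U_def)
    have "(x ^ n * \<theta> powi i) ^ n' * inverse ((x ^ n' * \<theta> powi i') ^ n) \<in> U"
      by (rule Um[OF Up[OF that(3)] Ui[OF Up[OF that(4)]]])
    also have "(x ^ n * \<theta> powi i) ^ n' * inverse ((x ^ n' * \<theta> powi i') ^ n) = \<theta> powi (i * int n' - i' * int n)"
    proof -
      have "(x ^ n * \<theta> powi i) ^ n' = x ^ (n * n') * \<theta> powi (i * int n')" 
        by (simp add: power_mult_distrib power_mult power_int_mult)
      moreover have "(x ^ n' * \<theta> powi i') ^ n = x ^ (n * n') * \<theta> powi (i' * int n)" 
        by (simp add: power_mult_distrib mult.commute[of n n'] power_mult power_int_mult)
      ultimately show ?thesis using x \<theta>(3) by (simp add: power_int_diff field_simps)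
    qed
    finally have "i * int n' - i' * int n = 0" by (rule \<theta>U)
    then have "i * int n' = i' * int n" by simp
    then have "real_of_int i * real n' = real_of_int i' * real n" by (metis of_int_mult of_int_of_nat_eq)
    then show ?thesis using that by (simp add: field_simps)
  qed
  define V where "V = (\<lambda>x. THE q. \<exists>n i. n > 0 \<and> x ^ n * \<theta> powi i \<in> U \<and> q = real_of_int i / real n)"
  have V: "V x = real_of_int i / n" if "n > 0" "x ^ n * \<theta> powi i \<in> U" for x n i
    unfolding V_def
  proof (rule the_equality)
    show "\<exists>n' i'. n' > 0 \<and> x ^ n' * \<theta> powi i' \<in> U \<and> real_of_int i / n = real_of_int i' / n'" using that by blast
  next
    fix q assume "\<exists>n' i'. n' > 0 \<and> x ^ n' * \<theta> powi i' \<in> U \<and> q = real_of_int i' / n'"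
    then show "q = real_of_int i / n" using V_uniq[OF _ that(1) _ that(2)] by blast
  qed
  define N where "N = (\<lambda>x. if x = 0 then 0 else 2 powr V x)"
  have Vmult: "V (x * y) = V x + V y" if xy: "x \<noteq> 0" "y \<noteq> 0" for x y
  proof -
    obtain n i where n: "n > 0" "x ^ n * \<theta> powi i \<in> U" using V_ex[OF xy(1)] by auto
    obtain n' i' where n': "n' > 0" "y ^ n' * \<theta> powi i' \<in> U" using V_ex[OF xy(2)] by auto
    have "(x ^ n * \<theta> powi i) ^ n' * (y ^ n' * \<theta> powi i') ^ n \<in> U"
      by (rule Um[OF Up[OF n(2)] Up[OF n'(2)]])
    also have "(x ^ n * \<theta> powi i) ^ n' * (y ^ n' * \<theta> powi i') ^ n = (x * y) ^ (n * n') * \<theta> powi (i * int n' + i' * int n)"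
    proof -
      have "(x ^ n * \<theta> powi i) ^ n' = x ^ (n * n') * \<theta> powi (i * int n')" 
        by (simp add: power_mult_distrib power_mult power_int_mult)
      moreover have "(y ^ n' * \<theta> powi i') ^ n = y ^ (n * n') * \<theta> powi (i' * int n)" 
        by (simp add: power_mult_distrib mult.commute[of n n'] power_mult power_int_mult)
      ultimately show ?thesis using \<theta>(3) by (simp add: power_int_add power_mult_distrib)
    qed
    finally have "V (x * y) = real_of_int (i * int n' + i' * int n) / real (n * n')" using n n' by (intro V) auto
    also have "\<dots> = V x + V y" using V[OF n] V[OF n'] n n' by (simp add: field_simps)
    finally show ?thesis .
  qed
  have Vle: "V x \<le> 0" if x: "x \<in> B" "x \<noteq> 0" for x
  proof (rule ccontr)
    assume *: "\<not> V x \<le> 0"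
    obtain n i where n: "n > 0" "x ^ n * \<theta> powi i \<in> U" using V_ex[OF x(2)] by auto
    have i: "i > 0" using * V[OF n] n by (auto simp: zero_less_divide_iff not_le)
    have "\<theta> * (x ^ n * \<theta> ^ (nat i - 1) * inverse (x ^ n * \<theta> powi i)) = 1"
      using i x \<theta>(3) by (cases "nat i") (auto simp: power_int_def field_simps)
    moreover have "x ^ n * \<theta> ^ (nat i - 1) * inverse (x ^ n * \<theta> powi i) \<in> B"
      using n(2) x(1) subring_set_power[OF ring] \<theta>(1) cl by (auto simp: U_def)
    ultimately show False using \<theta>(2) by blast
  qed
  have V1: "V 1 = 0" using V[of 1 1 0] U1 by simp
  have "absval N"
  proof
    fix x y
    show "N (x * y) = N x * N y" by (simp add: N_def Vmult powr_add)
    show "N (x + y) \<le> max (N x) (N y)"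
    proof (cases "x = 0 \<or> y = 0 \<or> x + y = 0")
      case True
      then show ?thesis by (auto simp: N_def le_max_iff_disj)
    next
      case False
      have *: "V (x + y) \<le> V y" if "x * inverse y \<in> B" "x \<noteq> 0" "y \<noteq> 0" "x + y \<noteq> 0" for x y
      proof -
        have e: "x + y = y * (x * inverse y + 1)" using that by (simp add: algebra_simps)
        moreover have "x * inverse y + 1 \<noteq> 0" using e that by auto
        ultimately have "V (x + y) = V y + V (x * inverse y + 1)" using that Vmult by metis
        moreover have "V (x * inverse y + 1) \<le> 0" using Vle that cl \<open>x * inverse y + 1 \<noteq> 0\<close> by auto
        ultimately show ?thesis by simp
      qed
      have "x * inverse y \<in> B \<or> y * inverse x \<in> B"
        using val[of "x * inverse y"] by (simp add: mult.commute)
      then have "V (x + y) \<le> max (V x) (V y)"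
        using *[of x y] *[of y x] False by (auto simp: add.commute le_max_iff_disj)
      then show ?thesis using False by (auto simp: N_def le_max_iff_disj)
    qed
  qed (auto simp: N_def)
  moreover have "N x = 2 powr (real_of_int i / n)" if "x \<noteq> 0" "n > 0" "x ^ n * \<theta> powi i \<in> B" "inverse (x ^ n * \<theta> powi i) \<in> B" for x n i
    using V[of n x i] that \<theta>(3) by (simp add: N_def U_def)
  ultimately show ?thesis using that by blast
qed

section \<open>Absolute values at infinity\<close>

lemma powi_less_iff:
  assumes "0 < (r :: real)" "r < 1"
  shows "r powi i < r powi j \<longleftrightarrow> j < i"
proof -
  have *: "r powi i < r powi j" if "j < i" for i j
  proof -
    have "r powi i = r powi j * r ^ nat (i - j)"
      using that assms power_int_add[of r j "i - j"] by (simp add: power_int_def)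
    also have "\<dots> < r powi j * 1"
      using that assms by (intro mult_strict_left_mono) (auto simp: power_less_one_iff)
    finally show ?thesis by simp
  qed
  show ?thesis using *[of j i] *[of i j] by (cases i j rule: linorder_cases) auto
qed

lemma powi_inject: "0 < (r::real) \<Longrightarrow> r < 1 \<Longrightarrow> r powi i = r powi j \<longleftrightarrow> i = j"
  using powi_less_iff[of r i j] powi_less_iff[of r j i] by (cases i j rule: linorder_cases) auto

lemma powi_le_iff: "0 < (r::real) \<Longrightarrow> r < 1 \<Longrightarrow> r powi i \<le> r powi j \<longleftrightarrow> j \<le> i"
  using powi_less_iff[of r j i] by (simp add: linorder_not_less[symmetric])

text \<open>The value at \<open>T_elem\<close> determines \<open>N\<close> on
  \<open>k_field\<close>: nonzero constants are roots of unity, hence of absolute value 1, and so a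
  polynomial of degree \<open>d\<close> has absolute value \<open>2 ^ d\<close>.\<close>

locale inf_absval = absval N for N :: "'a::{field,finite} kbar \<Rightarrow> real" +
  assumes N_T [simp]: "N T_elem = 2"

lemma k_field_least:
  assumes A: "subfield A Amb" and "T_elem \<in> A" and "range const \<subseteq> A"
  shows "(k_field :: 'a::{field,finite} kbar set) \<subseteq> A"
proof -
  have poly: "to_ac (Fract f 1) \<in> A" for f :: "'a poly"
  proof (induction f)
    case 0
    then show ?case using sf_0[OF A] by (simp add: fract_collapse)
  next
    case (pCons a f)
    have "Fract (pCons a f) 1 = Fract [:a:] 1 + Fract [:0, 1:] 1 * Fract f 1" by simp
    then have "to_ac (Fract (pCons a f) 1) = const a + T_elem * to_ac (Fract f 1)"
      by (simp only: const_def T_elem_def to_ac_add to_ac_mult)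
    then show ?case using pCons.IH assms by (auto intro!: sf_intros)
  qed
  show ?thesis
  proof
    fix x :: "'a kbar" assume "x \<in> k_field"
    then obtain r where r: "x = to_ac r" by (auto simp: k_field_def)
    obtain f g where "r = Fract f g" "g \<noteq> 0" by (cases r) auto
    then have "x = to_ac (Fract f 1) / to_ac (Fract g 1)" using r by (simp flip: to_ac_divide)
    then show "x \<in> A" using poly A by (auto intro: sf_intros)
  qed
qed

context inf_absval
begin

lemma N_Fqm: "x \<in> Fqm m \<Longrightarrow> m \<ge> 1 \<Longrightarrow> x \<noteq> 0 \<Longrightarrow> N x = 1"
proof (rule N_root_of_unity)
  assume x: "x \<in> Fqm m" "m \<ge> 1" "x \<noteq> 0"
  have Q: "CARD('a) ^ m > 1" using Fqm_card_pos x by blast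
  then have "x * x ^ (CARD('a) ^ m - 1) = x ^ (CARD('a) ^ m)" by (metis power_minus_mult mult.commute
        gr_implies_not0 neq0_conv)
  then have "x * x ^ (CARD('a) ^ m - 1) = x * 1" using x by (simp add: Fqm_def)
  then show "x ^ (CARD('a) ^ m - 1) = 1" using x mult_left_cancel[of x] by blast
  show "CARD('a) ^ m - 1 > 0" using Q by simp
qed

lemma N_const: "c \<noteq> 0 \<Longrightarrow> N (const c) = 1"
  using N_Fqm[of "const c" 1] by simp

lemma N_const_le: "N (const c) \<le> 1"
  using N_const[of c] by (cases "c = 0") auto

lemma N_Fqm_le: "x \<in> Fqm m \<Longrightarrow> m \<ge> 1 \<Longrightarrow> N x \<le> 1"
  using N_Fqm[of x m] by (cases "x = 0") auto

text \<open>Distinct elements of \<open>Fqm m\<close> are therefore incongruent modulo the elements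
  of absolute value below 1, so they can serve as residue representatives.\<close>

lemma N_Fqm_less: "x \<in> Fqm m \<Longrightarrow> m \<ge> 1 \<Longrightarrow> N x < 1 \<Longrightarrow> x = 0"
  using N_Fqm[of x m] by (cases "x = 0") auto

lemma N_k:
  assumes "x \<in> k_field" "x \<noteq> 0"
  shows "N x = 2 powi (- inf_val x)"
proof -
  have poly: "f \<noteq> 0 \<Longrightarrow> N (to_ac (Fract f 1)) = 2 ^ Polynomial.degree f" for f :: "'a poly"
  proof (induction f)
    case (pCons a f)
    have "Fract (pCons a f) 1 = Fract [:a:] 1 + Fract [:0, 1:] 1 * Fract f 1" by simp
    then have e: "to_ac (Fract (pCons a f) 1) = const a + T_elem * to_ac (Fract f 1)"
      by (simp only: const_def T_elem_def to_ac_add to_ac_mult)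
    show ?case
    proof (cases "f = 0")
      case True
      then show ?thesis using pCons N_const[of a] e by (auto simp: fract_collapse)
    next
      case False
      then have "N (T_elem * to_ac (Fract f 1)) = 2 * 2 ^ Polynomial.degree f" using pCons.IH by (simp add: N_mult)
      moreover have "N (const a) < 2 * 2 ^ Polynomial.degree f"
        using N_const_le[of a] one_le_power[of "2 :: real" "Polynomial.degree f"] by linarith
      ultimately show ?thesis unfolding e using N_add_eq[of "const a" "T_elem * to_ac (Fract f 1)"] False by simp
    qed
  qed simp
  obtain r where r: "x = to_ac r" using assms by (auto simp: k_field_def)
  obtain f g where fg: "r = Fract f g" "g \<noteq> 0" by (cases r) auto
  then have "f \<noteq> 0" using assms r by (auto simp: fract_collapse)
  have "x = to_ac (Fract f 1) / to_ac (Fract g 1)" using r fg by (simp flip: to_ac_divide)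
  then have "N x = 2 ^ Polynomial.degree f / 2 ^ Polynomial.degree g" using poly fg \<open>f \<noteq> 0\<close> by (simp add: N_divide)
  also have "\<dots> = 2 powi (int (Polynomial.degree f) - int (Polynomial.degree g))" by (simp add: power_int_diff)
  finally show ?thesis using inf_val_Fract[of f g] r fg \<open>f \<noteq> 0\<close> by simp
qed

end

section \<open>Normalized valuations on a subfield\<close>

context
  fixes A :: "'b::field set" and v :: "'b \<Rightarrow> int"
  assumes v: "prime_valuation A v" and A: "subfield A Amb"
begin

lemma pv_mult: "x \<in> A \<Longrightarrow> y \<in> A \<Longrightarrow> x \<noteq> 0 \<Longrightarrow> y \<noteq> 0 \<Longrightarrow> v (x * y) = v x + v y"
  and pv_add: "x \<in> A \<Longrightarrow> y \<in> A \<Longrightarrow> x \<noteq> 0 \<Longrightarrow> y \<noteq> 0 \<Longrightarrow> x + y \<noteq> 0 \<Longrightarrow> v (x + y) \<ge> min (v x) (v y)"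
  using v by (auto simp: prime_valuation_def)

lemma pv_surj: "\<exists>x\<in>A. x \<noteq> 0 \<and> v x = i"
proof -
  have "i \<in> v ` (A - {0})" using v by (auto simp: prime_valuation_def)
  then show ?thesis by auto
qed

lemma pv_1: "v 1 = 0"
  using pv_mult[of 1 1] sf_1[OF A] by simp

lemma pv_power: "x \<in> A \<Longrightarrow> x \<noteq> 0 \<Longrightarrow> v (x ^ n) = int n * v x"
  by (induction n) (auto simp: pv_1 pv_mult sf_power[OF A] algebra_simps)

lemma pv_inverse: "x \<in> A \<Longrightarrow> x \<noteq> 0 \<Longrightarrow> v (inverse x) = - v x"
  using pv_mult[of x "inverse x"] pv_1 sf_inverse[OF A] by simp

lemma pv_powi: "x \<in> A \<Longrightarrow> x \<noteq> 0 \<Longrightarrow> v (x powi i) = i * v x"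
  by (auto simp: power_int_def pv_power pv_inverse sf_inverse[OF A] algebra_simps)

lemma pv_uminus: "x \<in> A \<Longrightarrow> x \<noteq> 0 \<Longrightarrow> v (- x) = v x"
proof -
  assume x: "x \<in> A" "x \<noteq> 0"
  have m: "- 1 \<in> A" using A by (intro sf_intros)
  have "2 * v (- 1) = 0" using pv_power[OF m, of 2] pv_1 by simp
  then show ?thesis using pv_mult[OF m x(1)] x by simp
qed

lemma subring_val_ring: "subring_set (val_ring A v)"
  unfolding subring_set_def
proof (intro conjI ballI)
  show "1 \<in> val_ring A v" using pv_1 sf_1[OF A] by (simp add: val_ring_def)
next
  fix x assume "x \<in> val_ring A v"
  then show "- x \<in> val_ring A v" using pv_uminus[of x] sf_uminus[OF A] by (cases "x = 0") (auto simp: val_ring_def)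
next
  fix x y assume xy: "x \<in> val_ring A v" "y \<in> val_ring A v"
  then show "x + y \<in> val_ring A v" using pv_add[of x y] sf_add[OF A] 
    by (cases "x = 0 \<or> y = 0 \<or> x + y = 0") (auto simp: val_ring_def)
  from xy show "x * y \<in> val_ring A v" using pv_mult[of x y] sf_mult[OF A] 
    by (cases "x = 0 \<or> y = 0") (auto simp: val_ring_def)
qed

end

lemma inf_val_T: "inf_val (T_elem :: 'a::{field,finite} kbar) = - 1"
proof -
  have "[:0, 1 :: 'a:] \<noteq> 0" "(1 :: 'a poly) \<noteq> 0" by auto
  from inf_val_Fract[OF this] show ?thesis by (simp add: T_elem_def)
qed

lemma kbar_algebraic:
  fixes x :: "'a::{field,finite} kbar"
  shows "\<exists>p. p \<noteq> 0 \<and> (\<forall>i. Polynomial.coeff p i \<in> k_field) \<and> poly p x = 0"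
proof -
  obtain p :: "'a poly fract poly" where p: "p \<noteq> 0" "poly (map_poly to_ac p) x = 0"
    by (rule alg_closure_algebraic[of x])
  moreover have "map_poly to_ac p \<noteq> 0" using p by (auto simp: poly_eq_iff coeff_map_poly)
  ultimately show ?thesis by (intro exI[of _ "map_poly to_ac p"]) (auto simp: coeff_map_poly k_field_def)
qed

text \<open>Chevalley's theorem extends the valuation ring of \<open>v\<close> while \<theta> = 1/T
  stays a nonunit. As \<open>v \<theta> = e\<close>, the element
  \<open>x ^ e * \<theta> powi (- v x)\<close> is a unit of \<open>val_ring A v\<close>, which pins
  \<open>N\<close> down on \<open>A\<close>.\<close>

theorem infinite_prime_absval:
  fixes A :: "'a::{field,finite} kbar set"
  assumes inf: "infinite_prime A v" and A: "subfield A Amb" and k: "k_field \<subseteq> A"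
  obtains N e where "inf_absval N" "e > 0" "has_ram_index v k_field inf_val e" 
    "\<And>x. x \<in> A \<Longrightarrow> x \<noteq> 0 \<Longrightarrow> N x = 2 powr (- real_of_int (v x) / real e)"
proof -
  have v: "prime_valuation A v" using inf by (simp add: infinite_prime_def)
  obtain e where e: "has_ram_index v k_field inf_val e" using inf by (auto simp: infinite_prime_def lies_over_def)
  then have e0: "e > 0" and ve: "\<And>x. x \<in> k_field \<Longrightarrow> x \<noteq> 0 \<Longrightarrow> v x = int e * inf_val x"
    by (auto simp: has_ram_index_def)
  define \<theta> where "\<theta> = inverse (T_elem :: 'a kbar)"
  have TA: "T_elem \<in> A" using k T_in_k by auto
  have \<theta>A: "\<theta> \<in> A" "\<theta> \<noteq> 0" using TA A by (auto simp: \<theta>_def intro: sf_intros)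
  have vT: "v T_elem = - int e" using ve[of T_elem] by (simp add: inf_val_T)
  have v\<theta>: "v \<theta> = int e" using pv_inverse[OF v A TA] vT by (simp add: \<theta>_def)
  note ring = subring_val_ring[OF v A]
  have \<theta>B: "\<theta> \<in> val_ring A v" using v\<theta> \<theta>A by (simp add: val_ring_def)
  have "\<theta> * b \<noteq> 1" if "b \<in> val_ring A v" for b
  proof
    assume *: "\<theta> * b = 1"
    then have "b \<noteq> 0" by auto
    then have "v (\<theta> * b) > 0" using pv_mult[OF v A \<theta>A(1), of b] that v\<theta> e0 \<theta>A by (auto simp: val_ring_def)
    then show False using * pv_1[OF v A] by simp
  qed
  from valuation_ring_extension[OF ring \<theta>B this]
  obtain B where B: "subring_set B" "val_ring A v \<subseteq> B" "\<And>b. b \<in> B \<Longrightarrow> \<theta> * b \<noteq> 1" "\<And>x. x \<in> B \<or> inverse x \<in> B"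
    by blast
  have unit: "x \<in> B \<and> inverse x \<in> B" if "x \<in> A" "x \<noteq> 0" "v x = 0" for x
    using that pv_inverse[OF v A that(1,2)] sf_inverse[OF A] B(2) by (auto simp: val_ring_def subset_iff)
  have k_unit: "\<exists>i. a * \<theta> powi i \<in> B \<and> inverse (a * \<theta> powi i) \<in> B" if "a \<in> k_field" "a \<noteq> 0" for a
  proof (intro exI[of _ "- inf_val a"] unit)
    have aA: "a \<in> A" using k that by auto
    then show "a * \<theta> powi - inf_val a \<in> A" using \<theta>A A by (auto intro: sf_intros)
    show "a * \<theta> powi - inf_val a \<noteq> 0" using that \<theta>A by simp
    show "v (a * \<theta> powi - inf_val a) = 0"
      using pv_mult[OF v A aA, of "\<theta> powi - inf_val a"] sf_powi[OF A \<theta>A(1)] \<theta>A that ve[OF that] pv_powi[OF v A \<theta>A] v\<theta>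
      by simp
  qed
  have "\<theta> \<in> B" using \<theta>B B by auto
  from absval_of_valuation_ring[OF B(1,4) this B(3) \<theta>A(2) k_unit kbar_algebraic]
  obtain N where N: "absval N" "\<And>x n i. x \<noteq> 0 \<Longrightarrow> n > 0 \<Longrightarrow> x ^ n * \<theta> powi i \<in> B \<Longrightarrow> inverse (x ^ n * \<theta> powi i) \<in> B
      \<Longrightarrow> N x = 2 powr (real_of_int i / n)" by auto
  have NA: "N x = 2 powr (- real_of_int (v x) / real e)" if x: "x \<in> A" "x \<noteq> 0" for x
  proof -
    have "v (x ^ e * \<theta> powi (- v x)) = 0"
      using pv_mult[OF v A, of "x ^ e" "\<theta> powi - v x"] sf_powi[OF A \<theta>A(1)] sf_power[OF A x(1)] \<theta>A x 
        pv_powi[OF v A \<theta>A] v\<theta> pv_power[OF v A x] by simp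
    then have "x ^ e * \<theta> powi (- v x) \<in> B \<and> inverse (x ^ e * \<theta> powi (- v x)) \<in> B"
      using x \<theta>A A by (intro unit) (auto intro: sf_intros)
    then show ?thesis using N(2)[of x e "- v x"] x e0 by simp
  qed
  have "inf_absval N"
    using N(1) NA[OF TA] vT e0 by (simp add: inf_absval_def inf_absval_axioms_def)
  then show ?thesis using that e0 e NA by blast
qed

context inf_absval
begin

text \<open>Formulated with \<open>N\<close> and not with a valuation, so that generators for a
  field and for its subfields are measured on one scale and compared as powers.\<close>

definition uniformizer :: "'a kbar set \<Rightarrow> 'a kbar \<Rightarrow> bool"
  where "uniformizer A \<pi> \<longleftrightarrow> \<pi> \<in> A \<and> \<pi> \<noteq> 0 \<and> N \<pi> < 1 \<and> (\<forall>x\<in>A - {0}. \<exists>i. N x = N \<pi> powi i)"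

text \<open>A nonzero subgroup of the integers is generated by its least positive element; the
  exponent of \<open>1 / T\<close> shows that the subgroup is nonzero.\<close>

lemma uniformizer_exists:
  assumes A: "subfield A Amb" and T: "T_elem \<in> A" and \<rho>: "0 < \<rho>" "\<rho> < 1"
    and disc: "\<And>x. x \<in> A \<Longrightarrow> x \<noteq> 0 \<Longrightarrow> \<exists>i. N x = \<rho> powi i"
  obtains \<pi> where "uniformizer A \<pi>"
proof -
  define G where "G = {n :: nat. n > 0 \<and> (\<exists>x\<in>A - {0}. N x = \<rho> ^ n)}"
  have "\<exists>n. n \<in> G"
  proof -
    have iT: "inverse T_elem \<in> A" using A T by (intro sf_intros)
    then obtain i where i: "N (inverse T_elem) = \<rho> powi i" using disc by force
    have "i > 0"
    proof (rule ccontr)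
      assume "\<not> i > 0"
      then have "\<rho> powi i \<ge> \<rho> powi 0" using powi_le_iff[OF \<rho>, of 0 i] by simp
      then show False using i by (simp add: N_inverse)
    qed
    then have "N (inverse T_elem) = \<rho> ^ nat i" using i by (simp add: power_int_def)
    then have "nat i \<in> G" using iT \<open>i > 0\<close> by (force simp: G_def)
    then show ?thesis ..
  qed
  define g where "g = (LEAST n. n \<in> G)"
  have g: "g \<in> G" "\<And>n. n \<in> G \<Longrightarrow> g \<le> n" unfolding g_def using \<open>\<exists>n. n \<in> G\<close> by (auto intro: LeastI_ex Least_le)
  then obtain \<pi> where \<pi>: "\<pi> \<in> A" "\<pi> \<noteq> 0" "N \<pi> = \<rho> ^ g" "g > 0" by (auto simp: G_def)
  have "\<exists>i. N x = N \<pi> powi i" if x: "x \<in> A" "x \<noteq> 0" for x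
  proof -
    obtain i where i: "N x = \<rho> powi i" using disc x by blast
    define r where "r = nat (i mod int g)"
    have r: "int r = i mod int g" "r < g" using \<pi>(4) by (auto simp: r_def nat_less_iff)
    have y: "x * \<pi> powi (- (i div int g)) \<in> A - {0}" using x \<pi> A by (auto intro: sf_intros)
    have "N (x * \<pi> powi (- (i div int g))) = \<rho> powi i * (\<rho> powi int g) powi (- (i div int g))"
      by (simp add: N_mult N_powi i \<pi>)
    also have "\<dots> = \<rho> powi (i - int g * (i div int g))"
      using \<rho> by (simp add: power_int_diff power_int_minus power_int_mult field_simps)
    also have "i - int g * (i div int g) = int r" using r by (simp add: minus_mult_div_eq_mod)
    finally have Nr: "N (x * \<pi> powi (- (i div int g))) = \<rho> ^ r" by simp
    have "r = 0"
    proof (rule ccontr)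
      assume "r \<noteq> 0"
      then have "r \<in> G" using Nr y unfolding G_def by blast
      then show False using g(2) r(2) by fastforce
    qed
    then have "i = int g * (i div int g)" using r by (auto elim: dvdE)
    then have "N x = (\<rho> powi int g) powi (i div int g)" using i power_int_mult[of \<rho> "int g" "i div int g"] by metis
    then show ?thesis using \<pi> by (auto intro!: exI[of _ "i div int g"])
  qed
  moreover have "N \<pi> < 1" using \<pi> \<rho> by (simp add: power_less_one_iff)
  ultimately show ?thesis using \<pi> by (intro that[of \<pi>]) (auto simp: uniformizer_def)
qed

text \<open>The converse of \<open>infinite_prime_absval\<close>: an absolute value that is discrete
  on \<open>A\<close> yields an infinite prime of \<open>A\<close>. Writing
  \<open>2 = N \<pi> powi (- e)\<close> exhibits \<open>e\<close> as the ramification index over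
  \<open>k_field\<close>.\<close>

lemma infinite_prime_of_uniformizer:
  assumes A: "subfield A Amb" and k: "k_field \<subseteq> A" and \<pi>: "uniformizer A \<pi>"
  obtains v where "infinite_prime A v" "\<And>x. x \<in> A \<Longrightarrow> x \<noteq> 0 \<Longrightarrow> N x = N \<pi> powi v x"
proof -
  define v where "v = (\<lambda>x. SOME i. N x = N \<pi> powi i)"
  have \<pi>': "\<pi> \<in> A" "\<pi> \<noteq> 0" "N \<pi> > 0" "N \<pi> < 1" using \<pi> by (auto simp: uniformizer_def)
  have v: "N x = N \<pi> powi v x" if "x \<in> A" "x \<noteq> 0" for x
    using \<pi> that someI_ex[of "\<lambda>i. N x = N \<pi> powi i"] by (auto simp: uniformizer_def v_def)
  have vI: "v x = i" if "x \<in> A" "x \<noteq> 0" "N x = N \<pi> powi i" for x i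
    using v[OF that(1,2)] that(3) powi_inject[OF \<pi>'(3,4), of "v x" i] by simp
  have "prime_valuation A v"
    unfolding prime_valuation_def
  proof (intro conjI ballI impI)
    fix x y assume xy: "x \<in> A - {0}" "y \<in> A - {0}"
    show "v (x * y) = v x + v y"
      using xy \<pi>' by (intro vI) (auto simp: N_mult v[of x] v[of y] power_int_add sf_mult[OF A])
    assume xy0: "x + y \<noteq> 0"
    show "v (x + y) \<ge> min (v x) (v y)"
    proof (rule ccontr)
      assume "\<not> v (x + y) \<ge> min (v x) (v y)"
      then have l: "v (x + y) < v x" "v (x + y) < v y" by auto
      have "N x < N (x + y)" "N y < N (x + y)"
        using xy xy0 l powi_less_iff[OF \<pi>'(3,4)] v[of x] v[of y] v[of "x + y"] sf_add[OF A] by auto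
      then show False using N_add[of x y] by simp
    qed
  next
    show "v ` (A - {0}) = UNIV"
    proof (intro equalityI subsetI UNIV_I)
      fix i :: int
      have "v (\<pi> powi i) = i" using \<pi>' A by (intro vI) (auto simp: N_powi intro: sf_intros)
      moreover have "\<pi> powi i \<in> A - {0}" using \<pi>' A by (auto intro: sf_intros)
      ultimately show "i \<in> v ` (A - {0})" by (metis imageI)
    qed
  qed
  moreover have "lies_over v k_field inf_val"
  proof -
    have TA: "T_elem \<in> A" using k T_in_k by auto
    define e where "e = - v T_elem"
    have two: "2 = N \<pi> powi (- e)" using v[OF TA] by (simp add: e_def)
    have "e > 0"
    proof (rule ccontr)
      assume "\<not> e > 0"
      then have "N \<pi> powi (- e) \<le> N \<pi> powi 0" using powi_le_iff[OF \<pi>'(3,4), of "- e" 0] by simp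
      then show False using two by simp
    qed
    have "v x = int (nat e) * inf_val x" if "x \<in> k_field - {0}" for x
    proof (rule vI)
      have "N x = (N \<pi> powi (- e)) powi (- inf_val x)" using N_k[of x] that two by auto
      also have "\<dots> = N \<pi> powi (e * inf_val x)" by (simp flip: power_int_mult)
      finally show "N x = N \<pi> powi (int (nat e) * inf_val x)" using \<open>e > 0\<close> by simp
    qed (use that k in auto)
    then show ?thesis unfolding lies_over_def has_ram_index_def using \<open>e > 0\<close> by (intro exI[of _ "nat e"]) auto
  qed
  ultimately show ?thesis using that v by (simp add: infinite_prime_def)
qed

end

section \<open>The residue degree of the cyclotomic fields at infinity\<close>

text \<open>The operator by which the indeterminate acts on the Carlitz module with parameter
  \<theta>.\<close>

definition cz :: "'a::{field,finite} kbar \<Rightarrow> 'a kbar \<Rightarrow> 'a kbar"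
  where "cz \<theta> x = x ^ CARD('a) + \<theta> * x"

lemma carlitz_eq: "carlitz \<theta> M u = (\<Sum>i\<le>Polynomial.degree M. const (Polynomial.coeff M i) * (cz \<theta> ^^ i) u)"
  unfolding carlitz_def cz_def[abs_def] ..

lemma cz_add: "cz \<theta> (x + y) = cz \<theta> x + cz \<theta> y"
  and cz_scale: "cz \<theta> (const c * x) = const c * cz \<theta> x"
  by (simp_all add: cz_def frob_add power_mult_distrib algebra_simps)

lemma cz_0: "cz \<theta> 0 = (0 :: 'a::{field,finite} kbar)"
  using card_gt_1[where 'a = 'a] by (simp add: cz_def)

lemma cz_sum: "cz \<theta> (sum f I) = (\<Sum>i\<in>I. cz \<theta> (f i))"
  by (simp add: cz_def frob_sum sum.distrib sum_distrib_left)

lemma carlitz_cz: "carlitz \<theta> M (cz \<theta> u) = cz \<theta> (carlitz \<theta> M u)"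
  unfolding carlitz_eq cz_sum cz_scale by (simp only: funpow_swap1[of "cz \<theta>"])

context inf_absval
begin

section \<open>The closure of the Laurent polynomials in a small element\<close>

context
  fixes \<alpha> :: "'a kbar"
  assumes \<alpha>: "\<alpha> \<noteq> 0" "N \<alpha> < 1"
begin

definition Lau :: "'a kbar set"
  where "Lau = Fq.span (range (\<lambda>i::int. \<alpha> powi i))"

text \<open>Stands in for the part of the completion \<open>F_q((\<alpha>))\<close> that lies in the
  algebraic closure.\<close>

definition App :: "'a kbar set"
  where "App = {x. \<forall>\<epsilon>>0. \<exists>y\<in>Lau. N (x - y) < \<epsilon>}"

lemma N_\<alpha>: "0 < N \<alpha>" "N \<alpha> < 1"
  using \<alpha> by auto

lemma Lau_mult:
  assumes "x \<in> Lau" "y \<in> Lau"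
  shows "x * y \<in> Lau"
proof -
  have 1: "\<alpha> powi i * y \<in> Lau" if "y \<in> Lau" for i y
    using that unfolding Lau_def
  proof (induction y rule: Fq.span_induct_alt)
    case (step c x y)
    then obtain j where "x = \<alpha> powi j" by auto
    then have "\<alpha> powi i * (const c * x + y) = const c * \<alpha> powi (i + j) + \<alpha> powi i * y"
      using \<alpha>(1) by (simp add: power_int_add algebra_simps)
    moreover have "\<alpha> powi (i + j) \<in> Fq.span (range (\<lambda>i::int. \<alpha> powi i))" by (intro Fq.span_base) auto
    ultimately show ?case using step.IH by (simp only: Fq.span_add Fq.span_scale)
  qed (simp add: Fq.span_zero)
  show ?thesis using assms(1) unfolding Lau_def
  proof (induction x rule: Fq.span_induct_alt)
    case (step c x z)
    then have "x * y \<in> Lau" using 1[OF assms(2)] by auto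
    moreover have "(const c * x + z) * y = const c * (x * y) + z * y" by (simp add: algebra_simps)
    ultimately show ?case using step.IH unfolding Lau_def by (auto intro!: Fq.span_add Fq.span_scale)
  qed (simp add: Fq.span_zero)
qed

lemma Lau_add: "x \<in> Lau \<Longrightarrow> y \<in> Lau \<Longrightarrow> x + y \<in> Lau"
  unfolding Lau_def by (rule Fq.span_add)

lemma Lau_monomial: "const c * \<alpha> powi i \<in> Lau"
  unfolding Lau_def by (intro Fq.span_scale Fq.span_base) auto

text \<open>The powers of \<open>\<alpha>\<close> have distinct absolute values, so one term dominates.\<close>

lemma Lau_leading:
  assumes "y \<in> Lau" "y \<noteq> 0"
  obtains c i where "c \<noteq> 0" "N (y - const c * \<alpha> powi i) < N y"
proof -
  obtain t r where t: "finite t" "t \<subseteq> range (\<lambda>i::int. \<alpha> powi i)" "y = (\<Sum>a\<in>t. const (r a) * a)"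
    using assms(1) unfolding Lau_def Fq.span_explicit by auto
  define u where "u = {a \<in> t. r a \<noteq> 0}"
  have u: "finite u" "y = (\<Sum>a\<in>u. const (r a) * a)"
    using t(1,3) by (auto simp: u_def intro!: sum.mono_neutral_right)
  have "u \<noteq> {}" using u assms(2) by auto
  then have "Max (N ` u) \<in> N ` u" using u(1) by (intro Max_in) auto
  then obtain a where a': "a \<in> u" "N a = Max (N ` u)" by auto
  then have a: "a \<in> u" "\<And>b. b \<in> u \<Longrightarrow> N b \<le> N a" using u(1) by auto
  obtain i where i: "a = \<alpha> powi i" using a(1) t(2) unfolding u_def by blast
  have less: "N b < N a" if bu: "b \<in> u - {a}" for b
  proof -
    obtain j where j: "b = \<alpha> powi j" using bu t(2) unfolding u_def by blast
    then have "i \<noteq> j" using bu i by auto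
    then have "N b \<noteq> N a" using powi_inject[OF N_\<alpha>] i j by (simp add: N_powi)
    then show ?thesis using a(2)[of b] bu by auto
  qed
  have y: "y - const (r a) * a = (\<Sum>b\<in>u - {a}. const (r b) * b)"
    using u a(1) by (simp add: sum.remove[of u a])
  have c: "r a \<noteq> 0" using a(1) by (simp add: u_def)
  have Na: "N (const (r a) * a) = N a" "N a > 0" using c i \<alpha> by (auto simp: N_mult N_const)
  have l: "N (y - const (r a) * a) < N a"
    unfolding y
  proof (rule N_sum_less[OF Na(2)])
    fix b assume "b \<in> u - {a}"
    then show "N (const (r b) * b) < N a" using less[of b] by (auto simp: N_mult N_const u_def)
  qed
  then have "N y = N a" using N_add_eq[of "y - const (r a) * a" "const (r a) * a"] Na(1) by simp
  then show ?thesis using that[OF c, of i] l i by simp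
qed

text \<open>With this, a series need only be approximated by partial sums in \<open>App\<close>, and
  no limit has to be constructed.\<close>

lemma App_closed:
  assumes "\<And>\<epsilon>. \<epsilon> > 0 \<Longrightarrow> \<exists>y\<in>App. N (x - y) < \<epsilon>"
  shows "x \<in> App"
  unfolding App_def
proof (intro CollectI allI impI)
  fix \<epsilon> :: real assume e: "\<epsilon> > 0"
  obtain y where y: "y \<in> App" "N (x - y) < \<epsilon>" using assms e by blast
  obtain z where "z \<in> Lau" "N (y - z) < \<epsilon>" using y e by (auto simp: App_def)
  then show "\<exists>y\<in>Lau. N (x - y) < \<epsilon>" using N_trans_less[OF y(2)] by blast
qed

lemma Lau_subset_App: "Lau \<subseteq> App"
  unfolding App_def by (auto intro!: bexI)

lemma App_add: "x \<in> App \<Longrightarrow> y \<in> App \<Longrightarrow> x + y \<in> App"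
  unfolding App_def
proof (intro CollectI allI impI)
  fix \<epsilon> :: real assume e: "\<epsilon> > 0"
  assume "x \<in> {x. \<forall>\<epsilon>>0. \<exists>y\<in>Lau. N (x - y) < \<epsilon>}" "y \<in> {x. \<forall>\<epsilon>>0. \<exists>y\<in>Lau. N (x - y) < \<epsilon>}"
  then obtain x' y' where *: "x' \<in> Lau" "N (x - x') < \<epsilon>" "y' \<in> Lau" "N (y - y') < \<epsilon>" using e by blast
  have "N ((x + y) - (x' + y')) < \<epsilon>" using N_add_less[OF *(2,4)] by (simp add: algebra_simps)
  then show "\<exists>z\<in>Lau. N (x + y - z) < \<epsilon>" using Lau_add * by blast
qed

lemma App_mult: "x \<in> App \<Longrightarrow> y \<in> App \<Longrightarrow> x * y \<in> App"
  unfolding App_def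
proof (intro CollectI allI impI)
  fix \<epsilon> :: real assume e: "\<epsilon> > 0"
  assume a: "x \<in> {x. \<forall>\<epsilon>>0. \<exists>y\<in>Lau. N (x - y) < \<epsilon>}" "y \<in> {x. \<forall>\<epsilon>>0. \<exists>y\<in>Lau. N (x - y) < \<epsilon>}"
  \<comment> \<open>\<open>C\<close> bounds both factors; \<open>d \<le> 1\<close> keeps the
    approximant \<open>y'\<close> below \<open>C\<close> as well, and
    \<open>C * d \<le> \<epsilon>\<close> bounds the two error terms.\<close>
  define C where "C = 1 + N x + N y"
  have C: "C \<ge> 1" "N x \<le> C" "N y \<le> C" by (auto simp: C_def)
  define d where "d = min 1 (\<epsilon> / C)"
  have d: "d > 0" "d \<le> 1" "C * d \<le> \<epsilon>" using e C(1) by (auto simp: d_def min_def field_simps)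
  obtain x' y' where *: "x' \<in> Lau" "N (x - x') < d" "y' \<in> Lau" "N (y - y') < d" using a d(1) by blast
  have "N y' \<le> C" using N_diff[of y "y - y'"] * d C by simp
  have "N (x * y - x' * y') < \<epsilon>"
  proof -
    have e: "x * y - x' * y' = x * (y - y') + y' * (x - x')" by (simp add: algebra_simps)
    have l: "C * N (y - y') < C * d" "C * N (x - x') < C * d" using * C(1) by auto
    have "N (x * (y - y')) < \<epsilon>" unfolding N_mult 
      using mult_right_mono[OF C(2), of "N (y - y')"] l d(3) by simp
    moreover have "N (y' * (x - x')) < \<epsilon>" unfolding N_mult 
      using mult_right_mono[OF \<open>N y' \<le> C\<close>, of "N (x - x')"] l d(3) by simp
    ultimately show ?thesis unfolding e by (rule N_add_less)
  qed
  then show "\<exists>z\<in>Lau. N (x * y - z) < \<epsilon>" using Lau_mult * by blast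
qed

lemma const_in_App: "const c \<in> App"
  using Lau_monomial[of c 0] Lau_subset_App by auto

lemma \<alpha>_powi_in_App: "\<alpha> powi i \<in> App"
  using Lau_monomial[of 1 i] Lau_subset_App by auto

lemma App_uminus: "x \<in> App \<Longrightarrow> - x \<in> App"
  using App_mult[OF const_in_App[of "- 1"]] by simp

lemma App_power: "x \<in> App \<Longrightarrow> x ^ n \<in> App"
  using const_in_App[of 1] by (induction n) (auto intro: App_mult)

lemma App_sum: "(\<And>i. i \<in> I \<Longrightarrow> f i \<in> App) \<Longrightarrow> sum f I \<in> App"
  using const_in_App[of 0] by (induction I rule: infinite_finite_induct) (auto intro: App_add)

lemma App_leading:
  assumes "x \<in> App" "x \<noteq> 0"
  obtains c i where "c \<noteq> 0" "N (x - const c * \<alpha> powi i) < N x"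
proof -
  obtain y where y: "y \<in> Lau" "N (x - y) < N x" using assms N_pos[OF assms(2)] unfolding App_def by blast
  have Ny: "N y = N x" using N_eq_of_diff_less[OF y(2)] .
  then have "y \<noteq> 0" using assms by auto
  then obtain c i where ci: "c \<noteq> 0" "N (y - const c * \<alpha> powi i) < N y" using Lau_leading y(1) by blast
  then show ?thesis using that[of c i] N_trans_less[OF y(2), of "const c * \<alpha> powi i"] Ny by simp
qed

text \<open>Dividing \<open>x\<close> by its leading monomial \<open>m\<close> leaves
  \<open>1 - z\<close> with \<open>N z < 1\<close>, whose inverse is the sum of the geometric
  series; the partial sums lie in \<open>App\<close>.\<close>

lemma subfield_App: "subfield App Amb"
proof (rule subfieldI_Amb)
  fix x assume x: "x \<in> App" "x \<noteq> 0"
  obtain c i where ci: "c \<noteq> 0" "N (x - const c * \<alpha> powi i) < N x" using App_leading[OF x] .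
  define m where "m = const c * \<alpha> powi i"
  have m: "m \<noteq> 0" "N m = N x" using ci \<alpha> N_eq_of_diff_less[OF ci(2)] by (auto simp: m_def)
  define z where "z = 1 - x / m"
  have im: "inverse m \<in> App"
  proof -
    have "inverse m = const (inverse c) * \<alpha> powi (- i)"
    proof (rule inverse_unique)
      have "const c * const (inverse c) = (1 :: 'a kbar)" using ci(1) by (simp flip: const_simps)
      then show "m * (const (inverse c) * \<alpha> powi (- i)) = 1" using \<alpha>(1)
        by (simp add: m_def power_int_minus field_simps)
    qed
    then show ?thesis by (auto intro: App_mult const_in_App \<alpha>_powi_in_App)
  qed
  have z: "z \<in> App" unfolding z_def
    using App_add[OF const_in_App[of 1] App_uminus[OF App_mult[OF x(1) im]]] by (simp add: divide_inverse)
  have "z = (m - x) / m" using m by (simp add: z_def field_simps)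
  then have Nz: "N z < 1" using ci(2) m x by (simp add: N_divide m_def[symmetric] N_minus_commute[of m x])
  then have z1: "1 - z \<noteq> 0" by auto
  have N1z: "N (1 - z) = 1" using N_add_eq[of "- z" 1] Nz by simp
  have inv: "inverse (1 - z) \<in> App"
  proof (rule App_closed)
    fix \<epsilon> :: real assume "\<epsilon> > 0"
    then obtain J where J: "N z ^ J < \<epsilon>" using real_arch_pow_inv[OF _ Nz] by blast
    have "inverse (1 - z) - (\<Sum>j<J. z ^ j) = z ^ J / (1 - z)"
      using one_diff_power_eq[of z J] z1 by (simp add: field_simps)
    then have "N (inverse (1 - z) - (\<Sum>j<J. z ^ j)) < \<epsilon>" using J N1z by (simp add: N_divide N_power)
    then show "\<exists>y\<in>App. N (inverse (1 - z) - y) < \<epsilon>" by (intro bexI[of _ "\<Sum>j<J. z ^ j"] App_sum App_power[OF z])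
  qed
  have e: "inverse x = inverse m * inverse (1 - z)" using m x by (simp add: z_def field_simps)
  show "inverse x \<in> App" unfolding e by (rule App_mult[OF im inv])
qed (use const_in_App[of 1] in \<open>simp_all add: App_add App_mult App_uminus\<close>)

text \<open>The leading monomial of an element of absolute value 1 has exponent 0, so it is a
  constant.\<close>

lemma App_residue:
  assumes "x \<in> App" "N x \<le> 1"
  shows "\<exists>c. N (x - const c) < 1"
proof (cases "x = 0 \<or> N x < 1")
  case True
  then show ?thesis by (intro exI[of _ 0]) auto
next
  case False
  then have x: "x \<noteq> 0" "N x = 1" using assms(2) by auto
  obtain c i where ci: "c \<noteq> 0" "N (x - const c * \<alpha> powi i) < N x" using App_leading[OF assms(1) x(1)] .
  have "N \<alpha> powi i = N \<alpha> powi 0" using N_eq_of_diff_less[OF ci(2)] x ci(1) by (simp add: N_mult N_const N_powi)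
  then have "i = 0" using powi_inject[OF N_\<alpha>] by blast
  then show ?thesis using ci(2) x by auto
qed

lemma App_discrete: "x \<in> App \<Longrightarrow> x \<noteq> 0 \<Longrightarrow> \<exists>i. N x = N \<alpha> powi i"
proof -
  assume x: "x \<in> App" "x \<noteq> 0"
  obtain c i where ci: "c \<noteq> 0" "N (x - const c * \<alpha> powi i) < N x" using App_leading[OF x] .
  then show ?thesis using N_eq_of_diff_less[OF ci(2)] by (auto simp: N_mult N_const N_powi intro!: exI[of _ i])
qed

end

end

text \<open>
  A compatible system of generators of the torsion of the Carlitz module for \<open>\<F>\<^sub>q[1/T]\<close>:
  \<open>torsion_gen n\<close> generates the torsion of \<open>(1/T)\<^bsup>n+1\<^esup>\<close>.
\<close>

definition torsion_gen0 :: "'a::{field,finite} kbar"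
  where "torsion_gen0 = (SOME s. s ^ (CARD('a) - 1) = - inverse T_elem)"

primrec torsion_gen :: "nat \<Rightarrow> 'a::{field,finite} kbar"
  where "torsion_gen 0 = torsion_gen0"
  | "torsion_gen (Suc n) = (SOME x. cz (inverse T_elem) x = torsion_gen n)"

declare torsion_gen.simps(2) [simp del]

lemma cz_in: "subfield A Amb \<Longrightarrow> \<theta> \<in> A \<Longrightarrow> x \<in> A \<Longrightarrow> cz \<theta> x \<in> A"
  unfolding cz_def by (intro sf_intros)

lemma torsion_gen0_power: "torsion_gen0 ^ (CARD('a) - 1) = - inverse (T_elem :: 'a::{field,finite} kbar)"
proof -
  have "\<exists>s :: 'a kbar. s ^ (CARD('a) - 1) = - inverse T_elem"
    using card_gt_1[where 'a = 'a] by (intro nth_root_exists) simp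
  then show ?thesis unfolding torsion_gen0_def by (rule someI_ex)
qed

lemma torsion_gen_Suc: "cz (inverse T_elem) (torsion_gen (Suc n)) = (torsion_gen n :: 'a::{field,finite} kbar)"
proof -
  have "\<exists>x :: 'a kbar. cz (inverse T_elem) x = torsion_gen n"
  proof -
    let ?p = "Polynomial.monom 1 CARD('a) + [:- torsion_gen n, inverse T_elem:] :: 'a kbar poly"
    have "Polynomial.degree [:- torsion_gen n, inverse T_elem :: 'a kbar:] < CARD('a)"
      using card_gt_1[where 'a = 'a] by (simp add: degree_pCons_eq_if)
    then have "Polynomial.degree ?p = CARD('a)"
      by (subst degree_add_eq_left) (simp_all add: Polynomial.degree_monom_eq)
    then obtain x where "poly ?p x = 0" using alg_closed_imp_poly_has_root[of ?p] by auto
    then have "cz (inverse T_elem) x - torsion_gen n = 0" by (simp add: cz_def poly_monom algebra_simps)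
    then show ?thesis by auto
  qed
  then show ?thesis unfolding torsion_gen.simps by (rule someI_ex)
qed

lemma torsion_gen_funpow:
  "(cz (inverse T_elem) ^^ j) (torsion_gen (i + j)) = (torsion_gen i :: 'a::{field,finite} kbar)"
proof (induction j)
  case (Suc j)
  then show ?case using torsion_gen_Suc[of "i + j", where 'a = 'a] by (simp only: funpow_Suc_right o_def add_Suc_right)
qed simp

lemma torsion_gen0_nonzero: "torsion_gen0 \<noteq> (0 :: 'a::{field,finite} kbar)"
  using torsion_gen0_power[where 'a = 'a] card_gt_1[where 'a = 'a] by (auto simp: power_0_left)

lemma torsion_gen0_power_card:
  "torsion_gen0 ^ CARD('a) = - inverse T_elem * (torsion_gen0 :: 'a::{field,finite} kbar)"
  using torsion_gen0_power[where 'a = 'a] card_gt_1[where 'a = 'a]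
  by (metis power_minus_mult less_imp_le_nat less_le_trans zero_less_one)

text \<open>The kernel of \<open>cz\<close> at \<open>1 / T\<close> is the constant line through
  \<open>torsion_gen0\<close>, since quotients of its elements by \<open>torsion_gen0\<close>
  satisfy \<open>z ^ q = z\<close>; and \<open>cz\<close> maps the span for \<open>Suc n\<close>
  onto the span for \<open>n\<close>. Each step therefore adds one generator.\<close>

lemma theta_torsion_span:
  "(cz (inverse T_elem) ^^ Suc n) u = 0 \<Longrightarrow> u \<in> Fq.span (torsion_gen ` {..n})" for u :: "'a::{field,finite} kbar"
proof (induction n arbitrary: u)
  case 0
  then have "u ^ CARD('a) = - inverse T_elem * u" by (simp add: cz_def eq_neg_iff_add_eq_0)
  then have "(u / torsion_gen0) ^ CARD('a) = u / torsion_gen0"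
    using torsion_gen0_nonzero[where 'a = 'a]
    by (simp add: power_divide torsion_gen0_power_card)
  then obtain c where "u / torsion_gen0 = const c" using frob_fixed_const by blast
  then have "u = const c * torsion_gen 0" using torsion_gen0_nonzero[where 'a = 'a] by (simp add: field_simps)
  then show ?case by (auto intro: Fq.span_scale Fq.span_base)
next
  case (Suc n)
  have lift: "\<exists>y\<in>Fq.span (torsion_gen ` {..Suc n}). cz (inverse T_elem) y = x"
    if "x \<in> Fq.span (torsion_gen ` {..n})" for x :: "'a kbar"
    using that
  proof (induction x rule: Fq.span_induct_alt)
    case base
    then show ?case using cz_0 Fq.span_zero by blast
  next
    case (step c x y)
    then obtain z where z: "z \<in> Fq.span (torsion_gen ` {..Suc n})" "cz (inverse T_elem) z = y" by blast
    obtain i where i: "i \<le> n" "x = torsion_gen i" using step by auto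
    have "cz (inverse T_elem) (const c * torsion_gen (Suc i) + z) = const c * x + y"
      unfolding cz_add cz_scale torsion_gen_Suc z(2) i(2) ..
    moreover have "const c * torsion_gen (Suc i) + z \<in> Fq.span (torsion_gen ` {..Suc n})"
      using i by (intro Fq.span_add[OF _ z(1)] Fq.span_scale Fq.span_base) auto
    ultimately show ?case by blast
  qed
  have "(cz (inverse T_elem) ^^ Suc n) (cz (inverse T_elem) u) = 0"
    using Suc.prems by (simp only: funpow_Suc_right[of "Suc n"] o_def)
  then obtain y where y: "y \<in> Fq.span (torsion_gen ` {..Suc n})" "cz (inverse T_elem) y = cz (inverse T_elem) u"
    using lift Suc.IH by blast
  have "(u - y) ^ CARD('a) = - inverse T_elem * (u - y)"
    using y(2) by (simp add: cz_def frob_diff algebra_simps)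
  then have "((u - y) / torsion_gen0) ^ CARD('a) = (u - y) / torsion_gen0"
    using torsion_gen0_nonzero[where 'a = 'a]
    by (simp add: power_divide torsion_gen0_power_card)
  then obtain c where "(u - y) / torsion_gen0 = const c" using frob_fixed_const by blast
  then have "u = const c * torsion_gen 0 + y" using torsion_gen0_nonzero[where 'a = 'a] by (simp add: field_simps)
  moreover have "const c * torsion_gen 0 \<in> Fq.span (torsion_gen ` {..Suc n})" 
    by (intro Fq.span_scale Fq.span_base image_eqI[of _ _ 0]) auto
  ultimately show ?case using y(1) Fq.span_add by blast
qed

context inf_absval
begin

lemma N_power_diff_le:
  assumes "N x \<le> 1" "N y \<le> 1"
  shows "N (x ^ k - y ^ k) \<le> N (x - y)"
proof (induction k)
  case (Suc k)
  have e: "x ^ Suc k - y ^ Suc k = x * (x ^ k - y ^ k) + (x - y) * y ^ k" by (simp add: algebra_simps)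
  have "N (x * (x ^ k - y ^ k)) \<le> N (x - y)"
    using mult_mono[OF assms(1) Suc.IH] by (simp add: N_mult)
  moreover have "N ((x - y) * y ^ k) \<le> N (x - y)"
    using mult_left_mono[OF power_le_one[OF N_nonneg assms(2), of k], of "N (x - y)"] by (simp add: N_mult N_power)
  ultimately show ?case unfolding e by (rule N_add_le)
qed simp

text \<open>If \<open>N x \<ge> 1\<close>, the term \<open>x ^ q\<close> outweighs
  \<open>x / T\<close> in \<open>cz\<close>, so the image has absolute value at least 1 as well;
  smallness therefore passes from one generator to the next. It qualifies
  \<open>torsion_gen n\<close> as the element \<alpha> of \<open>App\<close>.\<close>

lemma torsion_gen_small: "torsion_gen n \<noteq> (0 :: 'a kbar) \<and> N (torsion_gen n) < 1"
proof (induction n)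
  case 0
  have "N torsion_gen0 ^ (CARD('a) - 1) = 1 / 2"
    using torsion_gen0_power[where 'a = 'a] by (simp flip: N_power) (simp add: N_inverse)
  then have "\<not> N torsion_gen0 \<ge> 1" using one_le_power[of "N torsion_gen0" "CARD('a) - 1"] by linarith
  then show ?case using torsion_gen0_nonzero[where 'a = 'a] by simp
next
  case (Suc n)
  let ?x = "torsion_gen (Suc n) :: 'a kbar"
  have c: "?x ^ CARD('a) + inverse T_elem * ?x = torsion_gen n" using torsion_gen_Suc[of n, where 'a = 'a] by (simp add: cz_def)
  have "?x \<noteq> 0" using c Suc.IH card_gt_1[where 'a = 'a] by (auto simp: power_0_left)
  moreover have "\<not> N ?x \<ge> 1"
  proof
    assume 1: "N ?x \<ge> 1"
    have "N ?x ^ 1 \<le> N ?x ^ CARD('a)" using 1 card_gt_1[where 'a = 'a] by (intro power_increasing) auto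
    then have 2: "N ?x \<le> N (?x ^ CARD('a))" by (simp add: N_power)
    have "N (inverse T_elem * ?x) = N ?x / 2" by (simp add: N_mult N_inverse)
    then have "N (inverse T_elem * ?x) < N (?x ^ CARD('a))" using 1 2 by linarith
    then have "N (inverse T_elem * ?x + ?x ^ CARD('a)) = N (?x ^ CARD('a))" by (rule N_add_eq)
    then have "N (torsion_gen n) \<ge> 1" using c 1 2 by (simp only: add.commute)
    then show False using Suc.IH by simp
  qed
  ultimately show ?case by linarith
qed

context
  fixes n :: nat and Z :: "'a kbar set"
  defines "Z \<equiv> App (torsion_gen n)"
begin

lemma small: "torsion_gen n \<noteq> (0 :: 'a kbar)" "N (torsion_gen n) < 1"
  using torsion_gen_small[of n] by auto

lemmas Z_closed = App_closed[OF small, folded Z_def]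
lemmas subfield_Z = subfield_App[OF small, folded Z_def]
lemmas const_in_Z = const_in_App[OF small, folded Z_def]

lemma gen_in_Z: "torsion_gen n \<in> Z"
  using \<alpha>_powi_in_App[OF small, of 1] by (simp add: Z_def)

text \<open>
  Since \<open>\<theta> = 1/T\<close> satisfies \<open>\<theta> = - (C\<^bsub>\<theta>\<^esub>\<^bsup>n\<^esup> \<lambda>)\<^bsup>q-1\<^esup>\<close>, it is the fixed point of a contraction whose iterates
  are polynomials in \<open>\<lambda>\<close>.
\<close>

lemma theta_in_Z: "inverse T_elem \<in> Z"
proof -
  let ?l = "torsion_gen n :: 'a kbar"
  define F where "F = (\<lambda>t. - (((cz t ^^ n) ?l) ^ (CARD('a) - 1)))"
  have F_fix: "F (inverse T_elem) = inverse T_elem"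
    using torsion_gen_funpow[of n 0, where 'a = 'a] torsion_gen0_power[where 'a = 'a] unfolding F_def by simp
  have iter_le: "N ((cz t ^^ i) ?l) \<le> N ?l" if t: "N t \<le> 1" for t i
  proof (induction i)
    case (Suc i)
    let ?y = "(cz t ^^ i) ?l"
    have "N ?y \<le> 1" using Suc.IH small(2) by simp
    then have "N ?y ^ CARD('a) \<le> N ?y ^ 1" using card_gt_1[where 'a = 'a] by (intro power_decreasing) auto
    then have "N (?y ^ CARD('a)) \<le> N ?l" using Suc.IH by (simp add: N_power)
    moreover have "N (t * ?y) \<le> N ?l" using mult_mono[OF t Suc.IH] by (simp add: N_mult)
    ultimately show ?case by (simp add: cz_def[of t ?y] N_add_le)
  qed simp
  \<comment> \<open>Varying \<open>t\<close> contributes \<open>(t - t') * ?y\<close> at each step,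
    and \<open>?y\<close> is no larger than the generator: this supplies the contraction factor
    \<open>N ?l\<close>.\<close>
  have iter_diff: "N ((cz t ^^ i) ?l - (cz t' ^^ i) ?l) \<le> N ?l * N (t - t')" if t: "N t \<le> 1" "N t' \<le> 1" for t t' i
  proof (induction i)
    case (Suc i)
    let ?y = "(cz t ^^ i) ?l" and ?y' = "(cz t' ^^ i) ?l"
    have y: "N ?y \<le> 1" "N ?y' \<le> 1" "N ?y \<le> N ?l" using iter_le[OF t(1), of i] iter_le[OF t(2), of i] small(2) by auto
    have e: "(cz t ^^ Suc i) ?l - (cz t' ^^ Suc i) ?l = (?y ^ CARD('a) - ?y' ^ CARD('a)) + ((t - t') * ?y + t' * (?y - ?y'))"
      by (simp add: cz_def[of t ?y] cz_def[of t' ?y'] algebra_simps)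
    have 1: "N (?y ^ CARD('a) - ?y' ^ CARD('a)) \<le> N ?l * N (t - t')"
      using N_power_diff_le[OF y(1,2)] Suc.IH by (rule order_trans)
    have 2: "N ((t - t') * ?y) \<le> N ?l * N (t - t')"
      using mult_left_mono[OF y(3), of "N (t - t')"] by (simp add: N_mult mult.commute)
    have 3: "N (t' * (?y - ?y')) \<le> N ?l * N (t - t')"
      using mult_mono[OF t(2) Suc.IH] by (simp add: N_mult)
    show ?case unfolding e by (intro N_add_le 1 2 3)
  qed simp
  have F_le: "N (F t) \<le> 1" if "N t \<le> 1" for t
    using iter_le[OF that, of n] small(2) by (simp add: F_def N_power power_le_one)
  have F_contr: "N (F t - F t') \<le> N ?l * N (t - t')" if t: "N t \<le> 1" "N t' \<le> 1" for t t'
  proof -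
    let ?y = "(cz t ^^ n) ?l" and ?y' = "(cz t' ^^ n) ?l"
    have y: "N ?y \<le> 1" "N ?y' \<le> 1" using iter_le[OF t(1), of n] iter_le[OF t(2), of n] small(2) by auto
    have "N (F t - F t') = N (?y ^ (CARD('a) - 1) - ?y' ^ (CARD('a) - 1))"
      unfolding F_def by (metis N_minus_commute minus_diff_minus N_uminus)
    also have "\<dots> \<le> N (?y - ?y')" by (rule N_power_diff_le[OF y])
    also have "\<dots> \<le> N ?l * N (t - t')" by (rule iter_diff[OF t])
    finally show ?thesis .
  qed
  have F_Z: "F t \<in> Z" if t: "t \<in> Z" for t
  proof -
    have "(cz t ^^ i) ?l \<in> Z" for i
      by (induction i) (auto intro!: cz_in subfield_Z gen_in_Z t)
    then show ?thesis unfolding F_def by (intro sf_intros subfield_Z)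
  qed
  define s where "s = (\<lambda>j. (F ^^ j) 0)"
  have sZ: "s j \<in> Z" and s1: "N (s j) \<le> 1" for j
    by (induction j) (auto simp: s_def F_Z F_le sf_0[OF subfield_Z])
  have th1: "N (inverse T_elem) \<le> 1" by (simp add: N_inverse)
  have conv: "N (inverse T_elem - s j) \<le> N ?l ^ j" for j
  proof (induction j)
    case 0
    then show ?case using th1 by (simp add: s_def)
  next
    case (Suc j)
    have "N (inverse T_elem - s (Suc j)) = N (F (inverse T_elem) - F (s j))"
      unfolding F_fix by (simp add: s_def)
    also have "\<dots> \<le> N ?l * N (inverse T_elem - s j)" by (rule F_contr[OF th1 s1])
    also have "\<dots> \<le> N ?l * N ?l ^ j" using Suc.IH by (intro mult_left_mono) auto
    finally show ?case by simp
  qed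
  show ?thesis
  proof (rule Z_closed)
    fix \<epsilon> :: real assume "\<epsilon> > 0"
    then obtain J where "N ?l ^ J < \<epsilon>" using real_arch_pow_inv[OF _ small(2)] by blast
    then have "N (inverse T_elem - s J) < \<epsilon>" using conv[of J] by simp
    then show "\<exists>y\<in>Z. N (inverse T_elem - y) < \<epsilon>" using sZ by blast
  qed
qed

lemma T_in_Z: "T_elem \<in> Z"
  using sf_inverse[OF subfield_Z theta_in_Z] by simp

lemma k_subset_Z: "k_field \<subseteq> Z"
  using k_field_least[OF subfield_Z T_in_Z] const_in_Z by auto

lemma torsion_gens_in_Z: "i \<le> n \<Longrightarrow> torsion_gen i \<in> Z"
proof -
  assume i: "i \<le> n"
  have "(cz (inverse T_elem) ^^ j) (torsion_gen n) \<in> Z" for j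
    by (induction j) (auto intro!: cz_in subfield_Z gen_in_Z theta_in_Z)
  then show ?thesis using torsion_gen_funpow[of "n - i" i, where 'a = 'a] i by (metis le_add_diff_inverse)
qed

lemma theta_torsion_in_Z: "Carlitz_torsion (inverse T_elem) (Polynomial.monom 1 (n + 1)) \<subseteq> Z"
proof
  fix u :: "'a kbar" assume u: "u \<in> Carlitz_torsion (inverse T_elem) (Polynomial.monom 1 (n + 1))"
  have "carlitz (inverse T_elem) (Polynomial.monom 1 (n + 1)) u
    = (\<Sum>i\<le>n + 1. const (if i = n + 1 then 1 else 0) * (cz (inverse T_elem) ^^ i) u)"
    unfolding carlitz_eq by (rule sum.cong) (auto simp: Polynomial.degree_monom_eq)
  also have "\<dots> = (\<Sum>i\<in>{n + 1}. const (if i = n + 1 then 1 else 0) * (cz (inverse T_elem) ^^ i) u)"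
    by (rule sum.mono_neutral_right) auto
  finally have "(cz (inverse T_elem) ^^ Suc n) u = 0" using u unfolding Carlitz_torsion_def by simp
  then have "u \<in> Fq.span (torsion_gen ` {..n})" by (rule theta_torsion_span)
  then show "u \<in> Z"
  proof (induction u rule: Fq.span_induct_alt)
    case base
    then show ?case by (rule sf_0[OF subfield_Z])
  next
    case (step c x y)
    then show ?case by (auto intro!: sf_intros subfield_Z const_in_Z torsion_gens_in_Z)
  qed
qed

text \<open>
  The Carlitz action of \<open>T\<close> in the coordinate \<open>w = s u\<close>, where \<open>s\<^bsup>q-1\<^esup> = - 1/T\<close>. Points with bounded forward
  orbit are approximated by solving \<open>y\<^sup>q - y = \<beta>\<close> backwards along the orbit.
\<close>

definition czw :: "'a kbar \<Rightarrow> 'a kbar"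
  where "czw w = - T_elem * (w ^ CARD('a) - w)"

lemma czw_cz: "torsion_gen0 * cz T_elem u = czw (torsion_gen0 * u)"
proof -
  have "czw (torsion_gen0 * u) = - T_elem * (torsion_gen0 ^ CARD('a) * u ^ CARD('a) - torsion_gen0 * u)"
    by (simp add: czw_def power_mult_distrib)
  also have "\<dots> = torsion_gen0 * cz T_elem u"
    unfolding torsion_gen0_power_card by (simp add: cz_def algebra_simps)
  finally show ?thesis ..
qed

lemma czw_funpow_cz: "torsion_gen0 * (cz T_elem ^^ i) u = (czw ^^ i) (torsion_gen0 * u)"
  by (induction i) (simp_all only: funpow.simps o_def id_def czw_cz)

text \<open>The differences \<open>\<delta> - const c\<close> multiply to
  \<open>\<delta> ^ q - \<delta>\<close>, so one of them is below 1. If it is nonzero, its q-th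
  power is negligible beside it, and its absolute value is that of
  \<open>\<delta> ^ q - \<delta>\<close>.\<close>

lemma artin_schreier_close:
  assumes d: "N \<delta> \<le> 1" and r: "N (\<delta> ^ CARD('a) - \<delta>) \<le> r" "r < 1"
  shows "\<exists>c. N (\<delta> - const c) \<le> r"
proof -
  have "(\<Prod>c\<in>UNIV. N (\<delta> - const c)) < 1"
    using r by (simp flip: N_prod add: prod_minus_const)
  then obtain c where c: "N (\<delta> - const c) < 1"
    using prod_ge_1[of UNIV "\<lambda>c. N (\<delta> - const c)"] by (metis linorder_not_less)
  let ?d = "\<delta> - const c"
  have e: "?d ^ CARD('a) - ?d = \<delta> ^ CARD('a) - \<delta>" by (simp add: frob_diff)
  have "N ?d \<le> r"
  proof (cases "?d = 0")
    case True
    have "0 \<le> r" using r(1) N_nonneg order_trans by blast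
    then show ?thesis using True by simp
  next
    case False
    have "N ?d ^ CARD('a) < N ?d ^ 1"
      using c False card_gt_1[where 'a = 'a] by (intro power_strict_decreasing) auto
    then have "N (?d ^ CARD('a)) < N (- ?d)" unfolding N_uminus by (simp add: N_power)
    then have "N (?d ^ CARD('a) + - ?d) = N (- ?d)" by (rule N_add_eq)
    then show ?thesis using e r(1) unfolding N_uminus by (metis diff_conv_add_uminus)
  qed
  then show ?thesis by blast
qed

text \<open>The formal solution of \<open>y ^ q - y = \<beta>\<close> is minus the sum of all
  \<open>\<beta> ^ (q ^ i)\<close>; the partial sums telescope and leave the remainder
  \<open>- (\<beta> ^ (q ^ j))\<close>.\<close>

lemma artin_schreier_approx:
  assumes b: "\<beta> \<in> Z" "N \<beta> \<le> 1 / 2"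
  shows "\<exists>y\<in>Z. N y \<le> 1 \<and> N (y ^ CARD('a) - y - \<beta>) \<le> (1 / 2) ^ M"
proof -
  define y where "y = (\<lambda>j. - (\<Sum>i<j. \<beta> ^ (CARD('a) ^ i)))"
  have yZ: "y j \<in> Z" for j using b unfolding y_def by (intro sf_intros subfield_Z)
  have y1: "N (y j) \<le> 1" for j unfolding y_def using b
    by (auto intro!: N_sum_le power_le_one simp: N_power)
  have yq: "y j ^ CARD('a) - y j - \<beta> = - (\<beta> ^ (CARD('a) ^ j))" for j
  proof (induction j)
    case 0
    then show ?case using card_gt_1[where 'a = 'a] by (simp add: y_def)
  next
    case (Suc j)
    have "y (Suc j) = y j - \<beta> ^ (CARD('a) ^ j)" by (simp add: y_def)
    then have "y (Suc j) ^ CARD('a) - y (Suc j) - \<beta> =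
        (y j ^ CARD('a) - y j - \<beta>) - \<beta> ^ (CARD('a) ^ Suc j) + \<beta> ^ (CARD('a) ^ j)"
      unfolding power_card_power_Suc by (simp add: frob_diff)
    then show ?case using Suc.IH by simp
  qed
  have "M \<le> CARD('a) ^ M" using less_exp[of M] card_gt_1[where 'a = 'a] 
      power_mono[of 2 "CARD('a)" M] by simp
  have "N (y M ^ CARD('a) - y M - \<beta>) = N \<beta> ^ (CARD('a) ^ M)" by (simp add: yq N_power)
  also have "\<dots> \<le> (1 / 2) ^ (CARD('a) ^ M)" using b by (intro power_mono) auto
  also have "\<dots> \<le> (1 / 2) ^ M" using \<open>M \<le> CARD('a) ^ M\<close> by (intro power_decreasing) auto
  finally show ?thesis using yZ y1 by blast
qed

lemma bounded_orbit_approx: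
  "(\<And>i. N ((czw ^^ i) w) \<le> 1) \<Longrightarrow> \<exists>y\<in>Z. N y \<le> 1 \<and> N (w - y) \<le> (1 / 2) ^ M"
proof (induction M arbitrary: w)
  case 0
  then show ?case using 0[of 0] sf_0[OF subfield_Z] by (intro bexI[of _ 0]) auto
next
  case (Suc M)
  have "N ((czw ^^ i) (czw w)) \<le> 1" for i
    using Suc.prems[of "Suc i"] by (simp only: funpow_Suc_right o_def)
  then obtain y' where y': "y' \<in> Z" "N y' \<le> 1" "N (czw w - y') \<le> (1 / 2) ^ M" using Suc.IH by blast
  \<comment> \<open>From \<open>czw w = - T * (w ^ q - w)\<close>: going back one step divides by
    \<open>T\<close>, so the error is halved.\<close>
  define \<beta> where "\<beta> = - y' / T_elem"
  have b: "\<beta> \<in> Z" "N \<beta> \<le> 1 / 2" using y' by (auto simp: \<beta>_def N_divide intro!: sf_intros subfield_Z T_in_Z)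
  obtain y where y: "y \<in> Z" "N y \<le> 1" "N (y ^ CARD('a) - y - \<beta>) \<le> (1 / 2) ^ Suc M"
    using artin_schreier_approx[OF b] by blast
  have e: "(w - y) ^ CARD('a) - (w - y) = - ((czw w - y') / T_elem) - (y ^ CARD('a) - y - \<beta>)"
  proof -
    have "czw w / T_elem = w - w ^ CARD('a)" by (simp add: czw_def)
    then show ?thesis by (simp add: \<beta>_def frob_diff diff_divide_distrib)
  qed
  have "N ((w - y) ^ CARD('a) - (w - y)) \<le> (1 / 2) ^ Suc M"
    unfolding e by (rule N_diff_le[OF _ y(3)]) (use y'(3) in \<open>simp add: N_divide\<close>)
  moreover have "N (w - y) \<le> 1" using N_diff_le[OF _ y(2), of w] Suc.prems[of 0] by simp
  moreover have "(1 / 2) ^ Suc M < (1 :: real)" by (simp only: power_Suc_less_one)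
  \<comment> \<open>The equation determines its solution only up to an additive constant;
    \<open>artin_schreier_close\<close> chooses it.\<close>
  ultimately obtain c where c: "N ((w - y) - const c) \<le> (1 / 2) ^ Suc M"
    using artin_schreier_close by blast
  have "y + const c \<in> Z" using y(1) by (intro sf_intros subfield_Z const_in_Z)
  moreover have "N (y + const c) \<le> 1" using y(2) N_const_le by (rule N_add_le)
  ultimately show ?case using c by (intro bexI[of _ "y + const c"]) (auto simp: algebra_simps)
qed

text \<open>Once an orbit of \<open>czw\<close> exceeds 1 it grows strictly, so the top term of the
  Carlitz action dominates and cannot be cancelled.\<close>

lemma torsion_bounded:
  assumes M: "M \<noteq> 0" and u: "carlitz T_elem M u = 0"
  shows "N (torsion_gen0 * u) \<le> 1"
proof (rule ccontr)
  let ?w = "torsion_gen0 * u"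
  assume "\<not> N ?w \<le> 1"
  then have w: "N ?w > 1" by simp
  have grow: "N (czw x) > N x" if "N x > 1" for x
  proof -
    have "N x ^ 1 < N x ^ CARD('a)" using that card_gt_1[where 'a = 'a] by (intro power_strict_increasing) auto
    then have "N (- x) < N (x ^ CARD('a))" by (simp add: N_power)
    then have "N (- x + x ^ CARD('a)) = N (x ^ CARD('a))" by (rule N_add_eq)
    then have "N (czw x) = 2 * N (x ^ CARD('a))" by (simp add: czw_def N_mult)
    then show ?thesis using \<open>N (- x) < N (x ^ CARD('a))\<close> that by simp
  qed
  have w1: "N ((czw ^^ i) ?w) > 1" for i
  proof (induction i)
    case (Suc i)
    then show ?case using grow[OF Suc.IH] by simp
  qed (use w in simp)
  have mono: "N ((czw ^^ i) ?w) < N ((czw ^^ j) ?w)" if "i < j" for i j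
    using that
  proof (induction j)
    case (Suc j)
    then show ?case using grow[OF w1[of j]] by (cases "i = j") auto
  qed simp
  let ?d = "Polynomial.degree M"
  have "torsion_gen0 * carlitz T_elem M u = (\<Sum>i\<le>?d. const (Polynomial.coeff M i) * (czw ^^ i) ?w)"
    unfolding carlitz_eq sum_distrib_left czw_funpow_cz[symmetric] by (simp add: mult.left_commute)
  also have "{..?d} = insert ?d {..<?d}" by auto
  finally have s: "(\<Sum>i<?d. const (Polynomial.coeff M i) * (czw ^^ i) ?w) + const (Polynomial.coeff M ?d) * (czw ^^ ?d) ?w = 0"
    using u by (simp add: add.commute)
  have lead: "N (const (Polynomial.coeff M ?d) * (czw ^^ ?d) ?w) = N ((czw ^^ ?d) ?w)"
    using M by (simp add: N_mult N_const)
  have less: "N (\<Sum>i<?d. const (Polynomial.coeff M i) * (czw ^^ i) ?w) < N (const (Polynomial.coeff M ?d) * (czw ^^ ?d) ?w)"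
    unfolding lead
  proof (rule N_sum_less)
    show "0 < N ((czw ^^ ?d) ?w)" using w1[of ?d] by linarith
    fix i assume "i \<in> {..<?d}"
    then have l: "N ((czw ^^ i) ?w) < N ((czw ^^ ?d) ?w)" by (intro mono) auto
    have "N (const (Polynomial.coeff M i) * (czw ^^ i) ?w) \<le> N ((czw ^^ i) ?w)"
      using mult_right_mono[OF N_const_le, of "N ((czw ^^ i) ?w)"] by (simp add: N_mult)
    then show "N (const (Polynomial.coeff M i) * (czw ^^ i) ?w) < N ((czw ^^ ?d) ?w)" using l by simp
  qed
  show False using N_add_eq[OF less] w1[of ?d] unfolding s lead by simp
qed

text \<open>The torsion is stable under \<open>cz T_elem\<close>, so every point of the orbit is
  torsion and \<open>torsion_bounded\<close> applies to all of them.\<close>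

lemma T_torsion_in_Z:
  assumes M: "M \<noteq> 0"
  shows "Carlitz_torsion T_elem M \<subseteq> Z"
proof
  fix u :: "'a kbar" assume "u \<in> Carlitz_torsion T_elem M"
  then have u: "carlitz T_elem M u = 0" by (simp add: Carlitz_torsion_def)
  have "carlitz T_elem M ((cz T_elem ^^ i) u) = 0" for i
    by (induction i) (simp_all only: funpow.simps o_def id_def carlitz_cz u cz_0)
  then have "N (torsion_gen0 * (cz T_elem ^^ i) u) \<le> 1" for i using torsion_bounded[OF M] by blast
  then have bd: "N ((czw ^^ i) (torsion_gen0 * u)) \<le> 1" for i unfolding czw_funpow_cz .
  have "torsion_gen0 * u \<in> Z"
  proof (rule Z_closed)
    fix \<epsilon> :: real assume "\<epsilon> > 0"
    then obtain J where J: "(1 / 2) ^ J < \<epsilon>" using real_arch_pow_inv[of \<epsilon> "1 / 2"] by auto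
    then show "\<exists>y\<in>Z. N (torsion_gen0 * u - y) < \<epsilon>" using bounded_orbit_approx[OF bd, of J] le_less_trans[OF _ J] by blast
  qed
  moreover have "torsion_gen0 \<in> Z" using torsion_gens_in_Z[of 0] by simp
  ultimately have "torsion_gen0 * u / torsion_gen0 \<in> Z" by (intro sf_divide[OF subfield_Z])
  then show "u \<in> Z" using torsion_gen0_nonzero[where 'a = 'a] by simp
qed

lemma nk_subset_Z:
  assumes M: "M \<noteq> 0"
  shows "nk_field n M \<subseteq> Z"
proof -
  have "L_field n \<subseteq> cyclotomic_field (inverse T_elem) (Polynomial.monom 1 (n + 1))"
    unfolding L_field_def Let_def fixed_field_def by auto
  also have "\<dots> \<subseteq> Z" unfolding cyclotomic_field_def
    using k_subset_Z theta_torsion_in_Z by (intro generate_field_least subfield_Z) auto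
  finally have L: "L_field n \<subseteq> Z" .
  have "cyclotomic_field T_elem M \<subseteq> Z" unfolding cyclotomic_field_def
    using k_subset_Z T_torsion_in_Z[OF M] by (intro generate_field_least subfield_Z) auto
  then show ?thesis unfolding nk_field_def using L by (intro compositum_least subfield_Z)
qed

end

lemma nk_field_residue:
  assumes "M \<noteq> 0" "x \<in> nk_field n M" "N x \<le> 1"
  shows "\<exists>c. N (x - const c) < 1"
  using nk_subset_Z[OF assms(1), of n] assms App_residue[OF small[of n]] by blast

lemma nk_field_discrete:
  assumes "M \<noteq> 0" "x \<in> nk_field n M" "x \<noteq> 0"
  shows "\<exists>i. N x = N (torsion_gen n) powi i"
  using nk_subset_Z[OF assms(1), of n] assms App_discrete[OF small[of n]] by blast

end

lemma subfield_nk_field: "subfield (nk_field n M) Amb"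
  unfolding nk_field_def by (rule subfield_compositum)

lemma k_subset_nk_field: "k_field \<subseteq> nk_field n M"
  unfolding nk_field_def cyclotomic_field_def
  using compositum_right subset_generate_field by blast

section \<open>Constant extensions and the Frobenius\<close>

text \<open>The trace is given by a nonzero polynomial of degree at most \<open>q ^ (m - 1)\<close>,
  which has too few roots to vanish on \<open>q ^ m\<close> elements.\<close>

lemma trace_nonzero:
  assumes m: "m \<ge> 1"
  shows "\<exists>d\<in>Fqm m. (\<Sum>i<m. d ^ (CARD('a) ^ i)) \<noteq> (0 :: 'a::{field,finite} kbar)"
proof (rule ccontr)
  assume no: "\<not> ?thesis"
  define P :: "'a kbar poly" where "P = (\<Sum>i<m. Polynomial.monom 1 (CARD('a) ^ i))"
  have q: "CARD('a) > 1" by (rule card_gt_1)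
  have inj: "CARD('a) ^ i = CARD('a) ^ (m - 1) \<longleftrightarrow> i = m - 1" for i
    using q by (rule power_inject_exp)
  have "Polynomial.coeff P (CARD('a) ^ (m - 1)) = (\<Sum>i<m. if i = m - 1 then 1 else 0)"
    unfolding P_def coeff_sum by (rule sum.cong) (use inj in auto)
  also have "\<dots> = 1" using m by simp
  finally have "P \<noteq> 0" by auto
  have deg: "Polynomial.degree P \<le> CARD('a) ^ (m - 1)"
    unfolding P_def using q m
    by (intro degree_sum_le) (auto intro!: order_trans[OF degree_monom_le] power_increasing)
  have "Fqm m \<subseteq> {x. poly P x = 0}" using no by (auto simp: P_def poly_sum poly_monom)
  then have "card (Fqm m :: 'a kbar set) \<le> card {x. poly P x = 0}"
    by (intro card_mono poly_roots_finite \<open>P \<noteq> 0\<close>)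
  also have "\<dots> \<le> CARD('a) ^ (m - 1)" using card_poly_roots_bound[OF \<open>P \<noteq> 0\<close>] deg by simp
  finally have "CARD('a) ^ m \<le> CARD('a) ^ (m - 1)" using card_Fqm[OF m, where 'a = 'a] by simp
  then show False using q m power_strict_increasing[of "m - 1" m "CARD('a)"] by simp
qed

lemma (in absval) N_le_0_iff [simp]: "N x \<le> 0 \<longleftrightarrow> x = 0"
  using N_nonneg[of x] N_eq_0_iff[of x] by linarith

text \<open>Collects what the constant extension requires of its base field: constant residues and
  values among the powers of one \<rho>. For \<open>nk_field\<close> this \<rho> is
  \<open>N (torsion_gen n)\<close>.\<close>

locale residue_one = inf_absval N for N :: "'a::{field,finite} kbar \<Rightarrow> real" +
  fixes E :: "'a kbar set" and m :: nat and \<rho> :: real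
  assumes subfield_E: "subfield E Amb"
    and k_E: "k_field \<subseteq> E"
    and res_E: "x \<in> E \<Longrightarrow> N x \<le> 1 \<Longrightarrow> \<exists>c. N (x - const c) < 1"
    and m_pos: "m \<ge> 1"
    and \<rho>: "0 < \<rho>" "\<rho> < 1"
    and disc_E: "x \<in> E \<Longrightarrow> x \<noteq> 0 \<Longrightarrow> \<exists>i. N x = \<rho> powi i"
begin

lemma const_E: "const c \<in> E"
  using k_E const_in_k by blast

text \<open>Divide by the largest coefficient and reduce all quotients to constants: the sum becomes
  a combination in \<open>Fqm m\<close> that is nonzero by independence, hence of absolute value 1.
  In particular a vanishing sum has zero coefficients, so \<open>E\<close> and \<open>Fqm m\<close>
  are linearly disjoint.\<close>

lemma independent_max:
  assumes I: "finite I" and \<zeta>: "\<And>i. i \<in> I \<Longrightarrow> \<zeta> i \<in> Fqm m"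
    and ind: "\<And>a. (\<Sum>i\<in>I. const (a i) * \<zeta> i) = 0 \<Longrightarrow> \<forall>i\<in>I. a i = 0"
    and x: "\<And>i. i \<in> I \<Longrightarrow> x i \<in> E" and i: "i \<in> I"
  shows "N (x i) \<le> N (\<Sum>i\<in>I. x i * \<zeta> i)"
proof (cases "\<forall>i\<in>I. x i = 0")
  case False
  have "Max ((\<lambda>i. N (x i)) ` I) \<in> (\<lambda>i. N (x i)) ` I" using I i by (intro Max_in) auto
  then obtain j where j': "j \<in> I" "N (x j) = Max ((\<lambda>i. N (x i)) ` I)" by auto
  then have j: "j \<in> I" "\<And>i. i \<in> I \<Longrightarrow> N (x i) \<le> N (x j)" using I by auto
  have xj: "x j \<noteq> 0" using False j(2) by (metis N_eq_0_iff N_nonneg order_antisym)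
  have "\<exists>c. N (x i / x j - const c) < 1" if "i \<in> I" for i
    using xj j x that by (intro res_E) (auto simp: N_divide intro: sf_divide[OF subfield_E])
  then obtain a where a: "\<And>i. i \<in> I \<Longrightarrow> N (x i / x j - const (a i)) < 1" by metis
  define z where "z = (\<Sum>i\<in>I. const (a i) * \<zeta> i)"
  have zF: "z \<in> Fqm m" unfolding z_def using \<zeta> by (intro sf_intros subfield_Fqm) auto
  have "a j \<noteq> 0" using a[OF j(1)] xj by auto
  then have z0: "z \<noteq> 0" using ind[of a] j(1) unfolding z_def by blast
  have e: "(\<Sum>i\<in>I. x i * \<zeta> i) / x j - z = (\<Sum>i\<in>I. (x i / x j - const (a i)) * \<zeta> i)"
    by (simp add: z_def sum_divide_distrib sum_subtractf left_diff_distrib)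
  have "N ((\<Sum>i\<in>I. x i * \<zeta> i) / x j - z) < 1"
    unfolding e
  proof (rule N_sum_less)
    fix i assume "i \<in> I"
    then show "N ((x i / x j - const (a i)) * \<zeta> i) < 1"
      using a[of i] N_Fqm_le[OF \<zeta> m_pos, of i] mult_left_mono[of "N (\<zeta> i)" 1 "N (x i / x j - const (a i))"]
      by (simp add: N_mult)
  qed simp
  moreover have "N z = 1" by (rule N_Fqm[OF zF m_pos z0])
  ultimately have "N ((\<Sum>i\<in>I. x i * \<zeta> i) / x j) = 1"
    using N_eq_of_diff_less[of z] N_minus_commute[of z] by simp
  then have "N (\<Sum>i\<in>I. x i * \<zeta> i) = N (x j)" using xj by (simp add: N_divide field_simps)
  then show ?thesis using j(2)[OF i] by simp
qed (use i in simp)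

definition basis :: "'a kbar set"
  where "basis = (SOME B. B \<subseteq> Fqm m \<and> Fq.independent B \<and> Fqm m \<subseteq> Fq.span B)"

lemma basis: "basis \<subseteq> Fqm m" "Fq.independent basis" "Fqm m \<subseteq> Fq.span basis"
proof -
  have "\<exists>B. B \<subseteq> Fqm m \<and> Fq.independent B \<and> Fqm m \<subseteq> Fq.span B"
    by (rule Fq.basis_exists[of "Fqm m"]) blast
  from someI_ex[OF this] show "basis \<subseteq> Fqm m" "Fq.independent basis" "Fqm m \<subseteq> Fq.span basis"
    unfolding basis_def by blast+
qed

lemma finite_subset_Fqm: "B \<subseteq> Fqm m \<Longrightarrow> finite B"
  using card_Fqm(1)[OF m_pos] finite_subset by blast

lemma basis_expand:
  assumes "B \<subseteq> Fqm m" "c \<in> Fq.span B"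
  obtains a where "c = (\<Sum>\<omega>\<in>B. const (a \<omega>) * \<omega>)"
  using assms Fq.span_finite[OF finite_subset_Fqm[OF assms(1)]] by auto

lemma basis_family:
  assumes "B \<subseteq> Fqm m" "Fq.independent B" "(\<Sum>\<omega>\<in>B. const (a \<omega>) * \<omega>) = 0"
  shows "\<forall>\<omega>\<in>B. a \<omega> = 0"
  using Fq.independentD[OF assms(2) finite_subset_Fqm[OF assms(1)] order_refl assms(3)] by blast

text \<open>
  \<open>Em\<close> is \<open>E \<F>\<^bsub>q^m\<^esub>\<close>, presented as the \<open>E\<close>-span of an \<open>\<F>\<^sub>q\<close>-basis of \<open>\<F>\<^bsub>q^m\<^esub>\<close>, and \<open>phi\<close> is
  the \<open>E\<close>-linear extension of \<open>c \<mapsto> c\<^sup>q\<close> (meaningful on \<open>Em\<close> only).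
\<close>

definition ev :: "('a kbar \<Rightarrow> 'a kbar) \<Rightarrow> 'a kbar"
  where "ev f = (\<Sum>\<omega>\<in>basis. f \<omega> * \<omega>)"

definition fr :: "('a kbar \<Rightarrow> 'a kbar) \<Rightarrow> 'a kbar"
  where "fr f = (\<Sum>\<omega>\<in>basis. f \<omega> * \<omega> ^ CARD('a))"

definition EE :: "('a kbar \<Rightarrow> 'a kbar) set"
  where "EE = {f. \<forall>\<omega>\<in>basis. f \<omega> \<in> E}"

definition Em :: "'a kbar set"
  where "Em = ev ` EE"

definition phi :: "'a kbar \<Rightarrow> 'a kbar"
  where "phi y = fr (SOME f. f \<in> EE \<and> ev f = y)"

lemma ev_max: "f \<in> EE \<Longrightarrow> \<omega> \<in> basis \<Longrightarrow> N (f \<omega>) \<le> N (ev f)"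
  unfolding ev_def
  by (rule independent_max[OF finite_subset_Fqm[OF basis(1)]])
    (use basis(1) basis_family[OF basis(1,2)] in \<open>auto simp: EE_def\<close>)

lemma ev_inj:
  assumes "f \<in> EE" "g \<in> EE" "ev f = ev g" "\<omega> \<in> basis"
  shows "f \<omega> = g \<omega>"
proof -
  have d: "(\<lambda>\<omega>. f \<omega> - g \<omega>) \<in> EE" using assms by (auto simp: EE_def intro: sf_diff[OF subfield_E])
  have "ev (\<lambda>\<omega>. f \<omega> - g \<omega>) = 0" using assms(3) by (simp add: ev_def left_diff_distrib sum_subtractf)
  then show ?thesis using ev_max[OF d assms(4)] by simp
qed

lemma phi_ev: "f \<in> EE \<Longrightarrow> phi (ev f) = fr f"
proof -
  assume f: "f \<in> EE"
  define g where "g = (SOME g. g \<in> EE \<and> ev g = ev f)"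
  have "\<exists>g. g \<in> EE \<and> ev g = ev f" using f by blast
  from someI_ex[OF this] have "g \<in> EE \<and> ev g = ev f" unfolding g_def .
  then have "g \<omega> = f \<omega>" if "\<omega> \<in> basis" for \<omega> using ev_inj f that by blast
  then show "phi (ev f) = fr f" unfolding phi_def g_def[symmetric] fr_def by simp
qed

lemma Em_smult:
  assumes "x \<in> E" "c \<in> Fqm m"
  shows "x * c \<in> Em \<and> phi (x * c) = x * c ^ CARD('a)"
proof -
  obtain a where a: "c = (\<Sum>\<omega>\<in>basis. const (a \<omega>) * \<omega>)" using basis_expand[OF basis(1)] basis(3) assms(2) by blast
  have f: "(\<lambda>\<omega>. x * const (a \<omega>)) \<in> EE" using assms const_E by (auto simp: EE_def intro: sf_mult[OF subfield_E])
  have e: "ev (\<lambda>\<omega>. x * const (a \<omega>)) = x * c" by (simp add: ev_def a sum_distrib_left mult.assoc)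
  have "fr (\<lambda>\<omega>. x * const (a \<omega>)) = x * c ^ CARD('a)"
    by (simp add: fr_def a frob_sum power_mult_distrib sum_distrib_left mult.assoc)
  moreover have "x * c \<in> Em" using imageI[OF f, of ev] unfolding Em_def e .
  ultimately show ?thesis using phi_ev[OF f] e by simp
qed

lemma Em_add:
  assumes "x \<in> Em" "y \<in> Em"
  shows "x + y \<in> Em \<and> phi (x + y) = phi x + phi y"
proof -
  obtain f g where fg: "f \<in> EE" "g \<in> EE" "x = ev f" "y = ev g" using assms by (auto simp: Em_def)
  have s: "(\<lambda>\<omega>. f \<omega> + g \<omega>) \<in> EE" using fg by (auto simp: EE_def intro: sf_add[OF subfield_E])
  have "ev (\<lambda>\<omega>. f \<omega> + g \<omega>) = x + y" "fr (\<lambda>\<omega>. f \<omega> + g \<omega>) = fr f + fr g"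
    using fg by (simp_all add: ev_def fr_def distrib_right sum.distrib)
  then show ?thesis using phi_ev[OF s] phi_ev fg s by (metis Em_def image_eqI)
qed

lemma E_subset_Em: "E \<subseteq> Em" and phi_E: "x \<in> E \<Longrightarrow> phi x = x"
  using Em_smult[of _ 1] sf_1[OF subfield_Fqm] by fastforce+

lemma Fqm_subset_Em: "Fqm m \<subseteq> Em" and phi_Fqm: "c \<in> Fqm m \<Longrightarrow> phi c = c ^ CARD('a)"
  using Em_smult[of 1] sf_1[OF subfield_E] by fastforce+

lemma phi_0: "0 \<in> Em" "phi 0 = 0"
  using E_subset_Em phi_E sf_0[OF subfield_E] by auto

lemma Em_sum:
  assumes "\<And>i. i \<in> I \<Longrightarrow> x i \<in> Em"
  shows "(\<Sum>i\<in>I. x i) \<in> Em \<and> phi (\<Sum>i\<in>I. x i) = (\<Sum>i\<in>I. phi (x i))"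
  using assms
proof (induction I rule: infinite_finite_induct)
  case (insert i I)
  then show ?case using Em_add[of "x i" "\<Sum>i\<in>I. x i"] by simp
qed (simp_all add: phi_0)

text \<open>Valid for arbitrary families in \<open>Fqm m\<close>, not only for the basis; this makes
  multiplicativity of \<open>phi\<close> a matter of expanding the product.\<close>

lemma Em_family:
  assumes "\<And>i. i \<in> I \<Longrightarrow> x i \<in> E" "\<And>i. i \<in> I \<Longrightarrow> c i \<in> Fqm m"
  shows "(\<Sum>i\<in>I. x i * c i) \<in> Em \<and> phi (\<Sum>i\<in>I. x i * c i) = (\<Sum>i\<in>I. x i * c i ^ CARD('a))"
proof -
  have "x i * c i \<in> Em \<and> phi (x i * c i) = x i * c i ^ CARD('a)" if "i \<in> I" for i using Em_smult assms that by blast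
  then show ?thesis using Em_sum[of I "\<lambda>i. x i * c i"] by simp
qed

lemma Em_mult:
  assumes "x \<in> Em" "y \<in> Em"
  shows "x * y \<in> Em \<and> phi (x * y) = phi x * phi y"
proof -
  obtain f g where fg: "f \<in> EE" "g \<in> EE" "x = ev f" "y = ev g" using assms by (auto simp: Em_def)
  define W where "W = (\<lambda>(\<omega>, \<omega>'). f \<omega> * g \<omega>')"
  define C :: "'a kbar \<times> 'a kbar \<Rightarrow> 'a kbar" where "C = (\<lambda>(\<omega>, \<omega>'). \<omega> * \<omega>')"
  have 1: "x * y = (\<Sum>p\<in>basis \<times> basis. W p * C p)"
    unfolding fg ev_def sum_product sum.cartesian_product by (rule sum.cong) (auto simp: W_def C_def)
  have 2: "phi x * phi y = (\<Sum>p\<in>basis \<times> basis. W p * C p ^ CARD('a))"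
    unfolding fg phi_ev[OF fg(1)] phi_ev[OF fg(2)] fr_def sum_product sum.cartesian_product
    by (rule sum.cong) (auto simp: W_def C_def power_mult_distrib)
  have "W p \<in> E" "C p \<in> Fqm m" if "p \<in> basis \<times> basis" for p
    using that fg basis(1) by (auto simp: W_def C_def EE_def intro!: sf_mult[OF subfield_E] sf_mult[OF subfield_Fqm])
  then show ?thesis unfolding 1 2 using Em_family[of "basis \<times> basis" W C] 1 2 by simp
qed

lemma Em_uminus: "x \<in> Em \<Longrightarrow> - x \<in> Em \<and> phi (- x) = - phi x"
  using Em_mult[of "- 1" x] sf_uminus[OF subfield_E sf_1[OF subfield_E]] E_subset_Em phi_E[of "- 1"] by auto

lemma Em_diff: "x \<in> Em \<Longrightarrow> y \<in> Em \<Longrightarrow> x - y \<in> Em \<and> phi (x - y) = phi x - phi y"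
  using Em_add[of x "- y"] Em_uminus[of y] by simp

lemma phi_1: "1 \<in> Em" "phi 1 = 1"
  using E_subset_Em phi_E sf_1[OF subfield_E] by auto

lemma Em_prod:
  assumes "\<And>i. i \<in> I \<Longrightarrow> x i \<in> Em"
  shows "(\<Prod>i\<in>I. x i) \<in> Em \<and> phi (\<Prod>i\<in>I. x i) = (\<Prod>i\<in>I. phi (x i))"
  using assms
proof (induction I rule: infinite_finite_induct)
  case (insert i I)
  then show ?case using Em_mult[of "x i" "\<Prod>i\<in>I. x i"] by simp
qed (simp_all add: phi_1)

lemma Fqm_frob: "c \<in> Fqm m \<Longrightarrow> c ^ (CARD('a) ^ i) \<in> Fqm m"
  by (rule sf_power[OF subfield_Fqm])

lemma phi_funpow_family:
  assumes "\<And>i. i \<in> I \<Longrightarrow> x i \<in> E" "\<And>i. i \<in> I \<Longrightarrow> c i \<in> Fqm m"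
  shows "(phi ^^ j) (\<Sum>i\<in>I. x i * c i) = (\<Sum>i\<in>I. x i * c i ^ (CARD('a) ^ j))"
proof (induction j)
  case (Suc j)
  have "c i ^ (CARD('a) ^ j) \<in> Fqm m" if "i \<in> I" for i using assms(2)[OF that] by (rule Fqm_frob)
  from Em_family[of I x, OF assms(1) this]
  show ?case using Suc.IH by (simp add: power_card_power_Suc del: power_Suc)
qed simp

lemma Em_repr:
  assumes "y \<in> Em" "B \<subseteq> Fqm m" "Fqm m \<subseteq> Fq.span B"
  obtains f where "\<And>\<omega>. \<omega> \<in> B \<Longrightarrow> f \<omega> \<in> E" "y = (\<Sum>\<omega>\<in>B. f \<omega> * \<omega>)"
proof -
  obtain g where g: "g \<in> EE" "y = ev g" using assms(1) by (auto simp: Em_def)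
  have "\<exists>a. \<omega> = (\<Sum>\<omega>'\<in>B. const (a \<omega>') * \<omega>')" if "\<omega> \<in> basis" for \<omega>
    using basis_expand[OF assms(2), of \<omega>] assms(3) basis(1) that by (metis subset_iff)
  then obtain a where a: "\<And>\<omega>. \<omega> \<in> basis \<Longrightarrow> \<omega> = (\<Sum>\<omega>'\<in>B. const (a \<omega> \<omega>') * \<omega>')" by metis
  define f where "f = (\<lambda>\<omega>'. \<Sum>\<omega>\<in>basis. g \<omega> * const (a \<omega> \<omega>'))"
  have "y = (\<Sum>\<omega>\<in>basis. g \<omega> * (\<Sum>\<omega>'\<in>B. const (a \<omega> \<omega>') * \<omega>'))"
    unfolding g(2) ev_def using a by (intro sum.cong) auto
  also have "\<dots> = (\<Sum>\<omega>'\<in>B. f \<omega>' * \<omega>')"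
    unfolding f_def sum_distrib_left sum_distrib_right by (subst sum.swap) (simp add: mult.assoc)
  finally have y: "y = (\<Sum>\<omega>'\<in>B. f \<omega>' * \<omega>')" .
  have fE: "f \<omega>' \<in> E" for \<omega>'
    unfolding f_def using g const_E by (intro sf_sum sf_mult subfield_E) (auto simp: EE_def)
  show ?thesis by (rule that[OF fE y])
qed

lemma phi_funpow_id: "y \<in> Em \<Longrightarrow> (phi ^^ m) y = y"
proof -
  assume "y \<in> Em"
  then obtain f where "f \<in> EE" "y = ev f" by (auto simp: Em_def)
  then show ?thesis using phi_funpow_family[of basis f "\<lambda>\<omega>. \<omega>" m] basis(1)
    by (auto simp: ev_def EE_def Fqm_def intro!: sum.cong)
qed

lemma phi_in_Em: "y \<in> Em \<Longrightarrow> phi y \<in> Em"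
proof -
  assume "y \<in> Em"
  then obtain f where f: "f \<in> EE" "y = ev f" by (auto simp: Em_def)
  have "f \<omega> \<in> E" "\<omega> ^ CARD('a) \<in> Fqm m" if "\<omega> \<in> basis" for \<omega>
    using that f(1) subsetD[OF basis(1) that] by (auto simp: EE_def intro: sf_power[OF subfield_Fqm])
  then show "phi y \<in> Em" unfolding f(2) phi_ev[OF f(1)] fr_def
    using Em_family[of basis f "\<lambda>\<omega>. \<omega> ^ CARD('a)"] by blast
qed

lemma phi_funpow_in_Em: "y \<in> Em \<Longrightarrow> (phi ^^ i) y \<in> Em"
  by (induction i) (auto simp: phi_in_Em)

text \<open>Coefficients are bounded by the sum they form, so \<open>phi\<close> cannot increase
  \<open>N\<close>; neither can its inverse, the power \<open>phi ^^ (m - 1)\<close>.\<close>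

lemma N_phi: 
  assumes "y \<in> Em"
  shows "N (phi y) = N y"
proof -
  have le: "N (phi y) \<le> N y" if yE: "y \<in> Em" for y
  proof -
    obtain f where f: "f \<in> EE" "y = ev f" using yE by (auto simp: Em_def)
    show ?thesis unfolding f(2) phi_ev[OF f(1)] fr_def
    proof (rule N_sum_le)
      fix \<omega> assume w: "\<omega> \<in> basis"
      have "N (\<omega> ^ CARD('a)) \<le> 1" using w basis(1) sf_power[OF subfield_Fqm] by (intro N_Fqm_le[OF _ m_pos]) auto
      then have "N (f \<omega> * \<omega> ^ CARD('a)) \<le> N (f \<omega>)" using mult_left_mono[of _ 1 "N (f \<omega>)"] by (simp add: N_mult)
      then show "N (f \<omega> * \<omega> ^ CARD('a)) \<le> N (ev f)" using ev_max[OF f(1) w] by simp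
    qed simp
  qed
  have it: "N ((phi ^^ i) y) \<le> N y" if "y \<in> Em" for i y
  proof (induction i)
    case (Suc i)
    then show ?case using le[OF phi_funpow_in_Em[OF that, of i]] by simp
  qed simp
  have "(phi ^^ (m - 1)) (phi y) = (phi ^^ Suc (m - 1)) y" by (simp only: funpow_Suc_right o_def)
  also have "\<dots> = y" using m_pos phi_funpow_id[OF assms] by simp
  finally have "N y \<le> N (phi y)" using it[OF phi_in_Em[OF assms], of "m - 1"] by simp
  then show ?thesis using le[OF assms] by simp
qed

lemma N_phi_funpow: "y \<in> Em \<Longrightarrow> N ((phi ^^ i) y) = N y"
  by (induction i) (auto simp: N_phi phi_funpow_in_Em)

text \<open>A basis \<open>B\<close> of \<open>Fqm m \<inter> Fqm i\<close> is extended to a basis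
  \<open>C\<close> of \<open>Fqm m\<close>. Being fixed is a linear relation among the
  \<open>\<omega> ^ (q ^ i) - \<omega>\<close> with \<omega> outside \<open>B\<close>; these are
  independent over the constants, so the coefficients outside \<open>B\<close> vanish.\<close>

lemma fixed_repr:
  assumes y: "y \<in> Em" and i: "i \<ge> 1" and fixd: "(phi ^^ i) y = y"
  obtains B f where "finite B" "B \<subseteq> Fqm i" "\<And>\<omega>. \<omega> \<in> B \<Longrightarrow> f \<omega> \<in> E" "y = (\<Sum>\<omega>\<in>B. f \<omega> * \<omega>)"
proof -
  obtain B :: "'a kbar set" where B: "B \<subseteq> Fqm m \<inter> Fqm i" "Fq.independent B" "Fqm m \<inter> Fqm i \<subseteq> Fq.span B"
    by (rule Fq.basis_exists[of "Fqm m \<inter> Fqm i"])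
  then have "B \<subseteq> Fqm m" by auto
  then obtain C where C: "B \<subseteq> C" "C \<subseteq> Fqm m" "Fq.independent C" "Fqm m \<subseteq> Fq.span C"
    using Fq.maximal_independent_subset_extend[OF _ B(2)] by metis
  have fin: "finite B" "finite C" using finite_subset_Fqm B C by auto
  obtain f where f: "\<And>\<omega>. \<omega> \<in> C \<Longrightarrow> f \<omega> \<in> E" "y = (\<Sum>\<omega>\<in>C. f \<omega> * \<omega>)" using Em_repr[OF y C(2,4)] by blast
  let ?\<zeta> = "\<lambda>\<omega>. \<omega> ^ (CARD('a) ^ i) - \<omega>"
  have "(phi ^^ i) y = (\<Sum>\<omega>\<in>C. f \<omega> * \<omega> ^ (CARD('a) ^ i))"
    unfolding f(2) by (rule phi_funpow_family) (use f C in auto)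
  then have "(\<Sum>\<omega>\<in>C. f \<omega> * ?\<zeta> \<omega>) = 0" using fixd f(2) by (simp add: right_diff_distrib sum_subtractf)
  moreover have "(\<Sum>\<omega>\<in>C. f \<omega> * ?\<zeta> \<omega>) = (\<Sum>\<omega>\<in>C - B. f \<omega> * ?\<zeta> \<omega>)"
    using fin B by (intro sum.mono_neutral_right) (auto simp: Fqm_def)
  ultimately have s0: "(\<Sum>\<omega>\<in>C - B. f \<omega> * ?\<zeta> \<omega>) = 0" by simp
  have ind: "\<forall>\<omega>\<in>C - B. a \<omega> = 0" if a: "(\<Sum>\<omega>\<in>C - B. const (a \<omega>) * ?\<zeta> \<omega>) = 0" for a
  proof -
    \<comment> \<open>A dependence makes \<open>z\<close> fixed by the power \<open>q ^ i\<close>,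
      which puts it into the span of \<open>B\<close>; independence of \<open>C\<close> then forces
      the coefficients to vanish.\<close>
    define z where "z = (\<Sum>\<omega>\<in>C - B. const (a \<omega>) * \<omega>)"
    have frob_sum: "(\<Sum>\<omega>\<in>J. h \<omega>) ^ (CARD('a) ^ i) = (\<Sum>\<omega>\<in>J. h \<omega> ^ (CARD('a) ^ i))" for J and h :: "'a kbar \<Rightarrow> 'a kbar"
      using card_gt_1[where 'a = 'a] by (induction J rule: infinite_finite_induct) (auto simp: frob_pow_add)
    have "z ^ (CARD('a) ^ i) - z = 0"
      using a by (simp add: z_def frob_sum power_mult_distrib right_diff_distrib sum_subtractf)
    moreover have "z \<in> Fqm m" unfolding z_def using C by (intro sf_intros subfield_Fqm) auto
    ultimately have "z \<in> Fq.span B" using B(3) by (auto simp: Fqm_def)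
    then obtain b where b: "z = (\<Sum>\<omega>\<in>B. const (b \<omega>) * \<omega>)" using basis_expand[of B z] B(1) by blast
    define d where "d = (\<lambda>\<omega>. if \<omega> \<in> B then - b \<omega> else a \<omega>)"
    have "(\<Sum>\<omega>\<in>C. const (d \<omega>) * \<omega>) = (\<Sum>\<omega>\<in>C - B. const (d \<omega>) * \<omega>) + (\<Sum>\<omega>\<in>B. const (d \<omega>) * \<omega>)"
      by (rule sum.subset_diff[OF C(1) fin(2)])
    also have "(\<Sum>\<omega>\<in>C - B. const (d \<omega>) * \<omega>) = z" unfolding z_def by (rule sum.cong) (auto simp: d_def)
    also have "(\<Sum>\<omega>\<in>B. const (d \<omega>) * \<omega>) = - z" unfolding b sum_negf[symmetric] by (rule sum.cong) (auto simp: d_def)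
    finally have "\<forall>\<omega>\<in>C. d \<omega> = 0" using basis_family[OF C(2,3)] by simp
    then show ?thesis by (auto simp: d_def)
  qed
  have "f \<omega> = 0" if w: "\<omega> \<in> C - B" for \<omega>
  proof -
    have "N (f \<omega>) \<le> N (\<Sum>\<omega>\<in>C - B. f \<omega> * ?\<zeta> \<omega>)"
    proof (rule independent_max)
      show "finite (C - B)" using fin by simp
      show "?\<zeta> \<omega> \<in> Fqm m" if "\<omega> \<in> C - B" for \<omega> using C that by (intro sf_intros subfield_Fqm) auto
    qed (use ind f w in auto)
    then show ?thesis using s0 by simp
  qed
  then have "y = (\<Sum>\<omega>\<in>B. f \<omega> * \<omega>)" unfolding f(2) using fin C by (intro sum.mono_neutral_right) auto
  then show ?thesis using that[of B f] fin B f C by auto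
qed

lemma fixed_in_E:
  assumes "y \<in> Em" "phi y = y"
  shows "y \<in> E"
proof -
  obtain B f where B: "finite B" "B \<subseteq> Fqm 1" "\<And>\<omega>. \<omega> \<in> B \<Longrightarrow> f \<omega> \<in> E" "y = (\<Sum>\<omega>\<in>B. f \<omega> * \<omega>)"
    using fixed_repr[of y 1] assms by auto
  have "\<omega> \<in> E" if "\<omega> \<in> B" for \<omega> using that B(2) const_E unfolding Fqm_1 by auto
  then show ?thesis unfolding B(4) using B(3) by (intro sf_sum sf_mult subfield_E)
qed

text \<open>This is how the minimality of \<open>m\<close> will control the order of
  \<open>phi\<close> on \<open>K\<close>.\<close>

lemma fixed_in_const_ext: "y \<in> Em \<Longrightarrow> i \<ge> 1 \<Longrightarrow> (phi ^^ i) y = y \<Longrightarrow> y \<in> const_ext E i"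
proof -
  assume y: "y \<in> Em" "i \<ge> 1" "(phi ^^ i) y = y"
  obtain B f where B: "finite B" "B \<subseteq> Fqm i" "\<And>\<omega>. \<omega> \<in> B \<Longrightarrow> f \<omega> \<in> E" "y = (\<Sum>\<omega>\<in>B. f \<omega> * \<omega>)"
    using fixed_repr[OF y] by auto
  show "y \<in> const_ext E i" unfolding B(4) const_ext_def
    by (intro sf_sum sf_mult subfield_compositum)
      (use B(2,3) compositum_left[of E "Fqm i"] compositum_right[of "Fqm i" E] in auto)
qed

text \<open>Inverses come from the norm: the product \<open>P\<close> of the conjugates of
  \<open>y\<close> is fixed by \<open>phi\<close>, so it lies in \<open>E\<close>; it is nonzero
  because \<open>phi\<close> preserves \<open>N\<close>; and \<open>y\<close> is one of its
  factors.\<close>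

lemma subfield_Em: "subfield Em Amb"
proof (rule subfieldI_Amb)
  fix y assume y: "y \<in> Em" "y \<noteq> 0"
  define P where "P = (\<Prod>i<m. (phi ^^ i) y)"
  have P: "P \<in> Em" "phi P = (\<Prod>i<m. (phi ^^ Suc i) y)"
    unfolding P_def using Em_prod[of "{..<m}" "\<lambda>i. (phi ^^ i) y"] phi_funpow_in_Em[OF y(1)] by auto
  obtain m' where m': "m = Suc m'" using m_pos by (cases m) auto
  have lt: "{..<m} = {..<Suc m'}" unfolding m' ..
  have P': "P = y * (\<Prod>i<m'. (phi ^^ Suc i) y)" unfolding P_def lt prod.lessThan_Suc_shift by simp
  have last: "(phi ^^ Suc m') y = y" using phi_funpow_id[OF y(1)] by (simp only: m'[symmetric])
  have "phi P = (\<Prod>i<m'. (phi ^^ Suc i) y) * (phi ^^ Suc m') y" unfolding P(2) lt by (simp only: prod.lessThan_Suc)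
  then have "phi P = P" unfolding last P' by (simp only: mult.commute)
  then have PE: "P \<in> E" using fixed_in_E P(1) by blast
  have "N P = N y ^ m" unfolding P_def by (simp add: N_prod N_phi_funpow[OF y(1)])
  then have P0: "P \<noteq> 0" using y by auto
  have "inverse y = (\<Prod>i<m'. (phi ^^ Suc i) y) * inverse P" using P' P0 y by (simp add: field_simps)
  moreover have "(\<Prod>i<m'. (phi ^^ Suc i) y) \<in> Em"
    using Em_prod[of "{..<m'}" "\<lambda>i. (phi ^^ Suc i) y"] phi_funpow_in_Em[OF y(1)] by blast
  moreover have "inverse P \<in> Em" using PE sf_inverse[OF subfield_E] E_subset_Em by blast
  ultimately show "inverse y \<in> Em" using Em_mult by simp
qed (simp_all add: phi_1 Em_add Em_mult Em_uminus)

lemma const_ext_eq_Em: "const_ext E m = Em"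
proof
  show "const_ext E m \<subseteq> Em" unfolding const_ext_def
    by (rule compositum_least[OF subfield_Em E_subset_Em Fqm_subset_Em])
  show "Em \<subseteq> const_ext E m"
  proof
    fix y assume "y \<in> Em"
    then obtain f where f: "f \<in> EE" "y = ev f" by (auto simp: Em_def)
    show "y \<in> const_ext E m" unfolding f(2) ev_def const_ext_def
      by (intro sf_sum sf_mult subfield_compositum)
        (use f(1) basis(1) compositum_left[of E "Fqm m"] compositum_right[of "Fqm m" E] in \<open>auto simp: EE_def\<close>)
  qed
qed

lemma Em_residue:
  assumes "y \<in> Em" "N y \<le> 1"
  shows "\<exists>c\<in>Fqm m. N (y - c) < 1"
proof -
  obtain f where f: "f \<in> EE" "y = ev f" using assms by (auto simp: Em_def)
  have "\<exists>c. N (f \<omega> - const c) < 1" if "\<omega> \<in> basis" for \<omega>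
    using f that ev_max[OF f(1) that] assms(2) by (intro res_E) (auto simp: EE_def)
  then obtain a where a: "\<And>\<omega>. \<omega> \<in> basis \<Longrightarrow> N (f \<omega> - const (a \<omega>)) < 1" by metis
  define c where "c = (\<Sum>\<omega>\<in>basis. const (a \<omega>) * \<omega>)"
  have "c \<in> Fqm m" unfolding c_def using basis(1) by (intro sf_intros subfield_Fqm) auto
  moreover have "y - c = (\<Sum>\<omega>\<in>basis. (f \<omega> - const (a \<omega>)) * \<omega>)"
    by (simp add: f ev_def c_def left_diff_distrib sum_subtractf)
  moreover have "N (\<Sum>\<omega>\<in>basis. (f \<omega> - const (a \<omega>)) * \<omega>) < 1"
  proof (rule N_sum_less)
    fix \<omega> assume w: "\<omega> \<in> basis"
    then have "N \<omega> \<le> 1" using N_Fqm_le[OF _ m_pos] basis(1) by auto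
    then show "N ((f \<omega> - const (a \<omega>)) * \<omega>) < 1"
      using a[OF w] mult_left_mono[of "N \<omega>" 1 "N (f \<omega> - const (a \<omega>))"] by (simp add: N_mult)
  qed simp
  ultimately show ?thesis by (intro bexI[of _ c]) simp_all
qed

text \<open>Basis elements have absolute value at most 1, so some coefficient must already have the
  full absolute value; the constant extension is unramified.\<close>

lemma Em_value:
  assumes "y \<in> Em" "y \<noteq> 0"
  obtains x where "x \<in> E" "x \<noteq> 0" "N x = N y"
proof -
  obtain f where f: "f \<in> EE" "y = ev f" using assms by (auto simp: Em_def)
  have "\<exists>\<omega>\<in>basis. N (f \<omega>) \<ge> N y"
  proof (rule ccontr)
    assume no: "\<not> ?thesis"
    have "N (\<Sum>\<omega>\<in>basis. f \<omega> * \<omega>) < N y"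
    proof (rule N_sum_less)
      fix \<omega> assume w: "\<omega> \<in> basis"
      then have "N \<omega> \<le> 1" using N_Fqm_le[OF _ m_pos] basis(1) by auto
      then show "N (f \<omega> * \<omega>) < N y" using no w mult_left_mono[of "N \<omega>" 1 "N (f \<omega>)"] by (force simp: N_mult)
    qed (use assms in simp)
    then show False using f by (simp add: ev_def)
  qed
  then obtain \<omega> where w: "\<omega> \<in> basis" "N (f \<omega>) \<ge> N y" by blast
  then have "N (f \<omega>) = N y" using ev_max[OF f(1) w(1)] f(2) by simp
  moreover have "f \<omega> \<noteq> 0" using calculation assms(2) by (metis N_eq_0_iff)
  ultimately show ?thesis using that[of "f \<omega>"] f w by (auto simp: EE_def)
qed

lemma Em_discrete: "y \<in> Em \<Longrightarrow> y \<noteq> 0 \<Longrightarrow> \<exists>i. N y = \<rho> powi i"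
  using Em_value disc_E by metis

end

section \<open>Local degree of a Frobenius-stable field\<close>

context residue_one
begin

text \<open>The residue field of \<open>A\<close>, carried as the set of its representatives in
  \<open>Fqm m\<close>.\<close>

definition resset :: "'a kbar set \<Rightarrow> 'a kbar set"
  where "resset A = {c \<in> Fqm m. \<exists>x\<in>A. N (x - c) < 1}"

lemma resset_subset: "resset A \<subseteq> Fqm m"
  by (auto simp: resset_def)

lemma finite_resset: "finite (resset A)"
  by (rule finite_subset_Fqm[OF resset_subset])

lemma phi_funpow_mult: "x \<in> Em \<Longrightarrow> y \<in> Em \<Longrightarrow> (phi ^^ i) (x * y) = (phi ^^ i) x * (phi ^^ i) y"
  by (induction i) (simp_all add: Em_mult phi_funpow_in_Em)

lemma phi_funpow_sum: "(\<And>j. j \<in> J \<Longrightarrow> x j \<in> Em) \<Longrightarrow> (phi ^^ i) (\<Sum>j\<in>J. x j) = (\<Sum>j\<in>J. (phi ^^ i) (x j))"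
  by (induction i) (simp_all add: Em_sum phi_funpow_in_Em)

lemma phi_funpow_diff: "x \<in> Em \<Longrightarrow> y \<in> Em \<Longrightarrow> (phi ^^ i) (x - y) = (phi ^^ i) x - (phi ^^ i) y"
  by (induction i) (simp_all add: Em_diff phi_funpow_in_Em)

lemma phi_funpow_E: "x \<in> E \<Longrightarrow> (phi ^^ i) x = x"
  by (induction i) (simp_all add: phi_E)

lemma phi_funpow_1: "(phi ^^ i) 1 = 1"
  by (induction i) (simp_all add: phi_1)

definition Tr :: "'a kbar \<Rightarrow> 'a kbar"
  where "Tr x = (\<Sum>i<m. (phi ^^ i) x)"

lemma Tr_in_E:
  assumes x: "x \<in> Em"
  shows "Tr x \<in> E"
proof (rule fixed_in_E)
  show "Tr x \<in> Em" unfolding Tr_def using Em_sum[of "{..<m}" "\<lambda>i. (phi ^^ i) x"] phi_funpow_in_Em[OF x] by simp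
  have "phi (Tr x) = (\<Sum>i<m. (phi ^^ Suc i) x)"
    unfolding Tr_def using Em_sum[of "{..<m}" "\<lambda>i. (phi ^^ i) x"] phi_funpow_in_Em[OF x] by simp
  then have "phi (Tr x) + x = (\<Sum>i<Suc m. (phi ^^ i) x)" by (simp only: sum.lessThan_Suc_shift) simp
  also have "\<dots> = Tr x + x" by (simp add: Tr_def phi_funpow_id[OF x])
  finally show "phi (Tr x) = Tr x" by simp
qed

context
  fixes A :: "'a kbar set"
  assumes A: "subfield A Amb" and k_A: "k_field \<subseteq> A" and A_Em: "A \<subseteq> Em" and phi_A: "\<And>x. x \<in> A \<Longrightarrow> phi x \<in> A"
begin

lemma phi_funpow_A: "x \<in> A \<Longrightarrow> (phi ^^ i) x \<in> A"
  by (induction i) (auto simp: phi_A)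

lemma const_A: "const c \<in> A"
  using k_A const_in_k by blast

lemma Tr_in_A: "x \<in> A \<Longrightarrow> Tr x \<in> A"
  unfolding Tr_def by (intro sf_sum[OF A] phi_funpow_A)

lemma resset_residue:
  assumes "x \<in> A" "N x \<le> 1"
  obtains c where "c \<in> resset A" "N (x - c) < 1"
proof -
  obtain c where "c \<in> Fqm m" "N (x - c) < 1" using Em_residue[of x] assms A_Em by blast
  then show ?thesis using that[of c] assms(1) by (auto simp: resset_def)
qed

lemma subspace_resset: "Fq.subspace (resset A)"
proof (rule Fq.subspaceI)
  show "0 \<in> resset A" using sf_0[OF A] sf_0[OF subfield_Fqm] by (auto simp: resset_def intro!: bexI[of _ 0])
next
  fix x y assume "x \<in> resset A" "y \<in> resset A"
  then obtain x' y' where *: "x' \<in> A" "N (x' - x) < 1" "y' \<in> A" "N (y' - y) < 1" "x \<in> Fqm m" "y \<in> Fqm m"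
    by (auto simp: resset_def)
  have "N ((x' + y') - (x + y)) < 1" using N_add_less[OF *(2,4)] by (simp add: algebra_simps)
  then show "x + y \<in> resset A" using * sf_add[OF A] sf_add[OF subfield_Fqm] by (auto simp: resset_def)
next
  fix c x assume "x \<in> resset A"
  then obtain x' where *: "x' \<in> A" "N (x' - x) < 1" "x \<in> Fqm m" by (auto simp: resset_def)
  have "N (const c * x' - const c * x) = N (const c) * N (x' - x)" by (simp flip: N_mult right_diff_distrib)
  also have "\<dots> \<le> N (x' - x)" using mult_right_mono[OF N_const_le, of "N (x' - x)"] by simp
  finally have "N (const c * x' - const c * x) < 1" using * by simp
  moreover have "const c * x' \<in> A" "const c * x \<in> Fqm m"
    by (rule sf_mult[OF A const_A *(1)], rule sf_mult[OF subfield_Fqm const_in_Fqm *(3)])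
  ultimately show "const c * x \<in> resset A" by (auto simp: resset_def)
qed

text \<open>The trace of \<open>c y\<close> has the absolute value of \<open>y\<close> for a suitable constant \<open>c\<close>.\<close>

lemma value_in_E:
  assumes Fq_A: "Fqm m \<subseteq> A" and y: "y \<in> A" "y \<noteq> 0"
  obtains r where "r \<in> A \<inter> E" "r \<noteq> 0" "N r = N y"
proof -
  obtain x where x: "x \<in> E" "x \<noteq> 0" "N x = N y" using Em_value[of y] y A_Em by blast
  have yx: "y / x \<in> Em" using y x A_Em E_subset_Em by (intro sf_divide[OF subfield_Em]) auto
  have Nyx: "N (y / x) = 1" using x(3) y(2) by (simp add: N_divide)
  have "\<exists>c\<in>Fqm m. N (y / x - c) < 1" by (rule Em_residue[OF yx]) (simp add: Nyx)
  then obtain \<xi> where \<xi>: "\<xi> \<in> Fqm m" "N (y / x - \<xi>) < 1" by blast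
  have \<xi>0: "\<xi> \<noteq> 0" using \<xi>(2) Nyx by auto
  obtain d :: "'a kbar" where d: "d \<in> Fqm m" "(\<Sum>i<m. d ^ (CARD('a) ^ i)) \<noteq> 0" using trace_nonzero[OF m_pos] by blast
  \<comment> \<open>Chosen so that \<open>c * (y / x)\<close> has residue \<open>d\<close>, an
    element of nonzero trace.\<close>
  define c where "c = d / \<xi>"
  have c: "c \<in> Fqm m" unfolding c_def using d \<xi> by (intro sf_divide[OF subfield_Fqm])
  have cE: "c \<in> Em" using c Fqm_subset_Em by blast
  define r where "r = Tr (c * y)"
  have cy: "c * y \<in> A" using c Fq_A y by (intro sf_mult[OF A]) auto
  have r: "r \<in> A \<inter> E" unfolding r_def using Tr_in_A[OF cy] Tr_in_E cy A_Em by blast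
  have pd: "(phi ^^ i) d = d ^ (CARD('a) ^ i)" for i
    using phi_funpow_family[of "{()}" "\<lambda>_. 1" "\<lambda>_. d" i] d sf_1[OF subfield_E] by simp
  \<comment> \<open>Conjugation fixes \<open>x\<close> and preserves \<open>N\<close>, so each
    conjugate of \<open>c * y / x\<close> is congruent to the same conjugate of \<open>d\<close>;
    their sum is then congruent to the nonzero trace.\<close>
  have trm: "N ((phi ^^ i) (c * y) / x - d ^ (CARD('a) ^ i)) < 1" for i
  proof -
    have xE: "x \<in> Em" and dE: "d \<in> Em" and \<xi>E: "\<xi> \<in> Em" using x(1) d(1) \<xi>(1) E_subset_Em Fqm_subset_Em by auto
    have cyx: "c * (y / x) \<in> Em" by (rule sf_mult[OF subfield_Em cE yx])
    have e: "x * (c * (y / x)) = c * y" using x(2) by simp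
    have "(phi ^^ i) (c * y) = x * (phi ^^ i) (c * (y / x))"
      using phi_funpow_mult[OF xE cyx, of i] unfolding e phi_funpow_E[OF x(1)] .
    then have "(phi ^^ i) (c * y) / x = (phi ^^ i) (c * (y / x))" using x(2) by simp
    then have "(phi ^^ i) (c * y) / x - d ^ (CARD('a) ^ i) = (phi ^^ i) (c * (y / x) - d)"
      using phi_funpow_diff[OF cyx dE, of i] pd[of i] by simp
    moreover have "c * (y / x) - d = c * (y / x - \<xi>)"
      unfolding right_diff_distrib c_def using \<xi>0 by simp
    moreover have "c * (y / x - \<xi>) \<in> Em" by (rule sf_mult[OF subfield_Em cE sf_diff[OF subfield_Em yx \<xi>E]])
    ultimately have "N ((phi ^^ i) (c * y) / x - d ^ (CARD('a) ^ i)) = N (c * (y / x - \<xi>))"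
      by (simp only: N_phi_funpow)
    also have "\<dots> \<le> N (y / x - \<xi>)" using mult_right_mono[OF N_Fqm_le[OF c m_pos], of "N (y / x - \<xi>)"] by (simp add: N_mult)
    finally show ?thesis using \<xi>(2) by simp
  qed
  let ?t = "\<Sum>i<m. d ^ (CARD('a) ^ i)"
  have "?t \<in> Fqm m" using d by (intro sf_sum[OF subfield_Fqm] Fqm_frob)
  then have Nt: "N ?t = 1" using d(2) N_Fqm m_pos by blast
  have "r / x - ?t = (\<Sum>i<m. (phi ^^ i) (c * y) / x - d ^ (CARD('a) ^ i))"
    by (simp add: r_def Tr_def sum_divide_distrib sum_subtractf)
  then have "N (r / x - ?t) < 1" using N_sum_less[of 1 "{..<m}"] trm by simp
  then have "N (?t - r / x) < N ?t" using Nt N_minus_commute[of ?t] by simp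
  then have Nrx: "N (r / x) = 1" using N_eq_of_diff_less[of ?t "r / x"] Nt by simp
  have "N r = N (r / x) * N x" using x(2) by (simp flip: N_mult)
  then have "N r = N y" using Nrx x(3) by simp
  moreover have "r \<noteq> 0" using Nrx by auto
  ultimately show ?thesis using r by (intro that)
qed

section \<open>The product of ramification index and residue degree\<close>

context
  fixes \<pi> \<eta> :: "'a kbar" and e f :: nat
  assumes order: "\<And>i. 0 < i \<Longrightarrow> i < m \<Longrightarrow> \<exists>x\<in>A. (phi ^^ i) x \<noteq> x"
    and \<pi>: "uniformizer A \<pi>" and \<eta>: "uniformizer (A \<inter> E) \<eta>" and e: "N \<eta> = N \<pi> ^ e"
    and f: "card (resset A) = CARD('a) ^ f"
begin

lemma \<pi>_props: "\<pi> \<in> A" "\<pi> \<noteq> 0" "0 < N \<pi>" "N \<pi> < 1" "\<And>x. x \<in> A \<Longrightarrow> x \<noteq> 0 \<Longrightarrow> \<exists>i. N x = N \<pi> powi i"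
  and \<eta>_props: "\<eta> \<in> A" "\<eta> \<in> E" "\<eta> \<noteq> 0" "0 < N \<eta>" "N \<eta> < 1" "\<And>x. x \<in> A \<Longrightarrow> x \<in> E \<Longrightarrow> x \<noteq> 0 \<Longrightarrow> \<exists>i. N x = N \<eta> powi i"
  using \<pi> \<eta> by (auto simp: uniformizer_def)

lemma e_pos: "e > 0"
  using e \<eta>_props(5) by (cases e) auto

definition rbasis :: "'a kbar set"
  where "rbasis = (SOME B. B \<subseteq> resset A \<and> Fq.independent B \<and> resset A \<subseteq> Fq.span B)"

lemma rbasis: "rbasis \<subseteq> resset A" "Fq.independent rbasis" "resset A \<subseteq> Fq.span rbasis"
proof -
  have "\<exists>B. B \<subseteq> resset A \<and> Fq.independent B \<and> resset A \<subseteq> Fq.span B"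
    by (rule Fq.basis_exists[of "resset A"]) blast
  from someI_ex[OF this] show "rbasis \<subseteq> resset A" "Fq.independent rbasis" "resset A \<subseteq> Fq.span rbasis"
    unfolding rbasis_def by blast+
qed

lemma finite_rbasis: "finite rbasis"
  using rbasis(1) finite_resset finite_subset by blast

lemma rbasis_Fqm: "rbasis \<subseteq> Fqm m"
  using rbasis(1) resset_subset by blast

lemma card_rbasis: "card rbasis = f"
proof -
  have "Fq.span rbasis = resset A"
    using rbasis Fq.span_minimal[OF rbasis(1) subspace_resset] by blast
  then have "CARD('a) ^ card rbasis = CARD('a) ^ f"
    using card_span_independent[OF finite_rbasis rbasis(2)] f by simp
  then show ?thesis using card_gt_1[where 'a = 'a] power_inject_exp by blast
qed

definition lift :: "'a kbar \<Rightarrow> 'a kbar"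
  where "lift c = (SOME x. x \<in> A \<and> N (x - c) < 1)"

lemma lift: "c \<in> resset A \<Longrightarrow> lift c \<in> A \<and> N (lift c - c) < 1"
  unfolding lift_def using someI_ex[of "\<lambda>x. x \<in> A \<and> N (x - c) < 1"] by (auto simp: resset_def)

lemma lift_rbasis: "c \<in> rbasis \<Longrightarrow> lift c \<in> A" "c \<in> rbasis \<Longrightarrow> N (lift c - c) < 1"
  using lift rbasis(1) by auto

text \<open>The classical candidate for a basis of \<open>A\<close> over
  \<open>A \<inter> E\<close>: lifts of a residue basis times the powers of \<pi> below
  \<open>e\<close>.\<close>

definition bas :: "'a kbar \<times> nat \<Rightarrow> 'a kbar"
  where "bas p = lift (fst p) * \<pi> ^ snd p"

definition Ix :: "('a kbar \<times> nat) set"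
  where "Ix = rbasis \<times> {..<e}"

lemma finite_Ix: "finite Ix" and card_Ix: "card Ix = e * f"
  by (simp_all add: Ix_def finite_rbasis card_rbasis card_cartesian_product)

lemma bas_A: "p \<in> Ix \<Longrightarrow> bas p \<in> A"
  by (auto simp: bas_def Ix_def intro!: sf_mult[OF A] sf_power[OF A] lift_rbasis \<pi>_props)

text \<open>Dividing by \<open>\<eta> powi k' * \<pi> ^ j\<close>, with \<open>j\<close> the
  remainder of the exponent modulo \<open>e\<close>, leaves an element of absolute value 1, whose
  residue is expanded in the residue basis. Subtracting the corresponding combination lowers the
  absolute value, and since values are powers of \<open>N \<pi>\<close>, by at least one factor
  \<open>N \<pi>\<close>.\<close>

lemma approx_step:
  assumes x: "x \<in> A"
  shows "\<exists>a. (\<forall>p\<in>Ix. a p \<in> A \<inter> E) \<and> N (x - (\<Sum>p\<in>Ix. a p * bas p)) \<le> N \<pi> * N x"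
proof (cases "x = 0")
  case True
  then show ?thesis using sf_0[OF A] sf_0[OF subfield_E] by (intro exI[of _ "\<lambda>_. 0"]) auto
next
  case False
  obtain k where k: "N x = N \<pi> powi k" using \<pi>_props(5) x False by blast
  define k' where "k' = k div int e"
  define j where "j = nat (k mod int e)"
  have j: "int j = k mod int e" "j < e" using e_pos by (auto simp: j_def nat_less_iff)
  define w where "w = \<eta> powi k' * \<pi> ^ j"
  have w: "w \<in> A" "w \<noteq> 0" unfolding w_def using \<eta>_props \<pi>_props
    by (auto intro!: sf_mult[OF A] sf_powi[OF A] sf_power[OF A])
  have "N w = N \<pi> powi (int e * k' + int j)"
    using \<pi>_props(2) by (simp add: w_def N_mult N_powi N_power e power_int_add flip: power_int_mult power_int_of_nat)
  also have "int e * k' + int j = k" unfolding k'_def j(1) by simp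
  finally have Nw: "N w = N x" using k by simp
  have "x / w \<in> A" "N (x / w) \<le> 1" using w x Nw by (auto simp: N_divide intro: sf_divide[OF A])
  then obtain c where c: "c \<in> resset A" "N (x / w - c) < 1" using resset_residue by blast
  obtain a where a: "c = (\<Sum>r\<in>rbasis. const (a r) * r)" using basis_expand[OF rbasis_Fqm, of c] c(1) rbasis(3) by blast
  define b where "b = (\<lambda>p :: 'a kbar \<times> nat. if snd p = j then const (a (fst p)) * \<eta> powi k' else 0)"
  have bF: "b p \<in> A \<inter> E" for p
    unfolding b_def using const_A const_E \<eta>_props sf_0[OF A] sf_0[OF subfield_E]
    by (auto intro!: sf_mult[OF A] sf_powi[OF A] sf_mult[OF subfield_E] sf_powi[OF subfield_E])
  have "(\<Sum>p\<in>Ix. b p * bas p) = (\<Sum>r\<in>rbasis. \<Sum>i<e. b (r, i) * bas (r, i))"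
    unfolding Ix_def by (simp add: sum.cartesian_product)
  also have "\<dots> = (\<Sum>r\<in>rbasis. const (a r) * lift r * w)"
  proof (rule sum.cong)
    fix r assume "r \<in> rbasis"
    have "(\<Sum>i<e. b (r, i) * bas (r, i)) = (\<Sum>i<e. if i = j then const (a r) * lift r * w else 0)"
      by (rule sum.cong) (auto simp: b_def bas_def w_def)
    then show "(\<Sum>i<e. b (r, i) * bas (r, i)) = const (a r) * lift r * w" using j(2) by simp
  qed simp
  finally have s: "(\<Sum>p\<in>Ix. b p * bas p) = (\<Sum>r\<in>rbasis. const (a r) * lift r) * w" by (simp add: sum_distrib_right)
  define y where "y = x - (\<Sum>p\<in>Ix. b p * bas p)"
  have "N (c - (\<Sum>r\<in>rbasis. const (a r) * lift r)) < 1"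
  proof -
    have "c - (\<Sum>r\<in>rbasis. const (a r) * lift r) = (\<Sum>r\<in>rbasis. const (a r) * (r - lift r))"
      by (simp add: a right_diff_distrib sum_subtractf)
    moreover have "N (\<Sum>r\<in>rbasis. const (a r) * (r - lift r)) < 1"
    proof (rule N_sum_less)
      fix r assume r: "r \<in> rbasis"
      show "N (const (a r) * (r - lift r)) < 1"
        using mult_right_mono[OF N_const_le, of "N (r - lift r)" "a r"] lift_rbasis(2)[OF r] N_minus_commute[of r "lift r"]
        by (simp add: N_mult)
    qed simp
    ultimately show ?thesis by simp
  qed
  then have "N (x / w - (\<Sum>r\<in>rbasis. const (a r) * lift r)) < 1" using N_trans_less c(2) by blast
  moreover have "y = (x / w - (\<Sum>r\<in>rbasis. const (a r) * lift r)) * w"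
    unfolding y_def s using w by (simp add: left_diff_distrib)
  ultimately have less: "N y < N x" using Nw w False mult_strict_right_mono[of _ 1 "N w"] by (simp add: N_mult)
  have "y \<in> A" unfolding y_def using x bF bas_A by (intro sf_diff[OF A] sf_sum[OF A] sf_mult[OF A]) auto
  have "N y \<le> N \<pi> * N x"
  proof (cases "y = 0")
    case False
    then obtain i where i: "N y = N \<pi> powi i" using \<pi>_props(5) \<open>y \<in> A\<close> by blast
    have "k < i" using less unfolding i k powi_less_iff[OF \<pi>_props(3,4)] .
    then have "N \<pi> powi i \<le> N \<pi> powi (k + 1)" using powi_le_iff[OF \<pi>_props(3,4), of i "k + 1"] by simp
    also have "\<dots> = N \<pi> * N x" using k \<pi>_props(3) by (simp add: power_int_add)
    finally show ?thesis using i by simp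
  qed simp
  then show ?thesis using bF unfolding y_def by (intro exI[of _ b]) simp
qed

text \<open>Without completeness the expansion is reached only up to an arbitrarily small error,
  which suffices for testing a continuous map.\<close>

lemma approx:
  assumes x: "x \<in> A"
  shows "\<exists>a. (\<forall>p\<in>Ix. a p \<in> A \<inter> E) \<and> N (x - (\<Sum>p\<in>Ix. a p * bas p)) \<le> N \<pi> ^ M * N x"
proof (induction M)
  case 0
  then show ?case using sf_0[OF A] sf_0[OF subfield_E] by (intro exI[of _ "\<lambda>_. 0"]) auto
next
  case (Suc M)
  then obtain a where a: "\<forall>p\<in>Ix. a p \<in> A \<inter> E" "N (x - (\<Sum>p\<in>Ix. a p * bas p)) \<le> N \<pi> ^ M * N x" by blast
  define y where "y = x - (\<Sum>p\<in>Ix. a p * bas p)"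
  have "y \<in> A" unfolding y_def using x a bas_A by (intro sf_diff[OF A] sf_sum[OF A] sf_mult[OF A]) auto
  then obtain b where b: "\<forall>p\<in>Ix. b p \<in> A \<inter> E" "N (y - (\<Sum>p\<in>Ix. b p * bas p)) \<le> N \<pi> * N y"
    using approx_step by blast
  have "x - (\<Sum>p\<in>Ix. (a p + b p) * bas p) = y - (\<Sum>p\<in>Ix. b p * bas p)"
    by (simp add: y_def distrib_right sum.distrib)
  moreover have "N \<pi> * N y \<le> N \<pi> ^ Suc M * N x"
    using mult_left_mono[OF a(2), of "N \<pi>"] by (simp add: y_def mult.assoc)
  moreover have "\<forall>p\<in>Ix. a p + b p \<in> A \<inter> E" using a(1) b(1) sf_add[OF A] sf_add[OF subfield_E] by auto
  ultimately show ?case using b(2) by (intro exI[of _ "\<lambda>p. a p + b p"]) auto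
qed

text \<open>The maps \<open>phi ^^ i\<close> with \<open>i < m\<close> are distinct on
  \<open>A\<close>: applying \<open>phi ^^ (m - i)\<close> to a coincidence of the i-th and j-th
  powers would make \<open>phi ^^ (j - i)\<close> trivial.\<close>

lemma dedekind_phi:
  assumes "\<And>x. x \<in> A \<Longrightarrow> (\<Sum>i<m. c i * (phi ^^ i) x) = 0"
  shows "\<forall>i<m. c i = 0"
proof -
  have neq: "\<exists>x\<in>A. (phi ^^ i) x \<noteq> (phi ^^ j) x" if ij: "i < j" "j < m" for i j
  proof -
    have "0 < j - i" "j - i < m" using ij by auto
    then obtain x where x: "x \<in> A" "(phi ^^ (j - i)) x \<noteq> x" using order by blast
    have "(phi ^^ i) x \<noteq> (phi ^^ j) x"
    proof
      assume "(phi ^^ i) x = (phi ^^ j) x"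
      then have "(phi ^^ (m - i)) ((phi ^^ i) x) = (phi ^^ (m - i)) ((phi ^^ j) x)" by simp
      moreover have "(phi ^^ (m - i)) ((phi ^^ i) x) = (phi ^^ m) x"
        using funpow_add[of "m - i" i phi] ij by (simp add: fun_eq_iff)
      moreover have "(phi ^^ (m - i)) ((phi ^^ j) x) = (phi ^^ (j - i)) ((phi ^^ m) x)"
      proof -
        have "(m - i) + j = (j - i) + m" using ij by simp
        then show ?thesis by (metis comp_apply funpow_add)
      qed
      ultimately show False using x phi_funpow_id A_Em by auto
    qed
    then show ?thesis using x by blast
  qed
  have "\<forall>i\<in>{..<m}. c i = 0"
  proof (rule dedekind_independence[where \<sigma> = "\<lambda>i. phi ^^ i" and A = A])
    fix i j assume "i \<in> {..<m}" "j \<in> {..<m}" "i \<noteq> j"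
    then show "\<exists>x\<in>A. (phi ^^ i) x \<noteq> (phi ^^ j) x" using neq[of i j] neq[of j i] by (metis lessThan_iff linorder_neqE_nat)
  qed (use assms A_Em in \<open>auto simp: phi_funpow_1 intro: phi_funpow_mult sf_mult[OF A] sf_1[OF A]\<close>)
  then show ?thesis by simp
qed

text \<open>
  If \<open>e f < m\<close>, some nonzero \<open>\<Sum>\<^sub>i c\<^sub>i \<phi>\<^sup>i\<close> kills all \<open>bas p\<close>; being continuous, it kills \<open>A\<close>.
\<close>

lemma degree_lower: "m \<le> card Ix"
proof (rule ccontr)
  assume "\<not> m \<le> card Ix"
  then have less: "card Ix < card {..<m}" by simp
  have "\<exists>c. (\<forall>i\<in>{..<m}. c i \<in> A) \<and> (\<exists>i\<in>{..<m}. c i \<noteq> 0) \<and> (\<forall>p\<in>Ix. (\<Sum>i\<in>{..<m}. c i * (phi ^^ i) (bas p)) = 0)"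
    using bas_A phi_funpow_A by (intro homogeneous_system[OF finite_Ix _ less A]) auto
  then obtain c where c: "\<exists>i<m. c i \<noteq> 0" "\<And>p. p \<in> Ix \<Longrightarrow> (\<Sum>i<m. c i * (phi ^^ i) (bas p)) = 0" by auto
  define L where "L = (\<lambda>x. \<Sum>i<m. c i * (phi ^^ i) x)"
  \<comment> \<open>A Lipschitz constant for \<open>L\<close>: \<open>phi\<close> is an isometry, so
    only the coefficients matter.\<close>
  define C where "C = (\<Sum>i<m. N (c i))"
  have C0: "C \<ge> 0" unfolding C_def by (simp add: sum_nonneg)
  have bound: "N (L y) \<le> C * N y" if "y \<in> A" for y
    unfolding L_def
  proof (rule N_sum_le)
    fix i assume "i \<in> {..<m}"
    then have "N (c i) \<le> C" unfolding C_def by (intro member_le_sum) auto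
    then show "N (c i * (phi ^^ i) y) \<le> C * N y"
      using N_phi_funpow[of y i] that A_Em mult_right_mono[of "N (c i)" C "N y"] by (auto simp: N_mult)
  qed (use C0 in simp)
  have "L x = 0" if x: "x \<in> A" for x
  proof (rule ccontr)
    assume "L x \<noteq> 0"
    then have pos: "N (L x) > 0" by simp
    have D: "C * N x + 1 > 0" using C0 by (simp add: add_nonneg_pos)
    obtain M where M: "N \<pi> ^ M < N (L x) / (C * N x + 1)"
      using real_arch_pow_inv[OF _ \<pi>_props(4), of "N (L x) / (C * N x + 1)"] pos D by auto
    obtain a where a: "\<forall>p\<in>Ix. a p \<in> A \<inter> E" "N (x - (\<Sum>p\<in>Ix. a p * bas p)) \<le> N \<pi> ^ M * N x" using approx[OF x] by blast
    define s where "s = (\<Sum>p\<in>Ix. a p * bas p)"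
    have sA: "s \<in> A" unfolding s_def using a bas_A by (intro sf_sum[OF A] sf_mult[OF A]) auto
    have phis: "(phi ^^ i) s = (\<Sum>p\<in>Ix. a p * (phi ^^ i) (bas p))" for i
    proof -
      have "(phi ^^ i) s = (\<Sum>p\<in>Ix. (phi ^^ i) (a p * bas p))"
        unfolding s_def using a bas_A A_Em by (intro phi_funpow_sum) (auto intro: sf_mult[OF A, THEN subsetD[OF A_Em]])
      also have "\<dots> = (\<Sum>p\<in>Ix. a p * (phi ^^ i) (bas p))"
      proof (rule sum.cong)
        fix p assume p: "p \<in> Ix"
        have "a p \<in> Em" "bas p \<in> Em" "a p \<in> E" using p a subsetD[OF A_Em bas_A[OF p]] A_Em by auto
        then show "(phi ^^ i) (a p * bas p) = a p * (phi ^^ i) (bas p)" by (simp add: phi_funpow_mult phi_funpow_E)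
      qed simp
      finally show ?thesis .
    qed
    have "L s = (\<Sum>i<m. \<Sum>p\<in>Ix. a p * (c i * (phi ^^ i) (bas p)))"
      unfolding L_def phis sum_distrib_left by (simp add: mult.left_commute)
    also have "\<dots> = (\<Sum>p\<in>Ix. a p * (\<Sum>i<m. c i * (phi ^^ i) (bas p)))"
      unfolding sum_distrib_left by (rule sum.swap)
    also have "\<dots> = 0" using c(2) by simp
    finally have "L s = 0" .
    moreover have "L (x - s) = L x - L s"
      unfolding L_def using x sA A_Em by (simp add: phi_funpow_diff subset_iff right_diff_distrib sum_subtractf)
    ultimately have "N (L x) \<le> C * N (x - s)" using bound[of "x - s"] x sA sf_diff[OF A] by simp
    also have "\<dots> \<le> C * (N \<pi> ^ M * N x)" using a(2) C0 unfolding s_def by (intro mult_left_mono)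
    also have "\<dots> = N \<pi> ^ M * (C * N x)" by simp
    also have "\<dots> \<le> N \<pi> ^ M * (C * N x + 1)" by (intro mult_left_mono) auto
    also have "\<dots> < N (L x)" using M D by (simp add: pos_less_divide_eq)
    finally show False by simp
  qed
  then show False using dedekind_phi[of c] c(1) unfolding L_def by blast
qed

text \<open>Exchanging the lifts for their residues changes the sum by less than its largest
  coefficient, and for the residues \<open>independent_max\<close> gives the value.\<close>

lemma lift_sum_value:
  assumes a: "\<And>r. r \<in> rbasis \<Longrightarrow> a r \<in> A \<inter> E" and nz: "\<exists>r\<in>rbasis. a r \<noteq> 0"
  shows "\<exists>r\<in>rbasis. a r \<noteq> 0 \<and> N (\<Sum>r\<in>rbasis. a r * lift r) = N (a r)"
proof -
  obtain r0 where r0: "r0 \<in> rbasis" "a r0 \<noteq> 0" using nz by blast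
  have "Max ((\<lambda>r. N (a r)) ` rbasis) \<in> (\<lambda>r. N (a r)) ` rbasis" using finite_rbasis r0 by (intro Max_in) auto
  then obtain r where r': "r \<in> rbasis" "N (a r) = Max ((\<lambda>r. N (a r)) ` rbasis)" by auto
  then have r: "r \<in> rbasis" "\<And>s. s \<in> rbasis \<Longrightarrow> N (a s) \<le> N (a r)" using finite_rbasis by auto
  have pos: "N (a r) > 0" using r(2)[OF r0(1)] r0(2) N_pos[of "a r0"] by linarith
  define z where "z = (\<Sum>s\<in>rbasis. a s * s)"
  have "N (a r) \<le> N z" unfolding z_def
  proof (rule independent_max[OF finite_rbasis])
    show "\<forall>i\<in>rbasis. b i = 0" if "(\<Sum>i\<in>rbasis. const (b i) * i) = 0" for b
      using basis_family[OF rbasis_Fqm rbasis(2) that] .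
  qed (use a r rbasis_Fqm in auto)
  moreover have "N z \<le> N (a r)" unfolding z_def
  proof (rule N_sum_le)
    fix s assume s: "s \<in> rbasis"
    then have "N s \<le> 1" using rbasis_Fqm by (intro N_Fqm_le[OF _ m_pos]) auto
    then have "N (a s * s) \<le> N (a s)" using mult_left_mono[of "N s" 1 "N (a s)"] by (simp add: N_mult)
    then show "N (a s * s) \<le> N (a r)" using r(2)[OF s] by simp
  qed simp
  ultimately have Nz: "N z = N (a r)" by simp
  have "z - (\<Sum>s\<in>rbasis. a s * lift s) = (\<Sum>s\<in>rbasis. a s * (s - lift s))"
    by (simp add: z_def right_diff_distrib sum_subtractf)
  moreover have "N (\<Sum>s\<in>rbasis. a s * (s - lift s)) < N (a r)"
  proof (rule N_sum_less[OF pos])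
    fix s assume s: "s \<in> rbasis"
    have l: "N (s - lift s) < 1" using lift_rbasis(2)[OF s] N_minus_commute[of s] by simp
    have "N (a s * (s - lift s)) \<le> N (a r) * N (s - lift s)"
      unfolding N_mult using r(2)[OF s] by (rule mult_right_mono) simp
    also have "\<dots> < N (a r) * 1" using l pos by (intro mult_strict_left_mono) auto
    finally show "N (a s * (s - lift s)) < N (a r)" by simp
  qed
  ultimately have "N (\<Sum>s\<in>rbasis. a s * lift s) = N (a r)"
    using N_eq_of_diff_less[of z "\<Sum>s\<in>rbasis. a s * lift s"] Nz by simp
  then show ?thesis using r pos by (intro bexI[of _ r]) auto
qed

text \<open>Grouped by the power of \<pi>, the terms have exponents \<open>int e * i + int j\<close>
  with distinct remainders modulo \<open>e\<close>; no two have equal absolute value, so the largest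
  one cannot be cancelled.\<close>

lemma bas_independent:
  assumes a: "\<And>p. p \<in> Ix \<Longrightarrow> a p \<in> A \<inter> E" and s0: "(\<Sum>p\<in>Ix. a p * bas p) = 0"
  shows "\<forall>p\<in>Ix. a p = 0"
proof (rule ccontr)
  assume "\<not> ?thesis"
  then obtain r1 j1 where p1: "(r1, j1) \<in> Ix" "a (r1, j1) \<noteq> 0" by auto
  define s where "s = (\<lambda>j. \<Sum>r\<in>rbasis. a (r, j) * lift r)"
  define J where "J = {j. j < e \<and> (\<exists>r\<in>rbasis. a (r, j) \<noteq> 0)}"
  have J: "finite J" "j1 \<in> J" using p1 by (auto simp: J_def Ix_def)
  have val: "s j \<noteq> 0 \<and> (\<exists>i. N (s j) = N \<eta> powi i)" if j: "j \<in> J" for j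
  proof -
    have aj: "a (r, j) \<in> A \<inter> E" if "r \<in> rbasis" for r using that j a by (auto simp: J_def Ix_def)
    then obtain r where r: "r \<in> rbasis" "a (r, j) \<noteq> 0" "N (s j) = N (a (r, j))"
      using lift_sum_value[of "\<lambda>r. a (r, j)"] j unfolding s_def J_def by blast
    then show ?thesis using \<eta>_props(6)[of "a (r, j)"] aj[OF r(1)] by (metis IntE N_eq_0_iff)
  qed
  have sJ: "(\<Sum>j\<in>J. s j * \<pi> ^ j) = 0"
  proof -
    have "(\<Sum>j\<in>J. s j * \<pi> ^ j) = (\<Sum>j<e. s j * \<pi> ^ j)"
    proof (rule sum.mono_neutral_left)
      show "\<forall>j\<in>{..<e} - J. s j * \<pi> ^ j = 0" by (auto simp: J_def s_def)
    qed (auto simp: J_def)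
    also have "\<dots> = (\<Sum>j<e. \<Sum>r\<in>rbasis. a (r, j) * bas (r, j))"
      by (simp add: s_def bas_def sum_distrib_right mult.assoc)
    also have "\<dots> = (\<Sum>r\<in>rbasis. \<Sum>j<e. a (r, j) * bas (r, j))" by (rule sum.swap)
    also have "\<dots> = (\<Sum>p\<in>Ix. a p * bas p)" unfolding Ix_def by (simp add: sum.cartesian_product)
    finally show ?thesis using s0 by simp
  qed
  have "Max ((\<lambda>j. N (s j * \<pi> ^ j)) ` J) \<in> (\<lambda>j. N (s j * \<pi> ^ j)) ` J" using J by (intro Max_in) auto
  then obtain j0 where j0': "j0 \<in> J" "N (s j0 * \<pi> ^ j0) = Max ((\<lambda>j. N (s j * \<pi> ^ j)) ` J)" by auto
  then have j0: "j0 \<in> J" "\<And>j. j \<in> J \<Longrightarrow> N (s j * \<pi> ^ j) \<le> N (s j0 * \<pi> ^ j0)" using J by auto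
  have pos: "N (s j0 * \<pi> ^ j0) > 0" using val[OF j0(1)] \<pi>_props(2) by simp
  have "N (\<Sum>j\<in>J - {j0}. s j * \<pi> ^ j) < N (s j0 * \<pi> ^ j0)"
  proof (rule N_sum_less[OF pos])
    fix j assume j: "j \<in> J - {j0}"
    obtain i where i: "N (s j) = N \<eta> powi i" using val j by blast
    obtain i0 where i0: "N (s j0) = N \<eta> powi i0" using val j0 by blast
    have exp: "N (s j * \<pi> ^ j) = N \<pi> powi (int e * i + int j)" "N (s j0 * \<pi> ^ j0) = N \<pi> powi (int e * i0 + int j0)"
      using \<pi>_props(2) by (simp_all add: i i0 N_mult N_power N_powi e power_int_add flip: power_int_mult power_int_of_nat)
    have "int e * i + int j \<noteq> int e * i0 + int j0"
    proof
      assume "int e * i + int j = int e * i0 + int j0"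
      then have "(int e * i + int j) mod int e = (int e * i0 + int j0) mod int e" by simp
      then have "j = j0" using j j0(1) by (simp add: J_def)
      then show False using j by simp
    qed
    then have "N (s j * \<pi> ^ j) \<noteq> N (s j0 * \<pi> ^ j0)" unfolding exp powi_inject[OF \<pi>_props(3,4)] .
    then show "N (s j * \<pi> ^ j) < N (s j0 * \<pi> ^ j0)" using j0(2)[of j] j by simp
  qed
  then have "N ((\<Sum>j\<in>J - {j0}. s j * \<pi> ^ j) + s j0 * \<pi> ^ j0) = N (s j0 * \<pi> ^ j0)" by (rule N_add_eq)
  moreover have "(\<Sum>j\<in>J - {j0}. s j * \<pi> ^ j) + s j0 * \<pi> ^ j0 = 0"
    using sJ sum.remove[OF J(1) j0(1), of "\<lambda>j. s j * \<pi> ^ j"] by (simp add: add.commute)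
  ultimately show False using pos by simp
qed

text \<open>
  If \<open>e f > m\<close>, the traces of a solution of the conjugated linear system give a relation over \<open>A \<inter> E\<close>.
\<close>

lemma degree_upper: "card Ix \<le> m"
proof (rule ccontr)
  assume "\<not> card Ix \<le> m"
  \<comment> \<open>The exponents run from 1 to \<open>m\<close>, not from 0, so that
    \<open>m - i\<close> is available for every \<open>i < m\<close>.\<close>
  then have less: "card {1..m} < card Ix" by simp
  have "\<exists>c. (\<forall>p\<in>Ix. c p \<in> A) \<and> (\<exists>p\<in>Ix. c p \<noteq> 0) \<and> (\<forall>l\<in>{1..m}. (\<Sum>p\<in>Ix. c p * (phi ^^ l) (bas p)) = 0)"
    using bas_A phi_funpow_A by (intro homogeneous_system[OF _ finite_Ix less A]) auto
  then obtain c p0 where c: "\<And>p. p \<in> Ix \<Longrightarrow> c p \<in> A" "p0 \<in> Ix" "c p0 \<noteq> 0"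
    "\<And>l. l \<in> {1..m} \<Longrightarrow> (\<Sum>p\<in>Ix. c p * (phi ^^ l) (bas p)) = 0" by blast
  have "\<exists>z\<in>A. Tr z \<noteq> 0"
  proof (rule ccontr)
    assume "\<not> ?thesis"
    then have "\<forall>i<m. (1 :: 'a kbar) = 0" by (intro dedekind_phi) (auto simp: Tr_def)
    then show False using m_pos by auto
  qed
  then obtain z where z: "z \<in> A" "Tr z \<noteq> 0" by blast
  \<comment> \<open>Rescaled so that the coefficient at \<open>p0\<close> becomes \<open>z\<close>,
    whose trace is nonzero.\<close>
  define d where "d = (\<lambda>p. c p * (z / c p0))"
  have d: "d p \<in> A" if "p \<in> Ix" for p using c that z(1) unfolding d_def by (intro sf_mult[OF A] sf_divide[OF A]) auto
  have d0: "(\<Sum>p\<in>Ix. d p * (phi ^^ l) (bas p)) = 0" if "l \<in> {1..m}" for l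
  proof -
    have "(\<Sum>p\<in>Ix. d p * (phi ^^ l) (bas p)) = (z / c p0) * (\<Sum>p\<in>Ix. c p * (phi ^^ l) (bas p))"
      unfolding d_def sum_distrib_left by (rule sum.cong) auto
    then show ?thesis using c(4)[OF that] by simp
  qed
  \<comment> \<open>Applying \<open>phi ^^ i\<close> to the equation of index \<open>m - i\<close>
    moves the conjugation from \<open>bas p\<close> to the coefficients.\<close>
  have conj: "(\<Sum>p\<in>Ix. (phi ^^ i) (d p) * bas p) = 0" if i: "i < m" for i
  proof -
    have "(phi ^^ i) (\<Sum>p\<in>Ix. d p * (phi ^^ (m - i)) (bas p)) = (\<Sum>p\<in>Ix. (phi ^^ i) (d p * (phi ^^ (m - i)) (bas p)))"
      using d bas_A phi_funpow_A A_Em by (intro phi_funpow_sum) (auto intro!: subsetD[OF A_Em] sf_mult[OF A])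
    also have "\<dots> = (\<Sum>p\<in>Ix. (phi ^^ i) (d p) * bas p)"
    proof (rule sum.cong)
      fix p assume p: "p \<in> Ix"
      have "(phi ^^ i) ((phi ^^ (m - i)) (bas p)) = (phi ^^ m) (bas p)"
        using funpow_add[of i "m - i" phi] i by (simp add: fun_eq_iff)
      also have "\<dots> = bas p" using phi_funpow_id bas_A[OF p] A_Em by blast
      finally show "(phi ^^ i) (d p * (phi ^^ (m - i)) (bas p)) = (phi ^^ i) (d p) * bas p"
        using phi_funpow_mult[of "d p" "(phi ^^ (m - i)) (bas p)" i] d[OF p] phi_funpow_A[OF bas_A[OF p]] A_Em by auto
    qed simp
    finally show ?thesis using d0[of "m - i"] i phi_funpow_E[OF sf_0[OF subfield_E]] by simp
  qed
  have "(\<Sum>p\<in>Ix. Tr (d p) * bas p) = (\<Sum>i<m. \<Sum>p\<in>Ix. (phi ^^ i) (d p) * bas p)"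
    unfolding Tr_def sum_distrib_right by (rule sum.swap)
  also have "\<dots> = 0" using conj by simp
  finally have "\<forall>p\<in>Ix. Tr (d p) = 0"
    using Tr_in_A[OF d] Tr_in_E[OF subsetD[OF A_Em d]] by (intro bas_independent) auto
  moreover have "d p0 = z" using c(3) by (simp add: d_def)
  ultimately show False using z(2) c(2) by auto
qed

lemma local_degree: "e * f = m"
  using degree_lower degree_upper card_Ix by simp

end

end

end

section \<open>Conjugacy of the infinite primes\<close>

text \<open>By induction on \<open>J\<close>: for \<open>M > 0\<close> the element
  \<open>x + y ^ M\<close> stays small on \<open>P\<close>, and it is large at the new index if
  \<open>x\<close> is not. It stays large at the old ones provided \<open>y ^ M\<close> and
  \<open>x\<close> differ in absolute value there, which excludes at most one \<open>M\<close> per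
  index.\<close>

lemma approx_combine:
  fixes q :: "'j \<Rightarrow> 'b::field \<Rightarrow> real"
  assumes K: "subfield K Amb" and J: "finite J"
    and q: "\<And>j. j \<in> J \<Longrightarrow> absval (q j)" and P: "\<And>p. p \<in> P \<Longrightarrow> absval p"
    and ex: "\<And>j. j \<in> J \<Longrightarrow> \<exists>y\<in>K. q j y > 1 \<and> (\<forall>p\<in>P. p y < 1)"
  shows "\<exists>z\<in>K. (\<forall>j\<in>J. q j z > 1) \<and> (\<forall>p\<in>P. p z < 1)"
  using J q ex
proof (induction J rule: finite_induct)
  case empty
  have "p 0 < 1" if "p \<in> P" for p using absval.N_0[OF P[OF that]] by simp
  then show ?case using sf_0[OF K] by (intro bexI[of _ 0]) auto
next
  case (insert j J)
  have "\<exists>z\<in>K. (\<forall>j\<in>J. q j z > 1) \<and> (\<forall>p\<in>P. p z < 1)"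
    by (rule insert.IH) (use insert.prems in auto)
  then obtain x where x: "x \<in> K" "\<And>i. i \<in> J \<Longrightarrow> q i x > 1" "\<And>p. p \<in> P \<Longrightarrow> p x < 1" by blast
  obtain y where y: "y \<in> K" "q j y > 1" "\<And>p. p \<in> P \<Longrightarrow> p y < 1" using insert.prems(2)[of j] by blast
  show ?case
  proof (cases "q j x > 1")
    case True
    then show ?thesis using x by (intro bexI[of _ x]) auto
  next
    case False
    have "finite {M. q i y ^ M = q i x}" if i: "i \<in> J" for i
    proof (cases "q i y > 1")
      case True
      have "M = M'" if "q i y ^ M = q i x" "q i y ^ M' = q i x" for M M'
        using that power_inject_exp[OF True, of M M'] by simp
      then have "{M. q i y ^ M = q i x} \<subseteq> {SOME M. q i y ^ M = q i x}"
        using someI[of "\<lambda>M. q i y ^ M = q i x"] by blast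
      then show ?thesis using finite_subset by blast
    next
      case False
      have "q i y \<ge> 0" using absval.N_nonneg[OF insert.prems(1)] i by auto
      then have "q i y ^ M \<le> 1" for M using False by (intro power_le_one) auto
      then have "q i y ^ M \<noteq> q i x" for M using x(2)[OF i] by (metis linorder_not_less)
      then show ?thesis by simp
    qed
    then have "finite (insert 0 (\<Union>i\<in>J. {M. q i y ^ M = q i x}))" using insert.hyps by simp
    then obtain M where M: "M \<notin> insert 0 (\<Union>i\<in>J. {M. q i y ^ M = q i x})" using ex_new_if_finite infinite_UNIV_nat by blast
    define z where "z = x + y ^ M"
    have M0: "M > 0" and Mne: "\<And>i. i \<in> J \<Longrightarrow> q i y ^ M \<noteq> q i x" using M by auto
    have "z \<in> K" unfolding z_def by (intro sf_add[OF K] sf_power[OF K] x y)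
    moreover have "p z < 1" if p: "p \<in> P" for p
    proof -
      interpret p: absval p by (rule P[OF p])
      have "p (y ^ M) < 1" using y(3)[OF p] M0 by (simp add: p.N_power power_less_one_iff)
      then show ?thesis unfolding z_def using x(3)[OF p] by (intro p.N_add_less)
    qed
    moreover have "q i z > 1" if i: "i \<in> J" for i
    proof -
      interpret qi: absval "q i" using insert.prems(1) i by auto
      have "q i (y ^ M) \<noteq> q i x" using Mne[OF i] by (simp add: qi.N_power)
      then have "q i z = q i x \<or> q i z = q i (y ^ M) \<and> q i x < q i (y ^ M)"
        unfolding z_def using qi.N_add_eq[of x "y ^ M"] qi.N_add_eq[of "y ^ M" x]
        by (cases "q i x" "q i (y ^ M)" rule: linorder_cases) (simp_all add: add.commute[of "y ^ M" x])
      then show ?thesis using x(2)[OF i] by auto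
    qed
    moreover have "q j z > 1"
    proof -
      interpret qj: absval "q j" using insert.prems(1) by auto
      have "q j (y ^ M) > 1" using y(2) M0 by (simp add: qj.N_power one_less_power)
      then show ?thesis unfolding z_def using qj.N_add_eq[of x "y ^ M"] False by simp
    qed
    ultimately show ?thesis by auto
  qed
qed

text \<open>\<open>approx_combine\<close> is applied twice, for each \<open>i\<close> over
  \<open>J\<close> and then over \<open>I\<close>; inversion exchanges large and small in between
  and at the end.\<close>

lemma simultaneous_separation:
  fixes p :: "'i \<Rightarrow> 'b::field \<Rightarrow> real" and q :: "'j \<Rightarrow> 'b \<Rightarrow> real"
  assumes K: "subfield K Amb" and "finite I" "finite J"
    and p: "\<And>i. i \<in> I \<Longrightarrow> absval (p i)" and q: "\<And>j. j \<in> J \<Longrightarrow> absval (q j)"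
    and sep: "\<And>i j. i \<in> I \<Longrightarrow> j \<in> J \<Longrightarrow> \<exists>x\<in>K. p i x < 1 \<and> q j x > 1"
    and I: "I \<noteq> {}" and J: "J \<noteq> {}"
  shows "\<exists>x\<in>K. (\<forall>i\<in>I. p i x < 1) \<and> (\<forall>j\<in>J. q j x > 1)"
proof -
  have inv: "N (inverse x) > 1 \<longleftrightarrow> N x < 1 \<and> x \<noteq> 0" "N (inverse x) < 1 \<longleftrightarrow> N x > 1 \<or> x = 0" if "absval N" for N x
  proof -
    interpret absval N by (rule that)
    show "N (inverse x) > 1 \<longleftrightarrow> N x < 1 \<and> x \<noteq> 0" "N (inverse x) < 1 \<longleftrightarrow> N x > 1 \<or> x = 0"
      using N_pos[of x] by (cases "x = 0"; simp add: N_inverse one_less_inverse_iff inverse_less_1_iff)+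
  qed
  have "\<exists>z\<in>K. (\<forall>i\<in>I. p i z > 1) \<and> (\<forall>N\<in>q ` J. N z < 1)"
  proof (rule approx_combine[OF K \<open>finite I\<close> p])
    fix i assume i: "i \<in> I"
    have "\<exists>z\<in>K. (\<forall>j\<in>J. q j z > 1) \<and> (\<forall>N\<in>{p i}. N z < 1)"
      by (rule approx_combine[OF K \<open>finite J\<close> q]) (use p[OF i] sep[OF i] in auto)
    then obtain z where z: "z \<in> K" "\<And>j. j \<in> J \<Longrightarrow> q j z > 1" "p i z < 1" by auto
    obtain j where "j \<in> J" using J by auto
    then have "z \<noteq> 0" using z(2)[of j] absval.N_0[OF q[of j]] by auto
    then have "p i (inverse z) > 1" using inv(1)[OF p[OF i]] z(3) by simp
    moreover have "q j (inverse z) < 1" if "j \<in> J" for j using inv(2)[OF q[OF that]] z(2)[OF that] by simp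
    ultimately show "\<exists>y\<in>K. 1 < p i y \<and> (\<forall>N\<in>q ` J. N y < 1)"
      using sf_inverse[OF K z(1)] by (intro bexI[of _ "inverse z"]) auto
  qed (use q in auto)
  then obtain z where z: "z \<in> K" "\<And>i. i \<in> I \<Longrightarrow> p i z > 1" "\<And>j. j \<in> J \<Longrightarrow> q j z < 1" by auto
  obtain i where "i \<in> I" using I by auto
  then have "z \<noteq> 0" using z(2)[of i] absval.N_0[OF p[of i]] by auto
  then have "q j (inverse z) > 1" if "j \<in> J" for j using inv(1)[OF q[OF that]] z(3)[OF that] by simp
  moreover have "p i (inverse z) < 1" if "i \<in> I" for i using inv(2)[OF p[OF that]] z(2)[OF that] by simp
  ultimately show ?thesis using sf_inverse[OF K z(1)] by (intro bexI[of _ "inverse z"]) auto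
qed

text \<open>An inclusion of discrete valuation rings forces \<open>w\<close> to be a multiple of
  \<open>v\<close>; surjectivity onto the integers makes the factor 1.\<close>

lemma prime_valuation_eqI:
  assumes A: "subfield A Amb" and v: "prime_valuation A v" and w: "prime_valuation A w"
    and le: "\<And>x. x \<in> A \<Longrightarrow> x \<noteq> 0 \<Longrightarrow> v x \<ge> 0 \<Longrightarrow> w x \<ge> 0" and x: "x \<in> A" "x \<noteq> 0"
  shows "w x = v x"
proof -
  have zero: "w y = 0" if y: "y \<in> A" "y \<noteq> 0" "v y = 0" for y
    using le[of y] le[of "inverse y"] y pv_inverse[OF v A y(1,2)] pv_inverse[OF w A y(1,2)] sf_inverse[OF A y(1)] by auto
  obtain \<pi> where \<pi>: "\<pi> \<in> A" "\<pi> \<noteq> 0" "v \<pi> = 1" using pv_surj[OF v A, of 1] by blast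
  have *: "w y = v y * w \<pi>" if y: "y \<in> A" "y \<noteq> 0" for y
  proof -
    have p: "\<pi> powi (- v y) \<in> A" "\<pi> powi (- v y) \<noteq> 0" using \<pi> sf_powi[OF A] by auto
    have "w (y * \<pi> powi (- v y)) = 0"
      using y p \<pi> by (intro zero) (simp_all add: sf_mult[OF A] pv_mult[OF v A y(1) p(1)] pv_powi[OF v A])
    then show ?thesis using y p \<pi> by (simp add: pv_mult[OF w A y(1) p(1)] pv_powi[OF w A])
  qed
  obtain y where y: "y \<in> A" "y \<noteq> 0" "w y = 1" using pv_surj[OF w A, of 1] by blast
  have "v y * w \<pi> = 1" using *[OF y(1,2)] y(3) by simp
  moreover have "w \<pi> \<ge> 0" using le[OF \<pi>(1,2)] \<pi>(3) by simp
  ultimately have "w \<pi> = 1" by (metis pos_zmult_eq_1_iff_lemma zmult_eq_1_iff abs_of_nonneg one_neq_neg_one zero_le_one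
        dual_order.antisym not_one_le_zero linorder_not_le neg_less_0_iff_less zero_less_one)
  then show ?thesis using *[OF x] by simp
qed

text \<open>Neither valuation ring contains the other, so there are elements distinguishing them in
  either direction; the quotient of two such elements has strict signs for both.\<close>

lemma prime_valuation_separation:
  assumes A: "subfield A Amb" and v: "prime_valuation A v" and w: "prime_valuation A w"
    and ne: "\<exists>x\<in>A - {0}. w x \<noteq> v x"
  shows "\<exists>x\<in>A - {0}. v x > 0 \<and> w x < 0"
proof -
  obtain a where a: "a \<in> A" "a \<noteq> 0" "v a \<ge> 0" "w a < 0"
    using prime_valuation_eqI[OF A v w] ne by (metis DiffE insertI1 linorder_not_le)
  obtain b where b: "b \<in> A" "b \<noteq> 0" "w b \<ge> 0" "v b < 0"
    using prime_valuation_eqI[OF A w v] ne by (metis DiffE insertI1 linorder_not_le)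
  have i: "inverse b \<in> A" "inverse b \<noteq> 0" using b sf_inverse[OF A] by auto
  have "v (a * inverse b) = v a - v b" "w (a * inverse b) = w a - w b"
    using pv_mult[OF v A a(1) i(1) a(2) i(2)] pv_mult[OF w A a(1) i(1) a(2) i(2)] pv_inverse[OF v A b(1,2)] pv_inverse[OF w A b(1,2)] by auto
  moreover have "a * inverse b \<in> A - {0}" using a i sf_mult[OF A] by auto
  ultimately show ?thesis using a b by (intro bexI[of _ "a * inverse b"]) auto
qed

text \<open>For a family of roots permuted by the Galois group this shows that the coefficients of
  the polynomial are fixed, hence lie in the base field.\<close>

lemma coeff_prod_linear_hom:
  fixes a :: "'i \<Rightarrow> 'b::field" and \<tau> :: "'b \<Rightarrow> 'b"
  assumes K: "subfield K Amb" and a: "\<And>i. i \<in> I \<Longrightarrow> a i \<in> K"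
    and hom: "\<And>x y. x \<in> K \<Longrightarrow> y \<in> K \<Longrightarrow> \<tau> (x + y) = \<tau> x + \<tau> y" "\<And>x y. x \<in> K \<Longrightarrow> y \<in> K \<Longrightarrow> \<tau> (x * y) = \<tau> x * \<tau> y"
      "\<tau> 1 = 1"
  shows "Polynomial.coeff (\<Prod>i\<in>I. [:- a i, 1:]) n \<in> K \<and>
    \<tau> (Polynomial.coeff (\<Prod>i\<in>I. [:- a i, 1:]) n) = Polynomial.coeff (\<Prod>i\<in>I. [:- \<tau> (a i), 1:]) n"
proof -
  have "\<tau> 0 + \<tau> 0 = \<tau> 0 + 0" using hom(1)[OF sf_0[OF K] sf_0[OF K]] by simp
  then have h0: "\<tau> 0 = 0" by (simp only: add_left_cancel)
  show ?thesis
    using a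
  proof (induction I arbitrary: n rule: infinite_finite_induct)
    case (insert i I)
    have hm: "\<tau> (- x) = - \<tau> x" if "x \<in> K" for x
      using hom(1)[of x "- x"] that sf_uminus[OF K that] h0 by (simp add: add_eq_0_iff)
    let ?c = "Polynomial.coeff (\<Prod>i\<in>I. [:- a i, 1:])" and ?d = "Polynomial.coeff (\<Prod>i\<in>I. [:- \<tau> (a i), 1:])"
    have IH: "?c n \<in> K" "\<tau> (?c n) = ?d n" for n using insert.IH insert.prems by auto
    have ai: "a i \<in> K" "- a i \<in> K" using insert.prems sf_uminus[OF K] by auto
    have cf: "Polynomial.coeff ([:- b, 1:] * p) n = - b * Polynomial.coeff p n + (case n of 0 \<Rightarrow> 0 | Suc k \<Rightarrow> Polynomial.coeff p k)"
      for b :: 'b and p n by (simp add: coeff_pCons split: nat.splits)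
    show ?case
    proof (cases n)
      case 0
      have "- a i * ?c 0 \<in> K" using ai IH by (intro sf_mult[OF K])
      then show ?thesis unfolding 0 prod.insert[OF insert.hyps] cf using hom(2)[OF ai(2) IH(1)] IH hm[OF ai(1)] by simp
    next
      case (Suc k)
      have m: "- a i * ?c n \<in> K" using ai IH by (intro sf_mult[OF K])
      have "- a i * ?c n + ?c k \<in> K" using m IH by (intro sf_add[OF K])
      moreover have "\<tau> (- a i * ?c n + ?c k) = - \<tau> (a i) * ?d n + ?d k"
        using hom(1)[OF m IH(1)[of k]] hom(2)[OF ai(2) IH(1)[of n]] IH(2) hm[OF ai(1)] by simp
      ultimately show ?thesis unfolding prod.insert[OF insert.hyps] cf Suc by (simp add: Suc)
    qed
  qed (use h0 hom(3) sf_0[OF K] sf_1[OF K] in \<open>auto simp: coeff_1\<close>)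
qed

locale galois_ext =
  fixes K :: "'a::{field,finite} kbar set"
  assumes ext: "finite_abelian_extension K k_field"
begin

lemma subfield_K: "subfield K Amb" and k_K: "k_field \<subseteq> K" and finite_dim: "ring.finite_dimension Amb k_field K"
  and fixed_k: "fixed_field K (Gal K k_field) = k_field"
  using ext by (auto simp: finite_abelian_extension_def)

abbreviation "\<Gamma> \<equiv> Gal K k_field"

lemma Gal_hom:
  assumes "\<sigma> \<in> \<Gamma>"
  shows "x \<in> K \<Longrightarrow> \<sigma> x \<in> K" "x \<in> K \<Longrightarrow> y \<in> K \<Longrightarrow> \<sigma> (x + y) = \<sigma> x + \<sigma> y"
    "x \<in> K \<Longrightarrow> y \<in> K \<Longrightarrow> \<sigma> (x * y) = \<sigma> x * \<sigma> y" "\<sigma> 1 = 1" "bij_betw \<sigma> K K" "x \<in> k_field \<Longrightarrow> \<sigma> x = x"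
proof -
  have "\<sigma> \<in> ring_iso (Amb\<lparr>carrier := K\<rparr>) (Amb\<lparr>carrier := K\<rparr>)" and f: "\<And>x. x \<in> k_field \<Longrightarrow> \<sigma> x = x"
    using assms by (auto simp: Gal_def)
  then have h: "\<sigma> \<in> ring_hom (Amb\<lparr>carrier := K\<rparr>) (Amb\<lparr>carrier := K\<rparr>)" and b: "bij_betw \<sigma> K K"
    by (auto simp: ring_iso_def)
  show "x \<in> K \<Longrightarrow> \<sigma> x \<in> K" "x \<in> K \<Longrightarrow> y \<in> K \<Longrightarrow> \<sigma> (x + y) = \<sigma> x + \<sigma> y"
    "x \<in> K \<Longrightarrow> y \<in> K \<Longrightarrow> \<sigma> (x * y) = \<sigma> x * \<sigma> y" "\<sigma> 1 = 1"
    using ring_hom_memE[OF h] by auto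
  show "bij_betw \<sigma> K K" by (rule b)
  show "x \<in> k_field \<Longrightarrow> \<sigma> x = x" by (rule f)
qed

lemma GalI:
  assumes "\<And>x. x \<in> K \<Longrightarrow> \<sigma> x \<in> K" "\<And>x y. x \<in> K \<Longrightarrow> y \<in> K \<Longrightarrow> \<sigma> (x + y) = \<sigma> x + \<sigma> y"
    "\<And>x y. x \<in> K \<Longrightarrow> y \<in> K \<Longrightarrow> \<sigma> (x * y) = \<sigma> x * \<sigma> y" "\<sigma> 1 = 1" "bij_betw \<sigma> K K" "\<And>x. x \<in> k_field \<Longrightarrow> \<sigma> x = x"
  shows "\<sigma> \<in> \<Gamma>"
  unfolding Gal_def ring_iso_def ring_hom_def using assms by auto

lemma Gal_id: "(\<lambda>x. x) \<in> \<Gamma>"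
  by (rule GalI) (auto simp: bij_betw_def inj_on_def)

lemma Gal_comp: "\<sigma> \<in> \<Gamma> \<Longrightarrow> \<tau> \<in> \<Gamma> \<Longrightarrow> (\<lambda>x. \<sigma> (\<tau> x)) \<in> \<Gamma>"
proof -
  assume s: "\<sigma> \<in> \<Gamma>" and t: "\<tau> \<in> \<Gamma>"
  have "bij_betw (\<sigma> \<circ> \<tau>) K K" by (rule bij_betw_trans[OF Gal_hom(5)[OF t] Gal_hom(5)[OF s]])
  then show ?thesis
    by (intro GalI) (simp_all add: Gal_hom[OF s] Gal_hom[OF t] o_def)
qed

lemma Gal_inv: 
  assumes s: "\<sigma> \<in> \<Gamma>"
  shows "inv_into K \<sigma> \<in> \<Gamma>" "x \<in> K \<Longrightarrow> \<sigma> (inv_into K \<sigma> x) = x" "x \<in> K \<Longrightarrow> inv_into K \<sigma> (\<sigma> x) = x"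
proof -
  note b = Gal_hom(5)[OF s]
  have r: "\<sigma> (inv_into K \<sigma> x) = x" "inv_into K \<sigma> x \<in> K" if "x \<in> K" for x
    using b that by (auto simp: bij_betw_def intro: f_inv_into_f inv_into_into)
  have l: "inv_into K \<sigma> (\<sigma> x) = x" if "x \<in> K" for x
    using b that by (auto simp: bij_betw_def)
  show "x \<in> K \<Longrightarrow> \<sigma> (inv_into K \<sigma> x) = x" "x \<in> K \<Longrightarrow> inv_into K \<sigma> (\<sigma> x) = x" using r l by auto
  have eqI: "inv_into K \<sigma> y = x" if "x \<in> K" "\<sigma> x = y" for x y using l that by blast
  show "inv_into K \<sigma> \<in> \<Gamma>"
  proof (rule GalI)
    show "bij_betw (inv_into K \<sigma>) K K" by (rule bij_betw_inv_into[OF b])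
    fix x y assume "x \<in> K" "y \<in> K"
    then show "inv_into K \<sigma> (x + y) = inv_into K \<sigma> x + inv_into K \<sigma> y" "inv_into K \<sigma> (x * y) = inv_into K \<sigma> x * inv_into K \<sigma> y"
      using r Gal_hom[OF s] sf_add[OF subfield_K] sf_mult[OF subfield_K] by (auto intro!: eqI)
  qed (use r eqI Gal_hom(4,6)[OF s] sf_1[OF subfield_K] k_K in auto)
qed

lemma Gal_0: "\<sigma> \<in> \<Gamma> \<Longrightarrow> \<sigma> 0 = 0"
proof -
  assume s: "\<sigma> \<in> \<Gamma>"
  have "\<sigma> 0 + \<sigma> 0 = \<sigma> 0 + 0" using Gal_hom(2)[OF s sf_0[OF subfield_K] sf_0[OF subfield_K]] by simp
  then show "\<sigma> 0 = 0" by (simp only: add_left_cancel)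
qed

lemma Gal_nonzero: "\<sigma> \<in> \<Gamma> \<Longrightarrow> x \<in> K \<Longrightarrow> x \<noteq> 0 \<Longrightarrow> \<sigma> x \<noteq> 0"
  using Gal_inv(3)[of \<sigma> x] Gal_inv(3)[of \<sigma> 0] Gal_0 sf_0[OF subfield_K] by metis

text \<open>Members of \<open>Gal\<close> are unconstrained outside \<open>K\<close>, so one
  automorphism occurs as many functions; restriction to \<open>K\<close> leaves one function for
  each and so makes the group finite.\<close>

definition G :: "('a kbar \<Rightarrow> 'a kbar) set"
  where "G = (\<lambda>\<sigma>. restrict \<sigma> K) ` \<Gamma>"

lemma Gal_eq_on_Span:
  assumes s: "\<sigma> \<in> \<Gamma>" and t: "\<tau> \<in> \<Gamma>" and "set Us \<subseteq> K" "\<And>u. u \<in> set Us \<Longrightarrow> \<sigma> u = \<tau> u"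
  shows "\<forall>x\<in>Amb.Span k_field Us. x \<in> K \<and> \<sigma> x = \<tau> x"
  using assms(3,4)
proof (induction Us)
  case Nil
  then show ?case using Gal_0[OF s] Gal_0[OF t] sf_0[OF subfield_K] by simp
next
  case (Cons u Us)
  show ?case
  proof
    fix x assume "x \<in> Amb.Span k_field (u # Us)"
    then obtain c y where c: "c \<in> k_field" "y \<in> Amb.Span k_field Us" "x = c * u + y"
      by (auto simp: Amb.line_extension_mem_iff)
    have y: "y \<in> K" "\<sigma> y = \<tau> y" using Cons c(2) by auto
    have u: "u \<in> K" "\<sigma> u = \<tau> u" "c \<in> K" using Cons.prems c(1) k_K by auto
    then have "c * u \<in> K" using sf_mult[OF subfield_K] by auto
    then show "x \<in> K \<and> \<sigma> x = \<tau> x" unfolding c(3)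
      using y u Gal_hom[OF s] Gal_hom[OF t] c(1) sf_add[OF subfield_K] by auto
  qed
qed

text \<open>An automorphism is determined by its values on a finite spanning list, and each value is
  a root of a polynomial over \<open>k_field\<close>.\<close>

lemma finite_G: "finite G"
proof -
  obtain n where "Amb.dimension n k_field K" using finite_dim by (auto simp: Amb.finite_dimension_def)
  then obtain Us where Us: "set Us \<subseteq> UNIV" "Amb.Span k_field Us = K"
    using Amb.exists_base[OF subfield_k] by auto
  have UK: "set Us \<subseteq> K" using Amb.Span_base_incl[OF subfield_k, of Us] Us by auto
  obtain p where p: "\<And>x :: 'a kbar. p x \<noteq> 0" "\<And>x i. Polynomial.coeff (p x) i \<in> k_field" "\<And>x. poly (p x) x = 0"
    using kbar_algebraic by metis
  define F where "F = (\<lambda>g :: 'a kbar \<Rightarrow> 'a kbar. restrict g (set Us))"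
  have "F g \<in> PiE (set Us) (\<lambda>u. {y. poly (p u) y = 0})" if g: "g \<in> G" for g
  proof -
    obtain \<sigma> where s: "\<sigma> \<in> \<Gamma>" "g = restrict \<sigma> K" using g by (auto simp: G_def)
    have "poly (p u) (\<sigma> u) = 0" if u: "u \<in> K" for u
    proof -
      have pw: "\<sigma> (u ^ i) = \<sigma> u ^ i" for i
        using Gal_hom[OF s(1)] u sf_power[OF subfield_K u] by (induction i) auto
      have trm: "Polynomial.coeff (p u) i * u ^ i \<in> K" for i using p(2) k_K sf_power[OF subfield_K u] by (intro sf_mult[OF subfield_K]) auto
      have sm: "\<sigma> (\<Sum>i\<in>I. Polynomial.coeff (p u) i * u ^ i) = (\<Sum>i\<in>I. \<sigma> (Polynomial.coeff (p u) i * u ^ i))" for I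
        by (induction I rule: infinite_finite_induct) (auto simp: Gal_0[OF s(1)] Gal_hom(2)[OF s(1)] trm sf_sum[OF subfield_K])
      have tr: "\<sigma> (Polynomial.coeff (p u) i * u ^ i) = Polynomial.coeff (p u) i * \<sigma> u ^ i" for i
        using Gal_hom(3)[OF s(1), of "Polynomial.coeff (p u) i" "u ^ i"] Gal_hom(6)[OF s(1) p(2)] subsetD[OF k_K p(2)] sf_power[OF subfield_K u] pw
        by simp
      have "poly (p u) (\<sigma> u) = \<sigma> (poly (p u) u)" unfolding poly_altdef sm tr ..
      then show ?thesis using p(3) Gal_0[OF s(1)] by simp
    qed
    then show ?thesis using UK by (auto simp: F_def s(2))
  qed
  then have "F ` G \<subseteq> PiE (set Us) (\<lambda>u. {y. poly (p u) y = 0})" by blast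
  moreover have "finite (PiE (set Us) (\<lambda>u. {y. poly (p u) y = 0}))"
    using p(1) by (intro finite_PiE poly_roots_finite) auto
  moreover have "inj_on F G"
  proof (rule inj_onI)
    fix g h assume g: "g \<in> G" and h: "h \<in> G" and e: "F g = F h"
    obtain \<sigma> where s: "\<sigma> \<in> \<Gamma>" "g = restrict \<sigma> K" using g by (auto simp: G_def)
    obtain \<tau> where t: "\<tau> \<in> \<Gamma>" "h = restrict \<tau> K" using h by (auto simp: G_def)
    have "\<sigma> u = \<tau> u" if "u \<in> set Us" for u
      using fun_cong[OF e, of u] that UK s t by (auto simp: F_def)
    then have "\<forall>x\<in>K. \<sigma> x = \<tau> x" using Gal_eq_on_Span[OF s(1) t(1) UK] Us(2) by auto
    then show "g = h" unfolding s t by (intro restrict_ext) auto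
  qed
  ultimately show ?thesis using finite_subset finite_imageD by metis
qed

lemma G_Gal: "g \<in> G \<Longrightarrow> g \<in> \<Gamma>"
proof -
  assume "g \<in> G"
  then obtain \<sigma> where s: "\<sigma> \<in> \<Gamma>" "g = restrict \<sigma> K" by (auto simp: G_def)
  have "bij_betw g K K" using bij_betw_cong[of K g \<sigma> K] Gal_hom(5)[OF s(1)] s(2) by auto
  then show "g \<in> \<Gamma>"
    using s Gal_hom[OF s(1)] k_K sf_1[OF subfield_K]
    by (intro GalI) (auto simp: sf_add[OF subfield_K] sf_mult[OF subfield_K])
qed

lemma G_id: "restrict (\<lambda>x. x) K \<in> G"
  using Gal_id by (auto simp: G_def)

lemma G_translate:
  assumes t: "\<tau> \<in> \<Gamma>"
  shows "bij_betw (\<lambda>g. restrict (\<lambda>x. \<tau> (g x)) K) G G"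
proof -
  let ?f = "\<lambda>g. restrict (\<lambda>x. \<tau> (g x)) K"
  have into: "?f ` G \<subseteq> G" using Gal_comp[OF t] G_Gal by (auto simp: G_def)
  have "inj_on ?f G"
  proof (rule inj_onI)
    fix g h assume g: "g \<in> G" and h: "h \<in> G" and e: "?f g = ?f h"
    have "g x = h x" if x: "x \<in> K" for x
    proof -
      have "\<tau> (g x) = \<tau> (h x)" using fun_cong[OF e, of x] x by simp
      then show ?thesis using Gal_inv(3)[OF t] Gal_hom(1)[OF G_Gal[OF g] x] Gal_hom(1)[OF G_Gal[OF h] x] by metis
    qed
    moreover have "g \<in> extensional K" "h \<in> extensional K" using g h by (auto simp: G_def)
    ultimately show "g = h" using extensionalityI by blast
  qed
  then show ?thesis using endo_inj_surj[OF finite_G into] by (simp add: bij_betw_def)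
qed

lemma orbit_prod_reindex: "\<tau> \<in> \<Gamma> \<Longrightarrow> x \<in> K \<Longrightarrow> (\<Prod>g\<in>G. f (\<tau> (g x))) = (\<Prod>g\<in>G. f (g x))"
  for f :: "'a kbar \<Rightarrow> 'b::comm_monoid_mult"
  using prod.reindex_bij_betw[OF G_translate, of \<tau> "\<lambda>g. f (g x)"] by simp

lemma norm_in_k:
  assumes x: "x \<in> K"
  shows "(\<Prod>g\<in>G. g x) \<in> k_field"
proof -
  have gx: "g x \<in> K" if "g \<in> G" for g using Gal_hom(1)[OF G_Gal[OF that] x] .
  have "\<tau> (\<Prod>g\<in>G. g x) = (\<Prod>g\<in>G. g x)" if t: "\<tau> \<in> \<Gamma>" for \<tau>
  proof -
    have "\<tau> (\<Prod>g\<in>H. g x) = (\<Prod>g\<in>H. \<tau> (g x))" if "H \<subseteq> G" "finite H" for H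
      using that(2,1)
      by (induction H rule: finite_induct) (auto simp: Gal_hom(3,4)[OF t] gx sf_prod[OF subfield_K] subset_iff)
    then show ?thesis using finite_G orbit_prod_reindex[OF t x, of "\<lambda>y. y"] by simp
  qed
  moreover have "(\<Prod>g\<in>G. g x) \<in> K" using gx by (intro sf_prod[OF subfield_K])
  ultimately have "(\<Prod>g\<in>G. g x) \<in> fixed_field K \<Gamma>" by (simp add: fixed_field_def)
  then show ?thesis using fixed_k by simp
qed

text \<open>\<open>K\<close> is normal: a \<open>k\<close>-homomorphism defined on a larger field permutes the conjugates of \<open>x\<close>.\<close>

lemma hom_image_in_K:
  assumes x: "x \<in> K" and L: "subfield L Amb" "K \<subseteq> L"
    and hom: "\<And>y z. y \<in> L \<Longrightarrow> z \<in> L \<Longrightarrow> \<phi> (y + z) = \<phi> y + \<phi> z" "\<And>y z. y \<in> L \<Longrightarrow> z \<in> L \<Longrightarrow> \<phi> (y * z) = \<phi> y * \<phi> z"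
      "\<And>y. y \<in> k_field \<Longrightarrow> \<phi> y = y"
  shows "\<phi> x \<in> K"
proof -
  define P where "P = (\<Prod>g\<in>G. [:- g x, 1:])"
  have gx: "g x \<in> K" if "g \<in> G" for g using Gal_hom(1)[OF G_Gal[OF that] x] .
  have ck: "Polynomial.coeff P n \<in> k_field" for n
  proof -
    have "Polynomial.coeff P n \<in> K \<and> \<tau> (Polynomial.coeff P n) = Polynomial.coeff P n" if t: "\<tau> \<in> \<Gamma>" for \<tau>
    proof -
      have "(\<Prod>g\<in>G. [:- \<tau> (g x), 1:]) = P" unfolding P_def by (rule orbit_prod_reindex[OF t x, of "\<lambda>y. [:- y, 1:]"])
      moreover have "Polynomial.coeff (\<Prod>g\<in>G. [:- g x, 1:]) n \<in> K \<and>
        \<tau> (Polynomial.coeff (\<Prod>g\<in>G. [:- g x, 1:]) n) = Polynomial.coeff (\<Prod>g\<in>G. [:- \<tau> (g x), 1:]) n"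
        by (rule coeff_prod_linear_hom[OF subfield_K]) (use gx Gal_hom[OF t] in auto)
      ultimately show ?thesis by (simp add: P_def)
    qed
    then have "Polynomial.coeff P n \<in> fixed_field K \<Gamma>" using Gal_id by (auto simp: fixed_field_def)
    then show ?thesis using fixed_k by simp
  qed
  have xL: "x \<in> L" using x L by auto
  have k1: "(1 :: 'a kbar) \<in> k_field" "(0 :: 'a kbar) \<in> k_field" using subfield_k by (auto intro: sf_intros)
  have pw: "\<phi> (x ^ i) = \<phi> x ^ i" for i
    using hom(2)[OF xL sf_power[OF L(1) xL]] hom(3)[OF k1(1)] by (induction i) auto
  have trm: "Polynomial.coeff P i * x ^ i \<in> L" for i using ck k_K L(2) sf_power[OF L(1) xL] by (intro sf_mult[OF L(1)]) auto
  have sm: "\<phi> (\<Sum>i\<in>I. Polynomial.coeff P i * x ^ i) = (\<Sum>i\<in>I. \<phi> (Polynomial.coeff P i * x ^ i))" for I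
    by (induction I rule: infinite_finite_induct) (auto simp: hom(3)[OF k1(2)] hom(1) trm sf_sum[OF L(1)])
  have tr: "\<phi> (Polynomial.coeff P i * x ^ i) = Polynomial.coeff P i * \<phi> x ^ i" for i
    using hom(2)[of "Polynomial.coeff P i" "x ^ i"] hom(3)[OF ck] subsetD[OF L(2) subsetD[OF k_K ck]] sf_power[OF L(1) xL] pw by simp
  have "poly P (\<phi> x) = \<phi> (poly P x)" unfolding poly_altdef sm tr ..
  also have "poly P x = 0"
    using finite_G G_id x by (auto simp: P_def poly_prod intro!: prod_zero bexI[of _ "restrict (\<lambda>x. x) K"])
  finally have "poly P (\<phi> x) = 0" using hom(3)[OF k1(2)] by simp
  then have "\<exists>g\<in>G. \<phi> x = g x" using finite_G by (auto simp: P_def poly_prod)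
  then show ?thesis using gx by auto
qed

lemma infinite_prime_comp:
  assumes v: "infinite_prime K v" and s: "\<sigma> \<in> \<Gamma>"
  shows "infinite_prime K (\<lambda>x. v (\<sigma> x))"
proof -
  have pv: "prime_valuation K v" using v by (simp add: infinite_prime_def)
  have img: "\<sigma> x \<in> K - {0}" if "x \<in> K - {0}" for x using that Gal_hom(1)[OF s] Gal_nonzero[OF s] by auto
  have "prime_valuation K (\<lambda>x. v (\<sigma> x))"
    unfolding prime_valuation_def
  proof (intro conjI ballI impI)
    fix x y assume xy: "x \<in> K - {0}" "y \<in> K - {0}"
    show "v (\<sigma> (x * y)) = v (\<sigma> x) + v (\<sigma> y)"
      using xy img[OF xy(1)] img[OF xy(2)] Gal_hom(3)[OF s, of x y] pv_mult[OF pv subfield_K] by auto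
    assume "x + y \<noteq> 0"
    then have "\<sigma> (x + y) \<noteq> 0" using Gal_nonzero[OF s] xy sf_add[OF subfield_K] by auto
    then show "v (\<sigma> (x + y)) \<ge> min (v (\<sigma> x)) (v (\<sigma> y))"
      using xy img[OF xy(1)] img[OF xy(2)] Gal_hom(2)[OF s, of x y] pv_add[OF pv subfield_K, of "\<sigma> x" "\<sigma> y"] by auto
  next
    have "\<sigma> ` (K - {0}) = K - {0}"
    proof
      show "K - {0} \<subseteq> \<sigma> ` (K - {0})"
      proof
        fix y assume y: "y \<in> K - {0}"
        then have "inv_into K \<sigma> y \<in> K - {0}" 
          using Gal_hom(1)[OF Gal_inv(1)[OF s]] Gal_nonzero[OF Gal_inv(1)[OF s]] by auto
        then show "y \<in> \<sigma> ` (K - {0})" using Gal_inv(2)[OF s, of y] y by (metis DiffE imageI)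
      qed
    qed (use img in auto)
    then show "(\<lambda>x. v (\<sigma> x)) ` (K - {0}) = UNIV"
      using pv unfolding prime_valuation_def by (metis image_image)
  qed
  moreover have "lies_over (\<lambda>x. v (\<sigma> x)) k_field inf_val"
    using v Gal_hom(6)[OF s] by (auto simp: infinite_prime_def lies_over_def has_ram_index_def)
  ultimately show ?thesis by (simp add: infinite_prime_def)
qed

text \<open>If the primes were not conjugate, weak approximation would give an \<open>x\<close> with
  all \<open>v (g x)\<close> positive and all \<open>w (g x)\<close> negative. Its norm lies in
  \<open>k_field\<close>, where \<open>v\<close> and \<open>w\<close> are positive multiples of
  \<open>inf_val\<close> and cannot differ in sign.\<close>

theorem infinite_primes_conjugate:
  assumes v: "infinite_prime K v" and w: "infinite_prime K w"
  shows "\<exists>\<sigma>\<in>\<Gamma>. \<forall>x\<in>K. x \<noteq> 0 \<longrightarrow> w x = v (\<sigma> x)"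
proof (rule ccontr)
  assume no: "\<not> ?thesis"
  \<comment> \<open>Separation is needed for every pair of conjugates; a coincidence between two of
    them would transport back to one between \<open>w\<close> and a conjugate of
    \<open>v\<close>.\<close>
  have diff: "\<exists>x\<in>K - {0}. v (g x) \<noteq> w (h x)" if g: "g \<in> G" and h: "h \<in> G" for g h
  proof (rule ccontr)
    assume "\<not> ?thesis"
    then have eq: "\<And>x. x \<in> K - {0} \<Longrightarrow> v (g x) = w (h x)" by blast
    note h' = G_Gal[OF h]
    have *: "w x = v (g (inv_into K h x))" if x: "x \<in> K" "x \<noteq> 0" for x
    proof -
      have "inv_into K h x \<in> K - {0}"
        using Gal_hom(1)[OF Gal_inv(1)[OF h'] x(1)] Gal_nonzero[OF Gal_inv(1)[OF h'] x] by simp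
      then show ?thesis using eq[of "inv_into K h x"] Gal_inv(2)[OF h' x(1)] by simp
    qed
    have "\<exists>\<sigma>\<in>\<Gamma>. \<forall>x\<in>K. x \<noteq> 0 \<longrightarrow> w x = v (\<sigma> x)"
      by (rule bexI[OF _ Gal_comp[OF G_Gal[OF g] Gal_inv(1)[OF h']]]) (use * in simp)
    with no show False by contradiction
  qed
  \<comment> \<open>The approximation lemmas speak of absolute values, so each conjugate is replaced
    by one. Only signs are read off afterwards, so the different exponents \<open>e\<close> do no
    harm.\<close>
  have av: "\<exists>N e. absval N \<and> e > 0 \<and> (\<forall>x\<in>K - {0}. N x = 2 powr (- real_of_int (u (g x)) / real e))"
    if u: "infinite_prime K u" and g: "g \<in> G" for u g
  proof -
    obtain N e where "inf_absval N" "e > 0" "\<And>x. x \<in> K \<Longrightarrow> x \<noteq> 0 \<Longrightarrow> N x = 2 powr (- real_of_int (u (g x)) / real e)"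
      using infinite_prime_absval[OF infinite_prime_comp[OF u G_Gal[OF g]] subfield_K k_K] by metis
    then show ?thesis unfolding inf_absval_def by blast
  qed
  have "\<forall>g\<in>G. \<exists>N e. absval N \<and> e > 0 \<and> (\<forall>x\<in>K - {0}. N x = 2 powr (- real_of_int (v (g x)) / real e))"
    using av[OF v] by blast
  then obtain p ep where p: "\<And>g. g \<in> G \<Longrightarrow> absval (p g)" "\<And>g. g \<in> G \<Longrightarrow> ep g > (0 :: nat)"
    "\<And>g x. g \<in> G \<Longrightarrow> x \<in> K - {0} \<Longrightarrow> p g x = 2 powr (- real_of_int (v (g x)) / real (ep g))" by metis
  have "\<forall>g\<in>G. \<exists>N e. absval N \<and> e > 0 \<and> (\<forall>x\<in>K - {0}. N x = 2 powr (- real_of_int (w (g x)) / real e))"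
    using av[OF w] by blast
  then obtain q eq where q: "\<And>g. g \<in> G \<Longrightarrow> absval (q g)" "\<And>g. g \<in> G \<Longrightarrow> eq g > (0 :: nat)"
    "\<And>g x. g \<in> G \<Longrightarrow> x \<in> K - {0} \<Longrightarrow> q g x = 2 powr (- real_of_int (w (g x)) / real (eq g))" by metis
  have pos: "p g x < 1 \<longleftrightarrow> v (g x) > 0" if "g \<in> G" "x \<in> K - {0}" for g x
    using p(2)[OF that(1)] powr_less_cancel_iff[of 2 "- real_of_int (v (g x)) / real (ep g)" 0]
    unfolding p(3)[OF that] by (simp add: zero_less_divide_iff)
  have neg: "q g x > 1 \<longleftrightarrow> w (g x) < 0" if "g \<in> G" "x \<in> K - {0}" for g x
    using q(2)[OF that(1)] powr_less_cancel_iff[of 2 0 "- real_of_int (w (g x)) / real (eq g)"]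
    unfolding q(3)[OF that] by (simp add: divide_less_0_iff)
  have Gne: "G \<noteq> {}" using G_id by blast
  have "\<exists>x\<in>K. (\<forall>g\<in>G. p g x < 1) \<and> (\<forall>g\<in>G. q g x > 1)"
  proof (rule simultaneous_separation[OF subfield_K finite_G finite_G p(1) q(1) _ Gne Gne])
    fix g h assume g: "g \<in> G" and h: "h \<in> G"
    have pv: "prime_valuation K (\<lambda>x. v (g x))" "prime_valuation K (\<lambda>x. w (h x))"
      using infinite_prime_comp[OF v G_Gal[OF g]] infinite_prime_comp[OF w G_Gal[OF h]] by (simp_all add: infinite_prime_def)
    have "\<exists>x\<in>K - {0}. v (g x) > 0 \<and> w (h x) < 0"
      by (rule prime_valuation_separation[OF subfield_K pv]) (use diff[OF g h] in metis)
    then show "\<exists>x\<in>K. p g x < 1 \<and> q h x > 1" using pos[OF g] neg[OF h] by auto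
  qed
  then obtain x where x: "x \<in> K" "\<And>g. g \<in> G \<Longrightarrow> p g x < 1" "\<And>g. g \<in> G \<Longrightarrow> q g x > 1" by blast
  have x0: "x \<noteq> 0" using x(3)[OF G_id] absval.N_0[OF q(1)[OF G_id]] by auto
  have vx: "v (g x) > 0" "w (g x) < 0" if "g \<in> G" for g using pos[OF that] neg[OF that] x that x0 by auto
  define y where "y = (\<Prod>g\<in>G. g x)"
  have yk: "y \<in> k_field" unfolding y_def by (rule norm_in_k[OF x(1)])
  have gx: "g x \<in> K" "g x \<noteq> 0" if "g \<in> G" for g
    using Gal_hom(1)[OF G_Gal[OF that] x(1)] Gal_nonzero[OF G_Gal[OF that] x(1) x0] by auto
  have y0: "y \<noteq> 0" unfolding y_def using gx finite_G by simp
  have vprod: "u (\<Prod>g\<in>H. g x) = (\<Sum>g\<in>H. u (g x))" if u: "prime_valuation K u" and H: "finite H" "H \<subseteq> G" for u H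
    using H
  proof (induction H rule: finite_induct)
    case (insert g H)
    have "(\<Prod>g\<in>H. g x) \<in> K" "(\<Prod>g\<in>H. g x) \<noteq> 0" using insert gx by (auto intro!: sf_prod[OF subfield_K])
    then show ?case using insert gx pv_mult[OF u subfield_K, of "g x" "\<Prod>g\<in>H. g x"] by auto
  qed (simp add: pv_1[OF u subfield_K])
  have vy: "v y > 0" unfolding y_def using v vx(1) finite_G Gne by (subst vprod) (auto simp: infinite_prime_def intro!: sum_pos)
  have "(\<Sum>g\<in>G. - w (g x)) > 0" using vx(2) finite_G Gne by (intro sum_pos) auto
  then have wy: "w y < 0" unfolding y_def using w finite_G by (subst vprod) (auto simp: infinite_prime_def sum_negf)
  obtain e1 where "e1 > 0" "v y = int e1 * inf_val y"
    using v yk y0 by (auto simp: infinite_prime_def lies_over_def has_ram_index_def)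
  then have "inf_val y > 0" using vy by (simp add: zero_less_mult_iff)
  moreover obtain e2 where "e2 > 0" "w y = int e2 * inf_val y"
    using w yk y0 by (auto simp: infinite_prime_def lies_over_def has_ram_index_def)
  ultimately show False using wy by (simp add: mult_less_0_iff)
qed

end

section \<open>Inertia degrees as logarithms of cardinalities\<close>

lemma (in ring) card_Span_independent:
  assumes K: "subfield K R" and ind: "independent K Us" and fin: "finite K"
  shows "card (Span K Us) = card K ^ length Us"
proof -
  let ?L = "{Ks. set Ks \<subseteq> K \<and> length Ks = length Us}"
  have Us: "set Us \<subseteq> carrier R" using independent_in_carrier[OF ind] .
  have img: "(\<lambda>Ks. combine Ks Us) ` ?L = Span K Us"
    using Span_eq_combine_set_length_version[OF K Us] by blast
  have "inj_on (\<lambda>Ks. combine Ks Us) ?L"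
  proof (rule inj_onI)
    fix Ks Ks' assume *: "Ks \<in> ?L" "Ks' \<in> ?L" "combine Ks Us = combine Ks' Us"
    then have "combine Ks Us \<in> Span K Us" using img by blast
    from unique_decomposition[OF K ind this] show "Ks = Ks'" using * by auto
  qed
  then have "card (Span K Us) = card ?L" using card_image img by metis
  then show ?thesis using card_lists_length_eq[OF fin] by simp
qed

text \<open>\<open>inertia_degree\<close> is a \<open>dim\<close>; over a finite field it is the
  exponent that relates two cardinalities, so residue degrees can be obtained by counting.\<close>

lemma (in ring) card_eq_power_dim:
  assumes K: "subfield K R" and fin: "finite (carrier R)"
  shows "card (carrier R) = card K ^ dim K (carrier R)"
proof -
  have finK: "finite K" using subfieldE(3)[OF K] fin finite_subset by blast
  obtain Us where Us: "set Us = carrier R" using finite_list[OF fin] by blast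
  then have "Span K Us = carrier R" using Span_base_incl[OF K] Span_in_carrier[OF subfieldE(3)[OF K]] by blast
  then obtain Vs where Vs: "independent K Vs" "Span K Vs = carrier R" using filter_base[OF K] Us by (metis order_refl)
  have "dimension (length Vs) K (carrier R)" using dimension_independent[OF Vs(1)] Vs(2) by simp
  from dimI[OF K this] have "dim K (carrier R) = length Vs" by (simp add: over_def)
  then show ?thesis using card_Span_independent[OF K Vs(1) finK] Vs(2) by simp
qed

context inf_absval
begin

text \<open>The base \<open>r\<close> is left open, because on a subfield the same \<open>N\<close>
  belongs to a valuation with another base, a power of \<open>r\<close>.\<close>

definition assoc :: "'a kbar set \<Rightarrow> ('a kbar \<Rightarrow> int) \<Rightarrow> bool"
  where "assoc A v \<longleftrightarrow> (\<exists>r. 0 < r \<and> r < 1 \<and> (\<forall>x\<in>A - {0}. N x = r powi v x))"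

lemma assoc_sign:
  assumes "assoc A v" "x \<in> A" "x \<noteq> 0"
  shows "N x \<le> 1 \<longleftrightarrow> v x \<ge> 0" "N x < 1 \<longleftrightarrow> v x > 0"
proof -
  obtain r where r: "0 < r" "r < 1" "N x = r powi v x" using assms by (auto simp: assoc_def)
  show "N x \<le> 1 \<longleftrightarrow> v x \<ge> 0" "N x < 1 \<longleftrightarrow> v x > 0"
    using powi_le_iff[OF r(1,2), of "v x" 0] powi_less_iff[OF r(1,2), of "v x" 0] r(3) by auto
qed

lemma assoc_uniformizer:
  assumes "assoc A v" "\<pi> \<in> A" "\<pi> \<noteq> 0" "v \<pi> = 1"
  shows "uniformizer A \<pi>"
proof -
  obtain r where r: "0 < r" "r < 1" "\<And>x. x \<in> A - {0} \<Longrightarrow> N x = r powi v x" using assms by (auto simp: assoc_def)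
  then have "N \<pi> = r" using assms by simp
  then show ?thesis using assms r by (auto simp: uniformizer_def)
qed

lemma assoc_ram_index:
  assumes v: "assoc A v" and w: "has_ram_index v B w e" and B: "B \<subseteq> A"
  shows "assoc B w"
proof -
  obtain r where r: "0 < r" "r < 1" "\<And>x. x \<in> A - {0} \<Longrightarrow> N x = r powi v x" using v by (auto simp: assoc_def)
  have e: "e > 0" "\<And>x. x \<in> B - {0} \<Longrightarrow> v x = int e * w x" using w by (auto simp: has_ram_index_def)
  have "N x = (r ^ e) powi w x" if x: "x \<in> B - {0}" for x
  proof -
    have "N x = r powi (int e * w x)" using r(3)[of x] e(2)[OF x] x B by auto
    then show ?thesis by (simp add: power_int_mult)
  qed
  moreover have "0 < r ^ e" "r ^ e < 1" using r e by (auto simp: power_less_one_iff)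
  ultimately show ?thesis unfolding assoc_def by blast
qed

lemma assoc_lies_over:
  assumes v: "assoc A v" and w: "assoc B w" "prime_valuation B w" and B: "subfield B Amb" "B \<subseteq> A"
  shows "lies_over v B w"
proof -
  obtain r where r: "0 < r" "r < 1" "\<And>x. x \<in> A - {0} \<Longrightarrow> N x = r powi v x" using v by (auto simp: assoc_def)
  obtain s where s: "0 < s" "s < 1" "\<And>x. x \<in> B - {0} \<Longrightarrow> N x = s powi w x" using w by (auto simp: assoc_def)
  obtain \<eta> where \<eta>: "\<eta> \<in> B" "\<eta> \<noteq> 0" "w \<eta> = 1" using pv_surj[OF w(2) B(1)] by blast
  define e where "e = v \<eta>"
  have se: "s = r powi e" using r(3)[of \<eta>] s(3)[of \<eta>] \<eta> B by (auto simp: e_def)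
  then have "e > 0" using powi_less_iff[OF r(1,2), of e 0] s by simp
  have "v x = int (nat e) * w x" if x: "x \<in> B - {0}" for x
  proof -
    have "r powi v x = r powi (e * w x)" using r(3)[of x] s(3)[OF x] x B se by (auto simp: power_int_mult)
    then have "v x = e * w x" using powi_inject[OF r(1,2)] by simp
    then show ?thesis using \<open>e > 0\<close> by simp
  qed
  then show ?thesis unfolding lies_over_def has_ram_index_def using \<open>e > 0\<close> by (intro exI[of _ "nat e"]) auto
qed

lemma infinite_prime_exists:
  assumes A: "subfield A Amb" "k_field \<subseteq> A" and \<pi>: "uniformizer A \<pi>"
  obtains v where "infinite_prime A v" "assoc A v"
proof (rule infinite_prime_of_uniformizer[OF A \<pi>])
  fix v assume v: "infinite_prime A v" "\<And>x. x \<in> A \<Longrightarrow> x \<noteq> 0 \<Longrightarrow> N x = N \<pi> powi v x"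
  have "0 < N \<pi>" "N \<pi> < 1" using \<pi> by (auto simp: uniformizer_def)
  moreover have "\<forall>x\<in>A - {0}. N x = N \<pi> powi v x" using v(2) by blast
  ultimately have "assoc A v" unfolding assoc_def by blast
  then show thesis by (rule that[OF v(1)])
qed

end

lemma infinite_prime_assoc:
  fixes A :: "'a::{field,finite} kbar set"
  assumes "infinite_prime A v" "subfield A Amb" "k_field \<subseteq> A"
  obtains N where "inf_absval N" "inf_absval.assoc N A v"
proof (rule infinite_prime_absval[OF assms])
  fix N and e :: nat assume N: "inf_absval N" "e > 0" "has_ram_index v k_field inf_val e" 
    "\<And>x. x \<in> A \<Longrightarrow> x \<noteq> 0 \<Longrightarrow> N x = 2 powr (- real_of_int (v x) / real e)"
  define r :: real where "r = 2 powr (- 1 / real e)"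
  have "0 < r" "r < 1" using N(2) powr_less_cancel_iff[of 2 "- 1 / real e" 0] by (auto simp: r_def)
  moreover have "N x = r powi v x" if "x \<in> A - {0}" for x
  proof -
    have "r powi v x = r powr real_of_int (v x)" by (rule powr_real_of_int'[symmetric]) (auto simp: r_def)
    then show ?thesis using N(4)[of x] that by (auto simp: r_def powr_powr)
  qed
  ultimately have "inf_absval.assoc N A v" unfolding inf_absval.assoc_def[OF N(1)] by blast
  then show thesis by (rule that[OF N(1)])
qed

context residue_one
begin

lemma val_ring_assoc: "assoc A v \<Longrightarrow> subfield A Amb \<Longrightarrow> val_ring A v = {x \<in> A. N x \<le> 1}"
  unfolding val_ring_def using assoc_sign(1)[of A v] N_0 by fastforce

lemma val_ideal_assoc: "assoc A v \<Longrightarrow> subfield A Amb \<Longrightarrow> val_ideal A v = {x \<in> A. N x < 1}"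
  unfolding val_ideal_def using assoc_sign(2)[of A v] N_0 by fastforce

text \<open>The map \<open>h\<close> is abstract because the count serves twice: for the residue
  field of the big field, and for the image in it of the residue field of the small one, whose
  cosets are formed in the big ring.\<close>

lemma card_residue_classes:
  assumes B: "subfield B Amb" "k_field \<subseteq> B" "B \<subseteq> Em"
    and h: "\<And>x y. x \<in> B \<Longrightarrow> y \<in> B \<Longrightarrow> N x \<le> 1 \<Longrightarrow> N y \<le> 1 \<Longrightarrow> h x = h y \<longleftrightarrow> N (x - y) < 1"
  shows "card (h ` {x \<in> B. N x \<le> 1}) = card (resset B)"
proof -
  have "\<exists>x\<in>B. N x \<le> 1 \<and> N (x - c) < 1" if c: "c \<in> resset B" for c
  proof -
    obtain x where x: "x \<in> B" "N (x - c) < 1" using c by (auto simp: resset_def)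
    have "N c \<le> 1" using c resset_subset N_Fqm_le[OF _ m_pos] by blast
    then have "N ((x - c) + c) \<le> 1" using x(2) by (intro N_add_le) auto
    then show ?thesis using x by auto
  qed
  then obtain l where l: "\<And>c. c \<in> resset B \<Longrightarrow> l c \<in> B \<and> N (l c) \<le> 1 \<and> N (l c - c) < 1" by metis
  have "h ` {x \<in> B. N x \<le> 1} = (\<lambda>c. h (l c)) ` resset B"
  proof (intro equalityI subsetI)
    fix y assume "y \<in> h ` {x \<in> B. N x \<le> 1}"
    then obtain x where x: "x \<in> B" "N x \<le> 1" "y = h x" by auto
    have "\<exists>c\<in>Fqm m. N (x - c) < 1" by (rule Em_residue) (use x B in auto)
    then obtain c where c: "c \<in> resset B" "N (x - c) < 1" using x by (auto simp: resset_def)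
    have "N (x - l c) < 1" using N_trans_less[OF c(2), of "l c"] l[OF c(1)] N_minus_commute[of c "l c"] by simp
    then have "h x = h (l c)" using h x l[OF c(1)] by blast
    then show "y \<in> (\<lambda>c. h (l c)) ` resset B" using x c by blast
  qed (use l in auto)
  moreover have "inj_on (\<lambda>c. h (l c)) (resset B)"
  proof (rule inj_onI)
    fix c d assume cd: "c \<in> resset B" "d \<in> resset B" "h (l c) = h (l d)"
    have "N (l c - l d) < 1" using h l cd by blast
    moreover have "N (c - l c) < 1" using l[OF cd(1)] N_minus_commute[of c "l c"] by simp
    ultimately have "N (c - l d) < 1" using N_trans_less by blast
    then have "N (c - d) < 1" using N_trans_less l[OF cd(2)] by blast
    moreover have "c - d \<in> Fqm m" using cd resset_subset by (intro sf_diff[OF subfield_Fqm]) auto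
    ultimately show "c = d" using N_Fqm_less[OF _ m_pos] by fastforce
  qed
  ultimately show ?thesis by (simp add: card_image)
qed

text \<open>The residue field of \<open>A\<close> is a finite field with
  \<open>card (resset A)\<close> elements, and the image of \<open>val_ring B w\<close> is a
  subfield with \<open>card (resset B)\<close> elements; comparing cardinalities gives the
  degree.\<close>

lemma inertia_degree_card:
  assumes A: "subfield A Amb" "A \<subseteq> Em" "assoc A v" and B: "subfield B Amb" "k_field \<subseteq> B" "B \<subseteq> A" "assoc B w"
  shows "card (resset A) = card (resset B) ^ inertia_degree A v B w"
proof -
  define V where "V = {x \<in> A. N x \<le> 1}"
  define I where "I = {x \<in> A. N x < 1}"
  define W where "W = {x \<in> B. N x \<le> 1}"
  define R where "R = (Amb :: 'a kbar ring)\<lparr>carrier := V\<rparr>"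
  have V: "val_ring A v = V" and I: "val_ideal A v = I" and W: "val_ring B w = W"
    using val_ring_assoc[OF A(3,1)] val_ideal_assoc[OF A(3,1)] val_ring_assoc[OF B(4,1)] by (simp_all add: V_def I_def W_def)
  have VI: "1 \<in> V" "0 \<in> V" "0 \<in> I" "I \<subseteq> V" "W \<subseteq> V" "1 \<in> W" "0 \<in> W"
    using sf_0[OF A(1)] sf_1[OF A(1)] sf_0[OF B(1)] sf_1[OF B(1)] B(3) by (auto simp: V_def I_def W_def)
  have Vc: "x + y \<in> V" "x * y \<in> V" "- x \<in> V" if "x \<in> V" "y \<in> V" for x y
    using that sf_add[OF A(1)] sf_mult[OF A(1)] sf_uminus[OF A(1)] by (auto simp: V_def N_add_le N_mult mult_le_one)
  have Wc: "x + y \<in> W" "x * y \<in> W" "- x \<in> W" if "x \<in> W" "y \<in> W" for x y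
    using that sf_add[OF B(1)] sf_mult[OF B(1)] sf_uminus[OF B(1)] by (auto simp: W_def N_add_le N_mult mult_le_one)
  have Ic: "x + y \<in> I" "- x \<in> I" if "x \<in> I" "y \<in> I" for x y
    using that sf_add[OF A(1)] sf_uminus[OF A(1)] by (auto simp: I_def N_add_less)
  have Im: "x * y \<in> I" if "x \<in> I" "y \<in> V" for x y
    using that sf_mult[OF A(1)] mult_left_mono[of "N y" 1 "N x"] by (auto simp: I_def V_def N_mult)
  have Rs: "carrier R = V" "\<zero>\<^bsub>R\<^esub> = 0" "\<one>\<^bsub>R\<^esub> = 1" "x \<otimes>\<^bsub>R\<^esub> y = x * y" "x \<oplus>\<^bsub>R\<^esub> y = x + y" for x y
    by (simp_all add: R_def)
  have "subring V Amb" by (rule Amb.subringI) (use VI Vc in auto)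
  then have "subcring V Amb" by (rule cring.subcringI'[OF cring_from_type_algebra])
  then have cring: "cring R" unfolding R_def using Amb.subcring_iff[of V] by simp
  interpret R: cring R by (rule cring)
  have ainv: "\<ominus>\<^bsub>R\<^esub> x = - x" if "x \<in> V" for x
    by (rule R.minus_equality) (use that Vc in \<open>auto simp: Rs\<close>)
  have ideal: "ideal I R"
  proof (rule idealI[OF R.ring_axioms])
    show "subgroup I (add_monoid R)"
    proof (rule subgroup.intro)
      show "inv\<^bsub>add_monoid R\<^esub> x \<in> I" if "x \<in> I" for x
        using ainv[of x] that Ic VI by (auto simp: a_inv_def)
    qed (use VI Ic in \<open>auto simp: Rs\<close>)
  qed (use Im in \<open>auto simp: Rs mult.commute\<close>)
  have N_lt: "N x = 1" if "x \<in> V" "x \<notin> I" for x using that by (auto simp: V_def I_def)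
  have maximal: "maximalideal I R"
  proof (rule maximalidealI[OF ideal])
    have "1 \<notin> I" by (simp add: I_def)
    then show "carrier R \<noteq> I" using VI by (auto simp: Rs)
  next
    fix J assume J: "ideal J R" "I \<subseteq> J" "J \<subseteq> carrier R"
    show "J = I \<or> J = carrier R"
    proof (cases "J \<subseteq> I")
      case True
      then show ?thesis using J by auto
    next
      case False
      then obtain x where x: "x \<in> J" "x \<notin> I" by auto
      then have xV: "x \<in> V" "N x = 1" using J N_lt by (auto simp: Rs)
      then have iV: "inverse x \<in> V" using sf_inverse[OF A(1)] by (auto simp: V_def N_inverse)
      have "x * inverse x \<in> J" using ideal.I_r_closed[OF J(1) x(1), of "inverse x"] iV by (simp add: Rs)
      moreover have "x \<noteq> 0" using xV by auto
      ultimately have "1 \<in> J" by simp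
      then show ?thesis using ideal.one_imp_carrier[OF J(1)] by (simp add: Rs)
    qed
  qed
  define Q where "Q = R Quot I"
  have Q: "residue_field A v = Q" unfolding residue_field_def V I Q_def R_def ..
  have field: "field Q" unfolding Q_def by (rule maximalideal.quotient_is_field[OF maximal cring])
  interpret Q: field Q by (rule field)
  define h where "h = (\<lambda>x. I +>\<^bsub>R\<^esub> x)"
  have h_eq: "h x = (\<lambda>i. i + x) ` I" for x by (auto simp: h_def a_r_coset_def r_coset_def Rs)
  have hom: "h \<in> ring_hom R Q" unfolding Q_def h_def by (rule ideal.rcos_ring_hom[OF ideal])
  have carrierQ: "carrier Q = h ` V" unfolding Q_def h_def FactRing_def A_RCOSETS_def' by (auto simp: Rs)
  have heq: "h x = h y \<longleftrightarrow> N (x - y) < 1" if "x \<in> A" "y \<in> A" for x y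
  proof
    assume "h x = h y"
    moreover have "x \<in> h x" using VI by (auto simp: h_eq image_iff)
    ultimately have "x \<in> (\<lambda>i. i + y) ` I" by (simp add: h_eq)
    then show "N (x - y) < 1" by (auto simp: I_def)
  next
    assume l: "N (x - y) < 1"
    have sub: "(\<lambda>i. i + x) ` I \<subseteq> (\<lambda>i. i + y) ` I" if "x - y \<in> I" for x y
    proof
      fix z assume "z \<in> (\<lambda>i. i + x) ` I"
      then obtain i where "i \<in> I" "z = i + x" by auto
      then have "i + (x - y) \<in> I" "z = (i + (x - y)) + y" using Ic(1) that by auto
      then show "z \<in> (\<lambda>i. i + y) ` I" by blast
    qed
    have d: "x - y \<in> I" "y - x \<in> I" using l N_minus_commute[of x y] that sf_diff[OF A(1)] by (auto simp: I_def)
    show "h x = h y" unfolding h_eq using sub[OF d(1)] sub[OF d(2)] by blast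
  qed
  have hh: "h (x + y) = h x \<oplus>\<^bsub>Q\<^esub> h y" "h (x * y) = h x \<otimes>\<^bsub>Q\<^esub> h y" if "x \<in> V" "y \<in> V" for x y
    using ring_hom_memE[OF hom] that by (auto simp: Rs)
  have h1: "h 1 = \<one>\<^bsub>Q\<^esub>" using ring_hom_memE(4)[OF hom] by (simp add: Rs)
  have h0: "h 0 = \<zero>\<^bsub>Q\<^esub>" using ring_hom_zero[OF hom R.ring_axioms Q.ring_axioms] by (simp add: Rs)
  have hneg: "\<ominus>\<^bsub>Q\<^esub> h x = h (- x)" if "x \<in> V" for x
    by (rule Q.minus_equality) (use that Vc hh[of "- x" x] h0 carrierQ in auto)
  have sub: "subfield (h ` W) Q"
  proof (rule Q.subfieldI')
    show "subring (h ` W) Q"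
    proof (rule Q.subringI)
      show "h ` W \<subseteq> carrier Q" using carrierQ VI by auto
      show "\<one>\<^bsub>Q\<^esub> \<in> h ` W" using h1 VI by (metis imageI)
      fix x assume "x \<in> h ` W"
      then obtain a where a: "a \<in> W" "x = h a" by auto
      then have "\<ominus>\<^bsub>Q\<^esub> x = h (- a)" using hneg VI by auto
      then show "\<ominus>\<^bsub>Q\<^esub> x \<in> h ` W" using Wc a by auto
      fix y assume "y \<in> h ` W"
      then obtain b where b: "b \<in> W" "y = h b" by auto
      have "a \<in> V" "b \<in> V" using a b VI by auto
      then have "x \<oplus>\<^bsub>Q\<^esub> y = h (a + b)" "x \<otimes>\<^bsub>Q\<^esub> y = h (a * b)" using hh a b by auto
      then show "x \<oplus>\<^bsub>Q\<^esub> y \<in> h ` W" "x \<otimes>\<^bsub>Q\<^esub> y \<in> h ` W" using Wc a b by auto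
    qed
    fix x assume "x \<in> h ` W - {\<zero>\<^bsub>Q\<^esub>}"
    then obtain a where a: "a \<in> W" "x = h a" "h a \<noteq> h 0" using h0 by auto
    have aV: "a \<in> V" using a VI by auto
    then have "N (a - 0) \<ge> 1" using heq[of a 0] a(3) sf_0[OF A(1)] by (auto simp: V_def)
    then have Na: "N a = 1" using aV by (simp add: V_def)
    then have iW: "inverse a \<in> W" "inverse a \<in> V" using a(1) aV sf_inverse[OF B(1)] sf_inverse[OF A(1)]
      by (auto simp: W_def V_def N_inverse)
    have "a * inverse a = 1" using Na by (metis N_0 right_inverse zero_neq_one)
    then have "x \<otimes>\<^bsub>Q\<^esub> h (inverse a) = \<one>\<^bsub>Q\<^esub>" using hh(2)[OF aV iW(2)] h1 a(2) by simp
    then have "inv\<^bsub>Q\<^esub> x = h (inverse a)"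
      using carrierQ aV iW(2) a(2) by (intro Q.comm_inv_char) auto
    then show "inv\<^bsub>Q\<^esub> x \<in> h ` W" using iW by auto
  qed
  have cA: "card (h ` V) = card (resset A)"
    unfolding V_def using A(2) B(2,3) by (intro card_residue_classes A(1)) (auto simp: heq)
  have cB: "card (h ` W) = card (resset B)"
    unfolding W_def using A(2) B(1-3) by (intro card_residue_classes B(1)) (auto simp: heq subset_iff)
  have "resset A \<noteq> {}" using VI sf_0[OF subfield_Fqm] sf_0[OF A(1)] by (auto simp: resset_def intro!: exI[of _ 0] bexI[of _ 0])
  then have "finite (carrier Q)" unfolding carrierQ using cA finite_resset by (metis card_eq_0_iff card.infinite)
  from Q.card_eq_power_dim[OF sub this]
  have "card (resset A) = card (resset B) ^ ring.dim Q (h ` W) (carrier Q)" using cA cB carrierQ by simp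
  then show ?thesis unfolding inertia_degree_def Q V I W h_def R_def .
qed

end

section \<open>The infinite primes of \<open>K\<close> and \<open>R K\<close>\<close>

lemma card_range_const: "card (range (const :: 'a::{field,finite} \<Rightarrow> 'a kbar)) = CARD('a)"
  by (rule card_image) (auto simp: inj_on_def)

context residue_one
begin

lemma resset_subfield_E:
  assumes "k_field \<subseteq> B" "B \<subseteq> E"
  shows "card (resset B) = CARD('a)"
proof -
  have "resset B = range const"
  proof (intro equalityI subsetI)
    fix c assume "c \<in> resset B"
    then obtain x where x: "c \<in> Fqm m" "x \<in> B" "N (x - c) < 1" by (auto simp: resset_def)
    have "N ((x - c) + c) \<le> 1" using x(3) N_Fqm_le[OF x(1) m_pos] by (intro N_add_le) auto
    then obtain a where "N (x - const a) < 1" using res_E[of x] x assms by auto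
    then have "N (c - const a) < 1" using N_trans_less[of c x 1 "const a"] x(3) N_minus_commute[of x c] by simp
    moreover have "c - const a \<in> Fqm m" using x(1) by (intro sf_diff[OF subfield_Fqm]) auto
    ultimately show "c \<in> range const" using N_Fqm_less[OF _ m_pos] by fastforce
  next
    fix c :: "'a kbar" assume "c \<in> range const"
    then obtain a where a: "c = const a" by blast
    have "const a \<in> B" using assms const_in_k by blast
    then show "c \<in> resset B" unfolding resset_def a by (intro CollectI conjI bexI[of _ "const a"]) simp_all
  qed
  then show ?thesis by (simp add: card_range_const)
qed

lemma resset_card:
  assumes "subfield A Amb" "k_field \<subseteq> A" "A \<subseteq> Em" "\<And>x. x \<in> A \<Longrightarrow> phi x \<in> A"
  obtains f where "card (resset A) = CARD('a) ^ f"
proof -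
  obtain B :: "'a kbar set" where B: "B \<subseteq> resset A" "Fq.independent B" "resset A \<subseteq> Fq.span B"
    by (rule Fq.basis_exists[of "resset A"])
  have "Fq.span B \<subseteq> resset A" by (rule Fq.span_minimal[OF B(1) subspace_resset[OF assms]])
  then have "Fq.span B = resset A" using B(3) by blast
  moreover have "finite B" using B(1) finite_resset finite_subset by blast
  ultimately show ?thesis using card_span_independent[OF _ B(2)] that by metis
qed

lemma Em_uniformizer:
  assumes A: "subfield A Amb" "k_field \<subseteq> A" "A \<subseteq> Em"
  obtains \<pi> where "uniformizer A \<pi>"
proof (rule uniformizer_exists[OF A(1) _ \<rho>])
  show "T_elem \<in> A" using A(2) T_in_k by blast
  show "\<exists>i. N x = \<rho> powi i" if "x \<in> A" "x \<noteq> 0" for x by (rule Em_discrete) (use that A in auto)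
qed (rule that)

lemma ram_index_mult_residue:
  assumes A: "subfield A Amb" "k_field \<subseteq> A" "A \<subseteq> Em" and phi: "\<And>x. x \<in> A \<Longrightarrow> phi x \<in> A"
    and ord: "\<And>i. 0 < i \<Longrightarrow> i < m \<Longrightarrow> \<exists>x\<in>A. (phi ^^ i) x \<noteq> x"
    and v: "infinite_prime A v" "assoc A v" and w: "infinite_prime (A \<inter> E) w" "has_ram_index v (A \<inter> E) w e"
    and t: "card (resset A) = CARD('a) ^ t"
  shows "e * t = m"
proof -
  have pv: "prime_valuation A v" "prime_valuation (A \<inter> E) w" using v w by (auto simp: infinite_prime_def)
  have sF: "subfield (A \<inter> E) Amb" by (rule subfield_Int[OF A(1) subfield_E])
  obtain \<pi> where \<pi>: "\<pi> \<in> A" "\<pi> \<noteq> 0" "v \<pi> = 1" using pv_surj[OF pv(1) A(1)] by blast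
  obtain \<eta> where \<eta>: "\<eta> \<in> A \<inter> E" "\<eta> \<noteq> 0" "w \<eta> = 1" using pv_surj[OF pv(2) sF] by blast
  obtain r where r: "\<And>x. x \<in> A - {0} \<Longrightarrow> N x = r powi v x" using v(2) by (auto simp: assoc_def)
  have v\<eta>: "v \<eta> = int e" using w(2) \<eta> by (simp add: has_ram_index_def)
  have N\<pi>: "N \<pi> = r" using r[of \<pi>] \<pi> by simp
  have "N \<eta> = N \<pi> ^ e" unfolding N\<pi> using r[of \<eta>] \<eta> v\<eta> by simp
  then show ?thesis
    by (intro local_degree[OF A phi ord assoc_uniformizer[OF v(2) \<pi>]
          assoc_uniformizer[OF assoc_ram_index[OF v(2) w(2)] \<eta>] _ t]) auto
qed

lemma phi_inverse: "x \<in> Em \<Longrightarrow> phi (inverse x) = inverse (phi x)"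
proof (cases "x = 0")
  case False
  assume x: "x \<in> Em"
  have "phi x * phi (inverse x) = 1" using Em_mult[OF x sf_inverse[OF subfield_Em x]] False phi_1 by simp
  then show ?thesis by (rule inverse_unique[symmetric])
qed (simp add: phi_0)

lemma phi_compositum:
  assumes A: "A \<subseteq> Em" "\<And>x. x \<in> A \<Longrightarrow> phi x \<in> compositum A B" and B: "B \<subseteq> Em" "\<And>x. x \<in> B \<Longrightarrow> phi x \<in> compositum A B"
    and x: "x \<in> compositum A B"
  shows "phi x \<in> compositum A B"
proof -
  note C = subfield_compositum[of A B]
  have "compositum A B \<subseteq> {x \<in> Em. phi x \<in> compositum A B}"
  proof (rule compositum_least)
    show "subfield {x \<in> Em. phi x \<in> compositum A B} Amb"
      by (rule subfieldI_Amb)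
        (auto simp: phi_1 phi_inverse Em_add Em_mult Em_uminus sf_1[OF C] sf_add[OF C] sf_mult[OF C] sf_uminus[OF C]
            sf_inverse[OF C] sf_inverse[OF subfield_Em])
  qed (use A B in auto)
  then show ?thesis using x by blast
qed

end

section \<open>The fields K, R and R K over the base E\<close>

locale residue_ext = residue_one N E m \<rho> + galois_ext K
  for N :: "'a::{field,finite} kbar \<Rightarrow> real" and E m \<rho> and K :: "'a kbar set" +
  assumes K_sub: "K \<subseteq> const_ext E m" and m_min: "\<And>m'. m' \<ge> 1 \<Longrightarrow> K \<subseteq> const_ext E m' \<Longrightarrow> m \<le> m'"
begin

lemma K_Em: "K \<subseteq> Em"
  using K_sub unfolding const_ext_eq_Em .

text \<open>\<open>K\<close> is normal over \<open>k_field\<close>, and \<open>phi\<close> is a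
  homomorphism on the larger field \<open>Em\<close> that fixes \<open>k_field\<close>.\<close>

lemma phi_K: "x \<in> K \<Longrightarrow> phi x \<in> K"
  by (rule hom_image_in_K[OF _ subfield_Em K_Em]) (use k_E in \<open>auto simp: Em_add Em_mult phi_E\<close>)

text \<open>If \<open>phi ^^ i\<close> fixed \<open>K\<close>, then \<open>K\<close> would lie in
  \<open>const_ext E i\<close>, against the minimality of \<open>m\<close>.\<close>

lemma order_K:
  assumes "0 < i" "i < m"
  shows "\<exists>x\<in>K. (phi ^^ i) x \<noteq> x"
proof (rule ccontr)
  assume "\<not> ?thesis"
  then have "K \<subseteq> const_ext E i" using fixed_in_const_ext[of _ i] K_Em assms by auto
  then show False using m_min[of i] assms by auto
qed

definition Km :: "'a kbar set" where "Km = const_ext K m"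
definition R :: "'a kbar set" where "R = Km \<inter> E"
definition M :: "'a kbar set" where "M = compositum R K"

lemma subfields: "subfield Km Amb" "subfield R Amb" "subfield M Amb"
  unfolding M_def R_def Km_def const_ext_def by (auto intro: subfield_Int subfield_compositum subfield_E)

lemma inclusions: "K \<subseteq> Km" "Fqm m \<subseteq> Km" "Km \<subseteq> Em" "R \<subseteq> M" "K \<subseteq> M" "M \<subseteq> Km" "k_field \<subseteq> Km" "k_field \<subseteq> R" "k_field \<subseteq> M" "M \<subseteq> Em"
proof -
  show K: "K \<subseteq> Km" and "Fqm m \<subseteq> Km" unfolding Km_def const_ext_def by (rule compositum_left, rule compositum_right)
  show Km: "Km \<subseteq> Em" unfolding Km_def const_ext_def by (rule compositum_least[OF subfield_Em K_Em Fqm_subset_Em])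
  show "R \<subseteq> M" and KM: "K \<subseteq> M" unfolding M_def by (rule compositum_left, rule compositum_right)
  show M: "M \<subseteq> Km" unfolding M_def by (rule compositum_least[OF subfields(1) _ K]) (auto simp: R_def)
  show "k_field \<subseteq> Km" "k_field \<subseteq> R" "k_field \<subseteq> M" using k_K K k_E KM by (auto simp: R_def)
  show "M \<subseteq> Em" using M Km by blast
qed

lemma M_Int_E: "M \<inter> E = R"
  using inclusions(4,6) by (auto simp: R_def)

lemma phi_Km: "x \<in> Km \<Longrightarrow> phi x \<in> Km"
  unfolding Km_def const_ext_def
proof (rule phi_compositum[OF K_Em _ Fqm_subset_Em])
  show "phi x \<in> compositum K (Fqm m)" if "x \<in> K" for x using phi_K[OF that] compositum_left by blast
  show "phi x \<in> compositum K (Fqm m)" if "x \<in> Fqm m" for x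
    using phi_Fqm[OF that] sf_power[OF subfield_Fqm that] compositum_right[of "Fqm m" K] by auto
qed

lemma phi_M: "x \<in> M \<Longrightarrow> phi x \<in> M"
  unfolding M_def
proof (rule phi_compositum[OF _ _ K_Em])
  show "R \<subseteq> Em" using inclusions by blast
  show "phi x \<in> compositum R K" if "x \<in> R" for x using that phi_E[of x] compositum_left[of R K] by (auto simp: R_def)
  show "phi x \<in> compositum R K" if "x \<in> K" for x using phi_K[OF that] compositum_right by blast
qed

lemma order_M: "0 < i \<Longrightarrow> i < m \<Longrightarrow> \<exists>x\<in>M. (phi ^^ i) x \<noteq> x"
  using order_K inclusions(5) by blast

text \<open>\<open>Km\<close> contains \<open>Fqm m\<close>, so the trace argument applies there:
  the value of a uniformizer of \<open>M\<close> is attained in \<open>Km \<inter> E = R\<close>.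
  Hence \<open>M\<close> over \<open>R\<close> has ramification index 1, and
  \<open>local_degree\<close> leaves \<open>m\<close> for the residue degree.\<close>

lemma resset_M: "card (resset M) = CARD('a) ^ m"
proof -
  obtain f where f: "card (resset M) = CARD('a) ^ f"
    using resset_card[OF subfields(3) inclusions(9,10) phi_M] by blast
  obtain \<pi> where \<pi>: "uniformizer M \<pi>" using Em_uniformizer[OF subfields(3) inclusions(9,10)] by blast
  then have p: "\<pi> \<in> M" "\<pi> \<noteq> 0" by (auto simp: uniformizer_def)
  obtain r where r: "r \<in> Km \<inter> E" "r \<noteq> 0" "N r = N \<pi>"
    using value_in_E[OF subfields(1) inclusions(7,3) phi_Km inclusions(2) _ p(2)] p(1) inclusions(6) by blast
  have "uniformizer (M \<inter> E) r"
    unfolding M_Int_E using r \<pi> inclusions(4) unfolding uniformizer_def R_def[symmetric] by auto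
  from local_degree[OF subfields(3) inclusions(9,10) phi_M order_M \<pi> this _ f, of 1] r(3) have "f = m" by simp
  then show ?thesis using f by simp
qed

end

text \<open>One actual pair of primes is required: for a vacuous quantification every number would
  satisfy the description, and \<open>THE\<close> would be undetermined.\<close>

lemma f_infI:
  assumes "infinite_prime A v" "infinite_prime B w" "lies_over v B w"
    and "\<And>v w. infinite_prime A v \<Longrightarrow> infinite_prime B w \<Longrightarrow> lies_over v B w \<Longrightarrow> inertia_degree A v B w = f"
  shows "f_inf A B = f"
  unfolding f_inf_def using assms by (intro the_equality) blast+

lemma e_infI:
  assumes "infinite_prime A v" "infinite_prime B w" "lies_over v B w"
    and "\<And>v w. infinite_prime A v \<Longrightarrow> infinite_prime B w \<Longrightarrow> lies_over v B w \<Longrightarrow> ram_index v B w = e"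
  shows "e_inf A B = e"
  unfolding e_inf_def using assms by (intro the_equality) blast+

lemma ram_index_eq:
  assumes B: "subfield B Amb" and w: "prime_valuation B w" and e: "has_ram_index v B w e"
  shows "ram_index v B w = e"
  unfolding ram_index_def
proof (rule the_equality)
  show "has_ram_index v B w e" by (rule e)
next
  fix e' assume "has_ram_index v B w e'"
  moreover obtain x where "x \<in> B" "x \<noteq> 0" "w x = 1" using pv_surj[OF w B] by blast
  ultimately show "e' = e" using e by (fastforce simp: has_ram_index_def)
qed

text \<open>An automorphism \<sigma> carries one prime to the other, but representatives in
  \<open>Fqm m\<close> need not lie in \<open>K\<close>; each is lifted to \<open>K\<close>, moved
  by \<sigma> and reduced again. Congruent images force congruent originals, so the map is
  injective, and equality follows by exchanging the two primes.\<close>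

lemma card_resset_le:
  assumes N: "residue_ext N E m \<rho> K" and N': "residue_ext N' E m \<rho>' K"
    and v: "infinite_prime K v" "inf_absval.assoc N K v" and w: "infinite_prime K w" "inf_absval.assoc N' K w"
  shows "card (residue_one.resset N' m K) \<le> card (residue_one.resset N m K)"
proof -
  interpret N: residue_ext N E m \<rho> K by (rule N)
  interpret N': residue_ext N' E m \<rho>' K by (rule N')
  obtain \<sigma> where \<sigma>: "\<sigma> \<in> Gal K k_field" "\<And>x. x \<in> K \<Longrightarrow> x \<noteq> 0 \<Longrightarrow> w x = v (\<sigma> x)"
    using N.infinite_primes_conjugate[OF v(1) w(1)] by blast
  have less: "N' x < 1 \<longleftrightarrow> N (\<sigma> x) < 1" and le: "N' x \<le> 1 \<longleftrightarrow> N (\<sigma> x) \<le> 1" if "x \<in> K" for x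
    using that N'.assoc_sign[OF w(2), of x] N.assoc_sign[OF v(2), of "\<sigma> x"] \<sigma>(2)[of x]
      N.Gal_hom(1)[OF \<sigma>(1)] N.Gal_nonzero[OF \<sigma>(1)] N.Gal_0[OF \<sigma>(1)] by (cases "x = 0"; force)+
  have "\<exists>x\<in>K. N' x \<le> 1 \<and> N' (x - c) < 1" if c: "c \<in> N'.resset K" for c
  proof -
    obtain x where x: "x \<in> K" "N' (x - c) < 1" "c \<in> Fqm m" using c by (auto simp: N'.resset_def)
    have "N' ((x - c) + c) \<le> 1" using x N'.N_Fqm_le[OF x(3) N'.m_pos] by (intro N'.N_add_le) auto
    then show ?thesis using x by auto
  qed
  then obtain l where l: "\<And>c. c \<in> N'.resset K \<Longrightarrow> l c \<in> K \<and> N' (l c) \<le> 1 \<and> N' (l c - c) < 1" by metis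
  have "\<exists>d. d \<in> N.resset K \<and> N (\<sigma> (l c) - d) < 1" if c: "c \<in> N'.resset K" for c
  proof -
    have s: "\<sigma> (l c) \<in> K" "N (\<sigma> (l c)) \<le> 1" using l[OF c] le N.Gal_hom(1)[OF \<sigma>(1)] by auto
    obtain d where "d \<in> N.resset K" "N (\<sigma> (l c) - d) < 1"
      by (rule N.resset_residue[OF N.subfield_K N.k_K N.K_Em N.phi_K s])
    then show ?thesis by blast
  qed
  then obtain g where g: "\<And>c. c \<in> N'.resset K \<Longrightarrow> g c \<in> N.resset K \<and> N (\<sigma> (l c) - g c) < 1" by metis
  have "inj_on g (N'.resset K)"
  proof (rule inj_onI)
    fix c d assume cd: "c \<in> N'.resset K" "d \<in> N'.resset K" "g c = g d"
    have lc: "l c \<in> K" "l d \<in> K" "l c - l d \<in> K" using l cd sf_diff[OF N.subfield_K] by auto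
    have "N (\<sigma> (l c) - g c) < 1" "N (g c - \<sigma> (l d)) < 1"
      using g[OF cd(1)] g[OF cd(2)] N.N_minus_commute[of "g d" "\<sigma> (l d)"] unfolding cd(3) by simp_all
    then have "N (\<sigma> (l c) - \<sigma> (l d)) < 1" by (rule N.N_trans_less)
    moreover have "\<sigma> (l c) = \<sigma> (l c - l d) + \<sigma> (l d)" using N.Gal_hom(2)[OF \<sigma>(1) lc(3,2)] by simp
    ultimately have "N' (l c - l d) < 1" using less[OF lc(3)] by simp
    moreover have "N' (c - l c) < 1" "N' (l d - d) < 1" using l cd N'.N_minus_commute[of c] by auto
    ultimately have "N' (c - d) < 1" using N'.N_trans_less by blast
    moreover have "c - d \<in> Fqm m" using cd N'.resset_subset by (intro sf_diff[OF subfield_Fqm]) auto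
    ultimately show "c = d" using N'.N_Fqm_less[OF _ N'.m_pos] by fastforce
  qed
  then show ?thesis using g N.finite_resset by (intro card_inj_on_le[of g]) auto
qed

text \<open>All residue degrees are read from three cardinalities: \<open>q\<close> for the residue
  fields of \<open>k\<close> and \<open>F\<close>, \<open>q ^ t\<close> for \<open>K\<close> and
  \<open>q ^ m\<close> for \<open>R K\<close>. The ramification index of \<open>K\<close> over
  \<open>F\<close> then follows from \<open>e * t = m\<close>.\<close>

theorem theorem3p5:
  fixes K F R :: "'a::{field,finite} kbar set"
    and N :: "'a poly"
    and n m t d :: nat
  assumes K: "finite_abelian_extension K k_field"
    and N: "N \<noteq> 0"
    and m_pos: "m \<ge> 1"
    and K_sub: "K \<subseteq> const_ext (nk_field n N) m"
    and m_min: "\<And>m'. m' \<ge> 1 \<Longrightarrow> K \<subseteq> const_ext (nk_field n N) m' \<Longrightarrow> m \<le> m'"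
    and F: "F = K \<inter> nk_field n N"
    and t: "t = f_inf K k_field"
    and R: "R = const_ext K m \<inter> nk_field n N"
    and d: "d = f_inf (compositum R K) K"
  shows "t = f_inf K F
    \<and> m = t * e_inf K F
    \<and> m = t * d
    \<and> m = f_inf (compositum R K) k_field
    \<and> d = e_inf K F"
proof -
  define E where "E = nk_field n N"
  define M where "M = compositum R K"
  \<comment> \<open>Any absolute value at infinity provides the whole local setting for
    \<open>E\<close> and \<open>K\<close>, so each statement below can be proved prime by
    prime.\<close>
  have loc: "residue_ext \<nu> E m (\<nu> (torsion_gen n)) K" if "inf_absval \<nu>" for \<nu>
  proof -
    interpret inf_absval \<nu> by (rule that)
    have "residue_one \<nu> E m (\<nu> (torsion_gen n))"
      unfolding E_def
    proof (intro residue_one.intro residue_one_axioms.intro)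
      show "inf_absval \<nu>" by (rule that)
      show "subfield (nk_field n N) Amb" "k_field \<subseteq> nk_field n N" by (rule subfield_nk_field, rule k_subset_nk_field)
      show "0 < \<nu> (torsion_gen n)" "\<nu> (torsion_gen n) < 1" using small[of n] by simp_all
      show "1 \<le> m" by (rule m_pos)
    qed (use nk_field_residue[OF N] nk_field_discrete[OF N] in blast)+
    then show ?thesis
      using K K_sub m_min unfolding residue_ext_def residue_ext_axioms_def galois_ext_def E_def by blast
  qed
  \<comment> \<open>The infinite prime of \<open>k_field\<close> itself supplies one absolute value,
    from which the existence of primes of the other fields follows.\<close>
  have "infinite_prime k_field (inf_val :: 'a kbar \<Rightarrow> int)"
    using prime_valuation_inf_val unfolding infinite_prime_def lies_over_def has_ram_index_def
    by (auto intro: exI[of _ 1])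
  then obtain \<nu>0 :: "'a kbar \<Rightarrow> real" where \<nu>0: "inf_absval \<nu>0"
    using infinite_prime_assoc[OF _ subfield_k order_refl] by blast
  interpret N0: residue_ext \<nu>0 E m "\<nu>0 (torsion_gen n)" K by (rule loc[OF \<nu>0])
  have subs: "subfield M Amb" "subfield K Amb" "subfield F Amb" "k_field \<subseteq> M" "k_field \<subseteq> K" "k_field \<subseteq> F" "F \<subseteq> K" "K \<subseteq> M" "F \<subseteq> E" "M \<subseteq> N0.Em"
    "N0.M = M"
  proof -
    show M: "N0.M = M" by (simp only: N0.M_def N0.R_def N0.Km_def M_def R flip: E_def)
    show "subfield M Amb" "k_field \<subseteq> M" "K \<subseteq> M" "M \<subseteq> N0.Em" using N0.subfields N0.inclusions M by auto
    show "subfield K Amb" "k_field \<subseteq> K" by (rule N0.subfield_K, rule N0.k_K)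
    show "subfield F Amb" "k_field \<subseteq> F" "F \<subseteq> K" "F \<subseteq> E" unfolding F
      using N0.k_K N0.k_E N0.subfield_K N0.subfield_E subfield_Int by (auto simp: E_def)
  qed
  have KEm: "K \<subseteq> N0.Em" using subs by blast
  have pairs: "\<exists>v w. infinite_prime A v \<and> infinite_prime B w \<and> lies_over v B w"
    if A: "subfield A Amb" "A \<subseteq> M" and B: "subfield B Amb" "k_field \<subseteq> B" "B \<subseteq> A" for A B
  proof -
    have kA: "k_field \<subseteq> A" "A \<subseteq> N0.Em" "B \<subseteq> N0.Em" using A B subs by auto
    obtain \<pi> where \<pi>: "N0.uniformizer A \<pi>" using N0.Em_uniformizer[OF A(1) kA(1,2)] by blast
    obtain v where v: "infinite_prime A v" "N0.assoc A v" using N0.infinite_prime_exists[OF A(1) kA(1) \<pi>] by blast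
    obtain \<eta> where \<eta>: "N0.uniformizer B \<eta>" using N0.Em_uniformizer[OF B(1,2) kA(3)] by blast
    obtain w where w: "infinite_prime B w" "N0.assoc B w" using N0.infinite_prime_exists[OF B(1,2) \<eta>] by blast
    then have "lies_over v B w" using N0.assoc_lies_over[OF v(2) w(2) _ B(1,3)] by (simp add: infinite_prime_def)
    then show ?thesis using v w by blast
  qed
  obtain t0 where t0: "card (N0.resset K) = CARD('a) ^ t0"
    using N0.resset_card[OF subs(2,5) KEm N0.phi_K] by blast
  have prime_K: "\<exists>v. infinite_prime K v \<and> inf_absval.assoc \<nu> K v" if \<nu>: "inf_absval \<nu>" for \<nu> :: "'a kbar \<Rightarrow> real"
  proof -
    interpret N1: residue_ext \<nu> E m "\<nu> (torsion_gen n)" K by (rule loc[OF \<nu>])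
    obtain \<pi> where \<pi>: "N1.uniformizer K \<pi>" by (rule N1.Em_uniformizer[OF subs(2,5) N1.K_Em])
    show ?thesis by (rule N1.infinite_prime_exists[OF subs(2,5) \<pi>]) (intro exI conjI)
  qed
  \<comment> \<open>Each absolute value gives a prime of \<open>K\<close>; conjugacy of these primes
    makes the exponent \<open>t0\<close> the same for all.\<close>
  have const_t: "card (residue_one.resset \<nu> m K) = CARD('a) ^ t0" if \<nu>: "inf_absval \<nu>" for \<nu> :: "'a kbar \<Rightarrow> real"
  proof -
    obtain v where v: "infinite_prime K v" "inf_absval.assoc \<nu>0 K v" using prime_K[OF \<nu>0] by blast
    obtain w where w: "infinite_prime K w" "inf_absval.assoc \<nu> K w" using prime_K[OF \<nu>] by blast
    show ?thesis
      using card_resset_le[OF loc[OF \<nu>0] loc[OF \<nu>] v w] card_resset_le[OF loc[OF \<nu>] loc[OF \<nu>0] w v] t0 by simp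
  qed
  have q: "CARD('a) ^ a = CARD('a) ^ b \<longleftrightarrow> a = b" for a b
    using power_inject_exp[OF card_gt_1[where 'a = 'a]] .
  \<comment> \<open>The absolute value is built from the given \<open>v\<close>; since
    \<open>v\<close> lies over \<open>w\<close>, it is associated with \<open>w\<close> too.\<close>
  have inertia: "\<exists>\<nu>. inf_absval \<nu> \<and> inf_absval.assoc \<nu> A v \<and> inf_absval.assoc \<nu> B w \<and>
      card (residue_one.resset \<nu> m A) = card (residue_one.resset \<nu> m B) ^ inertia_degree A v B w"
    if A: "subfield A Amb" "A \<subseteq> M" and B: "subfield B Amb" "k_field \<subseteq> B" "B \<subseteq> A"
      and v: "infinite_prime A v" and w: "infinite_prime B w" "lies_over v B w" for A B v w
  proof -
    have kA: "k_field \<subseteq> A" using B by blast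
    obtain \<nu> where \<nu>: "inf_absval \<nu>" "inf_absval.assoc \<nu> A v" by (rule infinite_prime_assoc[OF v A(1) kA])
    interpret N1: residue_ext \<nu> E m "\<nu> (torsion_gen n)" K by (rule loc[OF \<nu>(1)])
    have "N1.M = M" by (simp only: N1.M_def N1.R_def N1.Km_def M_def R flip: E_def)
    then have AEm: "A \<subseteq> N1.Em" using N1.inclusions(10) A(2) by blast
    have wB: "N1.assoc B w" using w(2) N1.assoc_ram_index[OF \<nu>(2) _ B(3)] by (auto simp: lies_over_def)
    show ?thesis using N1.inertia_degree_card[OF A(1) AEm \<nu>(2) B wB] \<nu> wB by blast
  qed
  have small_card: "card (residue_one.resset \<nu> m B) = CARD('a)" if "inf_absval \<nu>" "k_field \<subseteq> B" "B \<subseteq> E" for \<nu> B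
  proof -
    interpret N1: residue_ext \<nu> E m "\<nu> (torsion_gen n)" K by (rule loc[OF that(1)])
    show ?thesis by (rule N1.resset_subfield_E[OF that(2,3)])
  qed
  have M_card: "card (residue_one.resset \<nu> m M) = CARD('a) ^ m" if "inf_absval \<nu>" for \<nu>
  proof -
    interpret N1: residue_ext \<nu> E m "\<nu> (torsion_gen n)" K by (rule loc[OF that])
    have "N1.M = M" by (simp only: N1.M_def N1.R_def N1.Km_def M_def R flip: E_def)
    then show ?thesis using N1.resset_M by simp
  qed
  have kE: "k_field \<subseteq> E" by (rule N0.k_E)
  have f_inf_eqI: "f_inf A B = f" if A: "subfield A Amb" "A \<subseteq> M" and B: "subfield B Amb" "k_field \<subseteq> B" "B \<subseteq> A"
    and f: "\<And>\<nu> g. inf_absval \<nu> \<Longrightarrow> card (residue_one.resset \<nu> m A) = card (residue_one.resset \<nu> m B) ^ g \<Longrightarrow> g = f" for A B f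
  proof -
    obtain v w where vw: "infinite_prime A v" "infinite_prime B w" "lies_over v B w" using pairs[OF A B] by blast
    show ?thesis by (rule f_infI[OF vw]) (use inertia[OF A B] f in blast)
  qed
  have fKk: "f_inf K k_field = t0"
    by (rule f_inf_eqI) (use subs subfield_k kE const_t small_card q in auto)
  have fKF: "f_inf K F = t0"
    by (rule f_inf_eqI) (use subs const_t small_card q in auto)
  have fMk: "f_inf M k_field = m"
    by (rule f_inf_eqI) (use subs subfield_k kE M_card small_card q in auto)
  have ram: "ram_index v F w * t0 = m" if v: "infinite_prime K v" and w: "infinite_prime F w" "lies_over v F w" for v w
  proof -
    obtain e where e: "has_ram_index v F w e" using w(2) by (auto simp: lies_over_def)
    obtain \<nu> where \<nu>: "inf_absval \<nu>" "inf_absval.assoc \<nu> K v" by (rule infinite_prime_assoc[OF v subs(2,5)])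
    interpret N1: residue_ext \<nu> E m "\<nu> (torsion_gen n)" K by (rule loc[OF \<nu>(1)])
    have FE: "F = K \<inter> E" unfolding F E_def ..
    have "e * t0 = m"
      by (rule N1.ram_index_mult_residue[OF subs(2,5) N1.K_Em N1.phi_K N1.order_K v \<nu>(2) w(1)[unfolded FE] e[unfolded FE] const_t[OF \<nu>(1)]])
    then show ?thesis using ram_index_eq[OF subs(3) _ e] w(1) by (simp add: infinite_prime_def)
  qed
  obtain v1 w1 where vw1: "infinite_prime K v1" "infinite_prime F w1" "lies_over v1 F w1"
    using pairs[OF subs(2,8,3,6,7)] by blast
  have t0_pos: "t0 > 0" using ram[OF vw1] m_pos by (cases t0) auto
  have eKF: "e_inf K F = ram_index v1 F w1"
    by (rule e_infI[OF vw1]) (use ram[OF vw1] ram t0_pos in \<open>metis mult_cancel2 neq0_conv\<close>)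
  then have et: "e_inf K F * t0 = m" using ram[OF vw1] by simp
  have fMK: "f_inf M K = e_inf K F"
  proof (rule f_inf_eqI)
    fix \<nu> g assume \<nu>: "inf_absval \<nu>" and "card (residue_one.resset \<nu> m M) = card (residue_one.resset \<nu> m K) ^ g"
    \<comment> \<open>The residue degree \<open>g\<close> of \<open>R K\<close> over
      \<open>K\<close> satisfies \<open>t0 * g = m\<close>, the same equation as the ramification
      index of \<open>K\<close> over \<open>F\<close>.\<close>
    then have "CARD('a) ^ m = CARD('a) ^ (t0 * g)" using M_card[OF \<nu>] const_t[OF \<nu>] by (simp add: power_mult)
    then have "e_inf K F * t0 = g * t0" using q et by (simp add: mult.commute)
    then show "g = e_inf K F" using t0_pos by simp
  qed (use subs in auto)
  show ?thesis
    using fKk fKF fMk fMK et t d by (simp add: M_def mult.commute)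
qed

end
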